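(* Up to similarity, the time-like surfaces in Minkowski space $\mathbb R^3_1$ whose curvatures $K$, $H$ and $H'$ satisfy a linear relation $$\delta K=\alpha H+\beta H'+\gamma,\qquad \alpha,\beta,\gamma,\delta\ \text{constants},\quad \alpha^2-\beta^2+4\gamma\delta\neq0,$$ are described by the natural PDE's of the following basic surfaces: (1) $H=0$: $\ \nu=e^{\lambda}$, $\ \bar\Delta\lambda=e^{\lambda}$; (2) $H=\frac12$: $\ \nu=\frac12(1-e^{\lambda})$, $\ \bar\Delta\lambda=\sinh\lambda$; (3) $H'=1$: $\ \bar\Delta^*(e^{\nu})=2\nu(\nu+2)$; (4) $H=\beta H'$ ($\beta^2>1$): $\ \bar\Delta^*(\nu^{\beta})=2\,\frac{\beta(\beta+1)}{(\beta-1)^2}\,\nu$; (5) $H=\beta H'$ ($\beta^2<1$, $\beta\neq0$): $\ \Delta^*(\nu^{\beta})=2\,\frac{\beta(\beta+1)}{(\beta-1)^2}\,\nu$; (6) $H=\beta H'+1$ ($\beta^2>1$): $\ \nu=\frac{(\beta-1)\lambda+2}{2}$, $\ \bar\Delta^*(\lambda^{\beta})=\frac{\beta((\beta-1)\lambda+2)((\beta+1)\lambda+2)}{2(\beta-1)\lambda}$; (7) $H=\beta H'+1$ ($\beta^2<1$, $\beta\neq0$): $\ \nu=\frac{(\beta-1)\lambda+2}{2}$, $\ \Delta^*(\lambda^{\beta})=\frac{\beta((\beta-1)\lambda+2)((\beta+1)\lambda+2)}{2(\beta-1)\lambda}$; (8) $K=-1$: $\ \nu=\tan\frac{\lambda}{2}$,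 $\ \Delta\lambda=-\sin\lambda$; (9) $K=2H'$: $\ \nu=\frac{\lambda-4}{\lambda-2}$, $\ \bar\Delta^*(e^{\lambda})=2$; (10) $K=\beta H'+\gamma$ ($\beta\neq0$, $\gamma<0$): $\ \nu=\lambda+\frac{\beta}{2}$, $\ \mathcal I=\frac{1}{\sqrt{-\gamma}}\arctan\frac{\lambda}{\sqrt{-\gamma}}$, $\ \bar\Delta^*(e^{\beta\mathcal I})=-\frac{\beta\gamma}{2}\,\frac{\lambda(\beta\lambda+2\gamma)}{\lambda^2-\gamma}$.
   Context: $\mathbb R^3_1$ is $\mathbb R^3$ with the flat metric $\langle x,y\rangle=x_1y_1+x_2y_2-x_3y_3$. Functions are assumed sufficiently smooth. For a time-like surface $z=z(u,v)$ let $l$ be the unit normal field, $\langle l,l\rangle=1$, and $E=\langle z_u,z_u\rangle<0$, $F=\langle z_u,z_v\rangle$, $G=\langle z_v,z_v\rangle>0$, $L=\langle l,z_{uu}\rangle$, $M=\langle l,z_{uv}\rangle$, $N=\langle l,z_{vv}\rangle$. Parameters are principal if $F=M=0$; then the principal curvatures are $\nu_1=L/E$, $\nu_2=N/G$ and $K=\nu_1\nu_2$, $H=\frac12(\nu_1+\nu_2)$, $H'=\frac12(\nu_1-\nu_2)$ (so $H'^2=H^2-K$). All surfaces considered have real distinct principal curvatures ($H^2-K>0$) and are W-surfaces: there are differentiable functions $f(\nu),g(\nu)$, $\nu\in\mathcal I$ (an interval), with $f-g\ne0$, $f'g'\neq0$, and a function $\nu=\nu(u,v)$ such that $\nu_1=f(\nu)$,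 $\nu_2=g(\nu)$. Principal parameters $(u,v)$ on a W-surface are natural principal if both $\sqrt{-E}\,\exp\left(\int\frac{f'd\nu}{f-g}\right)$ and $\sqrt G\,\exp\left(\int\frac{g'd\nu}{g-f}\right)$ are constant; every W-surface locally admits such parameters, and they are determined up to affine changes of each parameter. The natural PDE of a W-surface in natural principal parameters is the equation for $\nu=\nu(u,v)$ $$\mathfrak a^2\exp\left(2\int_{\nu_0}^{\nu}\frac{f'd\nu}{f-g}\right)\left[g'\nu_{uu}+\left(g''-\frac{2g'^2}{g-f}\right)\nu_u^2\right]+\mathfrak b^2\exp\left(2\int_{\nu_0}^{\nu}\frac{g'd\nu}{g-f}\right)\left[f'\nu_{vv}+\left(f''-\frac{2f'^2}{f-g}\right)\nu_v^2\right]=fg(f-g),$$ where $\mathfrak a,\mathfrak b>0$ and $\nu_0$ are constants; natural parameters can be rescaled so that $\mathfrak a,\mathfrak b$ take any prescribed positive values. Equations are identified when they differ by a nowhere vanishing factor. A parallel surface of $\mathcal M$ is $\bar z=z+a\,l$, $a=\mathrm{const}\neq0$, at points with $(1-a\nu_1)(1-a\nu_2)\neq0$; a time-like W-surface and its parallel surfaces have the same natural PDE. "Are described by the natural PDE's of the basic surfaces" means: every surface in the class is, up to similarity, locally parallel to or coincident with one of the basic surfaces (1)-(10), and, with an appropriate choice of the constants $\mathfrak a,\mathfrak b,\nu_0$, the natural PDE is the one listed for that basic surface, written for the listed unknown ($\lambda$ or $\nu$). In (1)-(7) the parameter is $\nu=\nu_2$ (with $\lambda=2H'>0$ in (6), (7));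 in (8)-(10) the parameter is $\nu=\nu_1+\frac{\beta}{2}$ (with $\beta=0$ in (8) and $\beta=2$ in (9)). Powers $\nu^\beta,\lambda^\beta$ are considered where the base is positive. The operators are (with $(x,y)=(u,v)$) $\Delta\lambda=\lambda_{xx}+\lambda_{yy}$, $\bar\Delta\lambda=\lambda_{xx}-\lambda_{yy}$, $\Delta^*\lambda=\lambda_{xx}+(\lambda^{-1})_{yy}$, $\bar\Delta^*\lambda=\lambda_{xx}-(\lambda^{-1})_{yy}$.
   Formalization: For surfaces reducing to (2) or (7) with H'<0 only membership in the class is claimed, as the listed unknown λ does not exist; if α²+4γδ<0, the claim is made on an open dense set containing all points where the parallel surface at distance -α/(2γ) is regular. *)

theory Defs
  imports "HOL-Analysis.Analysis"
begin

definition du :: "(real \<times> real \<Rightarrow> 'a::real_normed_vector) \<Rightarrow> real \<times> real \<Rightarrow> 'a" where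
  "du h p = vector_derivative (\<lambda>s. h (s, snd p)) (at (fst p))"

definition dv :: "(real \<times> real \<Rightarrow> 'a::real_normed_vector) \<Rightarrow> real \<times> real \<Rightarrow> 'a" where
  "dv h p = vector_derivative (\<lambda>t. h (fst p, t)) (at (snd p))"

text \<open>Class \<open>C\<^sup>k\<close>; meaningful only for open \<open>S\<close>.\<close>

fun Ck_on :: "nat \<Rightarrow> (real \<times> real) set \<Rightarrow> (real \<times> real \<Rightarrow> 'a::real_normed_vector) \<Rightarrow> bool" where
  "Ck_on 0 S h \<longleftrightarrow> continuous_on S h"
| "Ck_on (Suc k) S h \<longleftrightarrow>
     (\<forall>p\<in>S. h differentiable at p) \<and> Ck_on k S (du h) \<and> Ck_on k S (dv h)"

definition smooth2_on :: "(real \<times> real) set \<Rightarrow> (real \<times> real \<Rightarrow> 'a::real_normed_vector) \<Rightarrow> bool" where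
  "smooth2_on S h \<longleftrightarrow> (\<forall>k. Ck_on k S h)"

definition lap :: "(real \<times> real \<Rightarrow> real) \<Rightarrow> real \<times> real \<Rightarrow> real" where
  "lap w p = du (du w) p + dv (dv w) p"

definition lap_bar :: "(real \<times> real \<Rightarrow> real) \<Rightarrow> real \<times> real \<Rightarrow> real" where
  "lap_bar w p = du (du w) p - dv (dv w) p"

definition lap_star :: "(real \<times> real \<Rightarrow> real) \<Rightarrow> real \<times> real \<Rightarrow> real" where
  "lap_star w p = du (du w) p + dv (dv (\<lambda>q. inverse (w q))) p"

definition lap_bar_star :: "(real \<times> real \<Rightarrow> real) \<Rightarrow> real \<times> real \<Rightarrow> real" where
  "lap_bar_star w p = du (du w) p - dv (dv (\<lambda>q. inverse (w q))) p"

definition mink :: "real^3 \<Rightarrow> real^3 \<Rightarrow> real" where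
  "mink x y = x $ 1 * y $ 1 + x $ 2 * y $ 2 - x $ 3 * y $ 3"

definition similarity :: "(real^3 \<Rightarrow> real^3) \<Rightarrow> bool" where
  "similarity T \<longleftrightarrow> (\<exists>c>0. \<exists>A t. (\<forall>x y. mink (A *v x) (A *v y) = mink x y) \<and>
     T = (\<lambda>x. c *\<^sub>R (A *v x) + t))"

type_synonym param = "real \<times> real \<Rightarrow> real^3"

definition ff_E :: "param \<Rightarrow> real \<times> real \<Rightarrow> real" where "ff_E z p = mink (du z p) (du z p)"
definition ff_F :: "param \<Rightarrow> real \<times> real \<Rightarrow> real" where "ff_F z p = mink (du z p) (dv z p)"
definition ff_G :: "param \<Rightarrow> real \<times> real \<Rightarrow> real" where "ff_G z p = mink (dv z p) (dv z p)"

definition sf_L :: "param \<Rightarrow> param \<Rightarrow> real \<times> real \<Rightarrow> real" where "sf_L z l p = mink (l p) (du (du z) p)"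
definition sf_M :: "param \<Rightarrow> param \<Rightarrow> real \<times> real \<Rightarrow> real" where "sf_M z l p = mink (l p) (dv (du z) p)"
definition sf_N :: "param \<Rightarrow> param \<Rightarrow> real \<times> real \<Rightarrow> real" where "sf_N z l p = mink (l p) (dv (dv z) p)"

text \<open>A time-like surface in principal parameters: the parametrization \<open>z\<close> on the domain \<open>D\<close>,
  together with a choice \<open>l\<close> of its unit normal field (the other choice is \<open>- l\<close>).\<close>

definition principal_surface :: "(real \<times> real) set \<Rightarrow> param \<Rightarrow> param \<Rightarrow> bool" where
  "principal_surface D z l \<longleftrightarrow> open D \<and> connected D \<and> smooth2_on D z \<and> smooth2_on D l \<and>
     (\<forall>p\<in>D. ff_E z p < 0 \<and> ff_G z p > 0 \<and>
        mink (l p) (l p) = 1 \<and> mink (l p) (du z p) = 0 \<and> mink (l p) (dv z p) = 0 \<and>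
        ff_F z p = 0 \<and> sf_M z l p = 0)"

definition curv1 :: "param \<Rightarrow> param \<Rightarrow> real \<times> real \<Rightarrow> real" where "curv1 z l p = sf_L z l p / ff_E z p"
definition curv2 :: "param \<Rightarrow> param \<Rightarrow> real \<times> real \<Rightarrow> real" where "curv2 z l p = sf_N z l p / ff_G z p"

definition curv_K :: "param \<Rightarrow> param \<Rightarrow> real \<times> real \<Rightarrow> real" where
  "curv_K z l p = curv1 z l p * curv2 z l p"
definition curv_H :: "param \<Rightarrow> param \<Rightarrow> real \<times> real \<Rightarrow> real" where
  "curv_H z l p = (curv1 z l p + curv2 z l p) / 2"
definition curv_H' :: "param \<Rightarrow> param \<Rightarrow> real \<times> real \<Rightarrow> real" where
  "curv_H' z l p = (curv1 z l p - curv2 z l p) / 2"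

definition W_functions :: "real set \<Rightarrow> (real \<Rightarrow> real) \<Rightarrow> (real \<Rightarrow> real) \<Rightarrow> bool" where
  "W_functions I f g \<longleftrightarrow> open I \<and> is_interval I \<and> I \<noteq> {} \<and>
     (\<forall>x\<in>I. f differentiable at x \<and> deriv f differentiable at x \<and>
            g differentiable at x \<and> deriv g differentiable at x \<and>
            f x - g x \<noteq> 0 \<and> deriv f x * deriv g x \<noteq> 0)"

definition W_surface :: "(real \<times> real) set \<Rightarrow> param \<Rightarrow> param \<Rightarrow>
    real set \<Rightarrow> (real \<Rightarrow> real) \<Rightarrow> (real \<Rightarrow> real) \<Rightarrow> (real \<times> real \<Rightarrow> real) \<Rightarrow> bool" where
  "W_surface D z l I f g \<nu> \<longleftrightarrow> principal_surface D z l \<and> W_functions I f g \<and> smooth2_on D \<nu> \<and>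
     (\<forall>p\<in>D. \<nu> p \<in> I \<and> curv1 z l p = f (\<nu> p) \<and> curv2 z l p = g (\<nu> p))"

text \<open>\<open>wint f g \<nu>\<^sub>0 x\<close> is the (oriented) integral of \<open>f' / (f - g)\<close> from \<open>\<nu>\<^sub>0\<close> to \<open>x\<close>.\<close>

definition wint :: "(real \<Rightarrow> real) \<Rightarrow> (real \<Rightarrow> real) \<Rightarrow> real \<Rightarrow> real \<Rightarrow> real" where
  "wint f g \<nu>\<^sub>0 x = (LBINT s=ereal \<nu>\<^sub>0..ereal x. deriv f s / (f s - g s))"

definition natural_parameters :: "(real \<times> real) set \<Rightarrow> param \<Rightarrow>
    real set \<Rightarrow> (real \<Rightarrow> real) \<Rightarrow> (real \<Rightarrow> real) \<Rightarrow> (real \<times> real \<Rightarrow> real) \<Rightarrow> bool" where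
  "natural_parameters D z I f g \<nu> \<longleftrightarrow> (\<exists>\<nu>\<^sub>0\<in>I.
     (\<lambda>p. sqrt (- ff_E z p) * exp (wint f g \<nu>\<^sub>0 (\<nu> p))) constant_on D \<and>
     (\<lambda>p. sqrt (ff_G z p) * exp (wint g f \<nu>\<^sub>0 (\<nu> p))) constant_on D)"

definition natural_lhs :: "real \<Rightarrow> real \<Rightarrow> real \<Rightarrow> (real \<Rightarrow> real) \<Rightarrow> (real \<Rightarrow> real) \<Rightarrow>
    (real \<times> real \<Rightarrow> real) \<Rightarrow> real \<times> real \<Rightarrow> real" where
  "natural_lhs \<aa> \<bb> \<nu>\<^sub>0 f g \<nu> p = (let x = \<nu> p in
     \<aa>\<^sup>2 * exp (2 * wint f g \<nu>\<^sub>0 x) *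
       (deriv g x * du (du \<nu>) p + (deriv (deriv g) x - 2 * (deriv g x)\<^sup>2 / (g x - f x)) * (du \<nu> p)\<^sup>2)
   + \<bb>\<^sup>2 * exp (2 * wint g f \<nu>\<^sub>0 x) *
       (deriv f x * dv (dv \<nu>) p + (deriv (deriv f) x - 2 * (deriv f x)\<^sup>2 / (f x - g x)) * (dv \<nu> p)\<^sup>2))"

definition natural_rhs :: "(real \<Rightarrow> real) \<Rightarrow> (real \<Rightarrow> real) \<Rightarrow> (real \<times> real \<Rightarrow> real) \<Rightarrow>
    real \<times> real \<Rightarrow> real" where
  "natural_rhs f g \<nu> p = f (\<nu> p) * g (\<nu> p) * (f (\<nu> p) - g (\<nu> p))"

text \<open>The real arguments are \<open>\<beta>\<close> in \<open>Basic4\<close> to \<open>Basic7\<close>, and \<open>\<beta>\<close>, \<open>\<gamma>\<close> in \<open>Basic10\<close>.\<close>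

datatype basic = Basic1 | Basic2 | Basic3 | Basic4 real | Basic5 real | Basic6 real | Basic7 real
  | Basic8 | Basic9 | Basic10 real real

fun admissible :: "basic \<Rightarrow> bool" where
  "admissible (Basic4 \<beta>) \<longleftrightarrow> \<beta>\<^sup>2 > 1"
| "admissible (Basic5 \<beta>) \<longleftrightarrow> \<beta>\<^sup>2 < 1 \<and> \<beta> \<noteq> 0"
| "admissible (Basic6 \<beta>) \<longleftrightarrow> \<beta>\<^sup>2 > 1"
| "admissible (Basic7 \<beta>) \<longleftrightarrow> \<beta>\<^sup>2 < 1 \<and> \<beta> \<noteq> 0"
| "admissible (Basic10 \<beta> \<gamma>) \<longleftrightarrow> \<beta> \<noteq> 0 \<and> \<gamma> < 0"
| "admissible _ \<longleftrightarrow> True"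

text \<open>The arguments after the class are \<open>K\<close>, \<open>H\<close>, \<open>H'\<close>.\<close>

fun basic_rel :: "basic \<Rightarrow> real \<Rightarrow> real \<Rightarrow> real \<Rightarrow> bool" where
  "basic_rel Basic1 K H H' \<longleftrightarrow> H = 0"
| "basic_rel Basic2 K H H' \<longleftrightarrow> H = 1/2"
| "basic_rel Basic3 K H H' \<longleftrightarrow> H' = 1"
| "basic_rel (Basic4 \<beta>) K H H' \<longleftrightarrow> H = \<beta> * H'"
| "basic_rel (Basic5 \<beta>) K H H' \<longleftrightarrow> H = \<beta> * H'"
| "basic_rel (Basic6 \<beta>) K H H' \<longleftrightarrow> H = \<beta> * H' + 1"
| "basic_rel (Basic7 \<beta>) K H H' \<longleftrightarrow> H = \<beta> * H' + 1"
| "basic_rel Basic8 K H H' \<longleftrightarrow> K = -1"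
| "basic_rel Basic9 K H H' \<longleftrightarrow> K = 2 * H'"
| "basic_rel (Basic10 \<beta> \<gamma>) K H H' \<longleftrightarrow> K = \<beta> * H' + \<gamma>"

text \<open>The parameter \<open>\<nu>\<close> as a function of the principal curvatures \<open>\<nu>\<^sub>1\<close>, \<open>\<nu>\<^sub>2\<close>.\<close>

fun basic_param :: "basic \<Rightarrow> real \<Rightarrow> real \<Rightarrow> real" where
  "basic_param Basic8 \<nu>\<^sub>1 \<nu>\<^sub>2 = \<nu>\<^sub>1"
| "basic_param Basic9 \<nu>\<^sub>1 \<nu>\<^sub>2 = \<nu>\<^sub>1 + 1"
| "basic_param (Basic10 \<beta> \<gamma>) \<nu>\<^sub>1 \<nu>\<^sub>2 = \<nu>\<^sub>1 + \<beta>/2"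
| "basic_param _ \<nu>\<^sub>1 \<nu>\<^sub>2 = \<nu>\<^sub>2"

text \<open>\<open>f\<close>, \<open>g\<close> are the functions of the class \<open>b\<close> for the parameter prescribed by
  \<^const>\<open>basic_param\<close>; the two conditions determine both of them on \<open>I\<close>.\<close>

definition basic_functions :: "basic \<Rightarrow> real set \<Rightarrow> (real \<Rightarrow> real) \<Rightarrow> (real \<Rightarrow> real) \<Rightarrow> bool" where
  "basic_functions b I f g \<longleftrightarrow> admissible b \<and> W_functions I f g \<and>
     (\<forall>x\<in>I. basic_rel b (f x * g x) ((f x + g x) / 2) ((f x - g x) / 2) \<and>
            basic_param b (f x) (g x) = x)"

definition basic_surface :: "basic \<Rightarrow> (real \<times> real) set \<Rightarrow> param \<Rightarrow> param \<Rightarrow>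
    real set \<Rightarrow> (real \<Rightarrow> real) \<Rightarrow> (real \<Rightarrow> real) \<Rightarrow> (real \<times> real \<Rightarrow> real) \<Rightarrow> bool" where
  "basic_surface b D z l I f g \<nu> \<longleftrightarrow> basic_functions b I f g \<and> W_surface D z l I f g \<nu> \<and>
     (\<forall>p\<in>D. basic_rel b (curv_K z l p) (curv_H z l p) (curv_H' z l p) \<and>
            \<nu> p = basic_param b (curv1 z l p) (curv2 z l p))"

text \<open>The parameter \<open>\<nu>\<close> as a function of the unknown of the listed equation, and the admitted values
  of that unknown; in \<open>Basic3\<close> to \<open>Basic5\<close> the unknown is \<open>\<nu>\<close> itself.\<close>

fun unknown_subst :: "basic \<Rightarrow> real \<Rightarrow> real" where
  "unknown_subst Basic1 x = exp x"
| "unknown_subst Basic2 x = (1 - exp x) / 2"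
| "unknown_subst Basic3 x = x"
| "unknown_subst (Basic4 \<beta>) x = x"
| "unknown_subst (Basic5 \<beta>) x = x"
| "unknown_subst (Basic6 \<beta>) x = ((\<beta> - 1) * x + 2) / 2"
| "unknown_subst (Basic7 \<beta>) x = ((\<beta> - 1) * x + 2) / 2"
| "unknown_subst Basic8 x = tan (x / 2)"
| "unknown_subst Basic9 x = (x - 4) / (x - 2)"
| "unknown_subst (Basic10 \<beta> \<gamma>) x = x + \<beta>/2"

fun unknown_dom :: "basic \<Rightarrow> real set" where
  "unknown_dom (Basic4 \<beta>) = {0<..}"
| "unknown_dom (Basic5 \<beta>) = {0<..}"
| "unknown_dom (Basic6 \<beta>) = {0<..}"
| "unknown_dom (Basic7 \<beta>) = {0<..}"
| "unknown_dom Basic8 = {x. cos (x / 2) \<noteq> 0}"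
| "unknown_dom Basic9 = - {2}"
| "unknown_dom _ = UNIV"

fun listed_lhs :: "basic \<Rightarrow> (real \<times> real \<Rightarrow> real) \<Rightarrow> real \<times> real \<Rightarrow> real" where
  "listed_lhs Basic1 w = lap_bar w"
| "listed_lhs Basic2 w = lap_bar w"
| "listed_lhs Basic3 w = lap_bar_star (\<lambda>q. exp (w q))"
| "listed_lhs (Basic4 \<beta>) w = lap_bar_star (\<lambda>q. w q powr \<beta>)"
| "listed_lhs (Basic5 \<beta>) w = lap_star (\<lambda>q. w q powr \<beta>)"
| "listed_lhs (Basic6 \<beta>) w = lap_bar_star (\<lambda>q. w q powr \<beta>)"
| "listed_lhs (Basic7 \<beta>) w = lap_star (\<lambda>q. w q powr \<beta>)"
| "listed_lhs Basic8 w = lap w"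
| "listed_lhs Basic9 w = lap_bar_star (\<lambda>q. exp (w q))"
| "listed_lhs (Basic10 \<beta> \<gamma>) w =
     lap_bar_star (\<lambda>q. exp (\<beta> * (1 / sqrt (-\<gamma>) * arctan (w q / sqrt (-\<gamma>)))))"

fun listed_rhs :: "basic \<Rightarrow> real \<Rightarrow> real" where
  "listed_rhs Basic1 x = exp x"
| "listed_rhs Basic2 x = sinh x"
| "listed_rhs Basic3 x = 2 * x * (x + 2)"
| "listed_rhs (Basic4 \<beta>) x = 2 * (\<beta> * (\<beta> + 1) / (\<beta> - 1)\<^sup>2) * x"
| "listed_rhs (Basic5 \<beta>) x = 2 * (\<beta> * (\<beta> + 1) / (\<beta> - 1)\<^sup>2) * x"
| "listed_rhs (Basic6 \<beta>) x =
     \<beta> * ((\<beta> - 1) * x + 2) * ((\<beta> + 1) * x + 2) / (2 * (\<beta> - 1) * x)"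
| "listed_rhs (Basic7 \<beta>) x =
     \<beta> * ((\<beta> - 1) * x + 2) * ((\<beta> + 1) * x + 2) / (2 * (\<beta> - 1) * x)"
| "listed_rhs Basic8 x = - sin x"
| "listed_rhs Basic9 x = 2"
| "listed_rhs (Basic10 \<beta> \<gamma>) x =
     - (\<beta> * \<gamma> / 2) * (x * (\<beta> * x + 2 * \<gamma>) / (x\<^sup>2 - \<gamma>))"

text \<open>For suitable constants the natural PDE, written for the listed unknown \<open>w\<close>, differs from the
  listed equation by the nowhere vanishing factor \<open>c (w p)\<close>.\<close>

definition natural_pde_is_listed :: "basic \<Rightarrow> real set \<Rightarrow> (real \<Rightarrow> real) \<Rightarrow> (real \<Rightarrow> real) \<Rightarrow> bool" where
  "natural_pde_is_listed b I f g \<longleftrightarrow>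
     (\<exists>\<aa>>0. \<exists>\<bb>>0. \<exists>\<nu>\<^sub>0\<in>I. \<exists>c::real \<Rightarrow> real. (\<forall>x. c x \<noteq> 0) \<and>
       (\<forall>U w. open U \<and> Ck_on 2 U w \<and> (\<forall>p\<in>U. w p \<in> unknown_dom b \<and> unknown_subst b (w p) \<in> I) \<longrightarrow>
         (\<forall>p\<in>U. natural_lhs \<aa> \<bb> \<nu>\<^sub>0 f g (\<lambda>q. unknown_subst b (w q)) p
                  - natural_rhs f g (\<lambda>q. unknown_subst b (w q)) p
                = c (w p) * (listed_lhs b w p - listed_rhs b (w p)))))"

text \<open>The surface \<open>(D, z, l)\<close> with W-data \<open>I, f, g, \<nu>\<close> is, near \<open>p\<close> and up to similarity, parallel to
  (\<open>a \<noteq> 0\<close>) or coincident with (\<open>a = 0\<close>) a basic surface of class \<open>b\<close>, and natural parameters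
  stay natural. In \<open>Basic2\<close> and \<open>Basic7\<close> the listed unknown exists only if \<open>H' > 0\<close>. The sign of \<open>H'\<close>
  cannot be normalized there, as neither parallel surfaces nor similarities nor the choice of the
  normal relate the two signs within these classes; elsewhere the unknown exists.\<close>

definition locally_basic :: "(real \<times> real) set \<Rightarrow> param \<Rightarrow> param \<Rightarrow> real set \<Rightarrow> (real \<Rightarrow> real) \<Rightarrow>
    (real \<Rightarrow> real) \<Rightarrow> (real \<times> real \<Rightarrow> real) \<Rightarrow> real \<times> real \<Rightarrow> bool" where
  "locally_basic D z l I f g \<nu> p \<longleftrightarrow>
     (\<exists>V a T l' b J f' g' \<nu>'.
        p \<in> V \<and> V \<subseteq> D \<and>
        (\<forall>q\<in>V. (1 - a * curv1 z l q) * (1 - a * curv2 z l q) \<noteq> 0) \<and>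
        similarity T \<and>
        basic_surface b V (\<lambda>q. T (z q + a *\<^sub>R l q)) l' J f' g' \<nu>' \<and>
        (natural_parameters D z I f g \<nu> \<longrightarrow>
           natural_parameters V (\<lambda>q. T (z q + a *\<^sub>R l q)) J f' g' \<nu>') \<and>
        (J \<subseteq> unknown_subst b ` unknown_dom b \<and> natural_pde_is_listed b J f' g' \<or>
           (b = Basic2 \<or> (\<exists>\<beta>. b = Basic7 \<beta>)) \<and> (\<forall>x\<in>J. f' x < g' x)))"

text \<open>If \<open>\<alpha>\<^sup>2 + 4 \<gamma> \<delta> < 0\<close>, the only parallel surface whose linear relation has no \<open>H\<close>-term lies at distance
  \<open>a = - \<alpha> / (2 \<gamma>)\<close>. It is not defined at the points with \<open>(1 - a \<nu>\<^sub>1) (1 - a \<nu>\<^sub>2) = 0\<close>. If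
  \<open>\<alpha>\<^sup>2 + 4 \<gamma> \<delta> \<ge> 0\<close>, the required parallel surface is everywhere defined.\<close>

definition parallel_defined :: "real \<Rightarrow> real \<Rightarrow> real \<Rightarrow> param \<Rightarrow> param \<Rightarrow> real \<times> real \<Rightarrow> bool" where
  "parallel_defined \<alpha> \<gamma> \<delta> z l p \<longleftrightarrow> \<alpha>\<^sup>2 + 4 * \<gamma> * \<delta> \<ge> 0 \<or>
     (2 * \<gamma> + \<alpha> * curv1 z l p) * (2 * \<gamma> + \<alpha> * curv2 z l p) \<noteq> 0"

end

theory Submission
  imports Defs
begin

text \<open>
  Write \<open>A = \<aa>\<^sup>2 exp (2 \<integral> f'/(f - g))\<close> and \<open>B = \<bb>\<^sup>2 exp (2 \<integral> g'/(g - f))\<close>. With \<open>P' = g'/B\<close> and \<open>Q' = f'/A\<close> the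
  natural PDE becomes \<open>A B (P\<^sub>u\<^sub>u + Q\<^sub>v\<^sub>v) = f g (f - g)\<close>. In each of the ten classes \<open>A\<close> and \<open>B\<close> are elementary, and \<open>P\<close>,
  \<open>Q\<close>, expressed through the listed unknown, are proportional to the functions to which the listed
  operator is applied.

  For the classification, the curvatures of \<open>z + a l\<close> are \<open>\<nu>\<^sub>i / (1 - a \<nu>\<^sub>i)\<close>, which turns the relation into
  \<open>(\<delta> - a \<alpha> - a\<^sup>2 \<gamma>) K = (\<alpha> + 2 a \<gamma>) H + \<beta> H' + \<gamma>\<close> and leaves \<open>\<alpha>\<^sup>2 + 4 \<gamma> \<delta>\<close> unchanged. If this number is
  non-negative, a suitable \<open>a\<close> removes \<open>K\<close> (unless \<open>\<alpha> = \<gamma> = 0\<close>, which is class (9)); otherwise \<open>a = - \<alpha> / (2 \<gamma>)\<close> removes \<open>H\<close>. A homothety and the choice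
  of the normal, which multiply both curvatures by an arbitrary non-zero constant, do the rest.
\<close>

section \<open>The natural PDE in divergence form\<close>

text \<open>The sign of \<alpha>^2 + 4 \<gamma> \<delta> matters because it is the discriminant of
  \<gamma> a^2 + \<alpha> a - \<delta>, the polynomial that must vanish for K to disappear. At a
  root the hypothesis of the theorem says A^2 \<noteq> \<beta>^2, where A = \<alpha> + 2 a \<gamma>
  is the new coefficient of H. Two obstacles shape the proof. The surface z + a l degenerates where
  1 - a \<nu>_i = 0. At a root this is impossible: both curvatures would equal 1/a. In the elliptic
  case it can happen, even on an open set; but f and g are injective, so there \<nu> is locally
  constant and the surface itself falls into class (3). Hence the classification holds on a dense
  open set. The second obstacle is the sign of H'. If the relation is homogeneous, the sign of the
  scaling factor is free; a constant term fixes that factor together with its sign. In class (6) the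
  two roots a give opposite signs of the scaled H', so one of them is right; in classes (2) and (7)
  the negative sign remains as an alternative.\<close>

lemma W_functions_commute: "W_functions I f g \<Longrightarrow> W_functions I g f"
  unfolding W_functions_def by (auto simp: mult.commute)

lemma W_functions_DERIV:
  assumes "W_functions I f g" "x \<in> I"
  shows "(f has_real_derivative deriv f x) (at x)"
    and "(deriv f has_real_derivative deriv (deriv f) x) (at x)"
    and "(g has_real_derivative deriv g x) (at x)"
    and "(deriv g has_real_derivative deriv (deriv g) x) (at x)"
  using assms unfolding W_functions_def
  by (auto simp: DERIV_deriv_iff_real_differentiable)

lemma wint_has_derivative:
  assumes W: "W_functions I f g" and "\<nu>\<^sub>0 \<in> I" "x \<in> I"
  shows "(wint f g \<nu>\<^sub>0 has_real_derivative deriv f x / (f x - g x)) (at x)"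
proof -
  have I: "open I" "is_interval I" using W by (auto simp: W_functions_def)
  obtain e where e: "e > 0" "cball x e \<subseteq> I"
    using I(1) \<open>x \<in> I\<close> open_contains_cball by blast
  \<comment> \<open>The fundamental theorem needs one compact interval inside \<open>I\<close> that
    contains \<open>\<nu>\<^sub>0\<close> and has \<open>x\<close> in its interior, so that the
    derivative is two-sided. The order of the two limits is arbitrary, hence min and max.\<close>
  define a b where "a = min (x - e) \<nu>\<^sub>0" and "b = max (x + e) \<nu>\<^sub>0"
  have "x - e \<in> cball x e" "x + e \<in> cball x e" using e(1) by (auto simp: dist_real_def)
  then have "x - e \<in> I" "x + e \<in> I" using e(2) by auto
  then have ab: "a \<in> I" "b \<in> I" using \<open>\<nu>\<^sub>0 \<in> I\<close> by (auto simp: a_def b_def min_def max_def)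
  have sub: "{a..b} \<subseteq> I"
  proof
    fix t assume "t \<in> {a..b}"
    then show "t \<in> I" using mem_is_interval_1_I[OF I(2) ab] by auto
  qed
  have x: "a < x" "x < b" using e(1) by (auto simp: a_def b_def)
  have cont: "continuous_on {a..b} (\<lambda>s. deriv f s / (f s - g s))"
  proof (rule continuous_at_imp_continuous_on, rule ballI)
    fix s assume "s \<in> {a..b}"
    then have s: "s \<in> I" using sub by auto
    show "isCont (\<lambda>s. deriv f s / (f s - g s)) s"
      using s W_functions_DERIV[OF W s, THEN DERIV_isCont] W
      by (auto intro!: continuous_intros simp: W_functions_def)
  qed
  have "((\<lambda>u. LBINT s=ereal \<nu>\<^sub>0..ereal u. deriv f s / (f s - g s)) has_vector_derivative
      deriv f x / (f x - g x)) (at x within {a..b})"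
    using interval_integral_FTC2[OF _ _ cont, of \<nu>\<^sub>0 x] x by (simp add: a_def b_def)
  moreover have "at x within {a..b} = at x" using x by (simp add: at_within_Icc_at)
  ultimately show ?thesis
    unfolding has_real_derivative_iff_has_vector_derivative wint_def by simp
qed

text \<open>\<open>A\<close> and the exponential of 2 \<open>wint\<close> solve the same linear
  first-order equation, so their quotient is constant, and \<open>wint\<close> vanishes at
  \<open>\<nu>\<^sub>0\<close>. With \<open>sqrt (A \<nu>\<^sub>0)\<close> as the constant of the
  natural PDE, the exponential factor is therefore exactly \<open>A\<close>.\<close>

lemma exp_wint_eq:
  assumes W: "W_functions I f g" and \<nu>\<^sub>0: "\<nu>\<^sub>0 \<in> I" and x: "x \<in> I"
    and A: "\<And>y. y \<in> I \<Longrightarrow> (A has_real_derivative 2 * deriv f y / (f y - g y) * A y) (at y)"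
    and pos: "A \<nu>\<^sub>0 > 0"
  shows "(sqrt (A \<nu>\<^sub>0))\<^sup>2 * exp (2 * wint f g \<nu>\<^sub>0 x) = A x"
proof -
  let ?h = "\<lambda>y. A y * exp (- 2 * wint f g \<nu>\<^sub>0 y)"
  have I: "convex I" using W by (auto simp: W_functions_def is_interval_convex)
  have "(?h has_real_derivative 0) (at y within I)" if "y \<in> I" for y
    apply (rule DERIV_subset[where s=UNIV])
    by (rule derivative_eq_intros A[OF that] wint_has_derivative[OF W \<nu>\<^sub>0 that] refl
        | simp add: algebra_simps)+
  then obtain c where c: "\<forall>y\<in>I. ?h y = c"
    using has_field_derivative_zero_constant[OF I, of ?h] by auto
  have "wint f g \<nu>\<^sub>0 \<nu>\<^sub>0 = 0" by (simp add: wint_def)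
  then have "c = A \<nu>\<^sub>0" using c \<nu>\<^sub>0 by fastforce
  then have "A \<nu>\<^sub>0 = A x * exp (- 2 * wint f g \<nu>\<^sub>0 x)" using c x by auto
  then show ?thesis using pos by (simp add: exp_minus field_simps)
qed

text \<open>Second partial derivatives are iterated \<open>vector_derivative\<close>s, so the first
  derivative has to be known on a whole neighbourhood before it can be differentiated at the
  point.\<close>

lemma eventually_nhds_deriv_line:
  fixes W :: "real \<Rightarrow> real"
  assumes "\<forall>\<^sub>F t in nhds t0. (W has_real_derivative W1 t) (at t)"
    and "(W1 has_real_derivative W2) (at t0)"
  shows "vector_derivative W (at t0) = W1 t0"
    and "vector_derivative (\<lambda>t. vector_derivative W (at t)) (at t0) = W2"
proof -
  have ev: "\<forall>\<^sub>F t in nhds t0. vector_derivative W (at t) = W1 t"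
    using assms(1) by eventually_elim
      (simp add: has_real_derivative_iff_has_vector_derivative vector_derivative_at)
  show "vector_derivative W (at t0) = W1 t0" using eventually_nhds_x_imp_x[OF ev] .
  have "((\<lambda>t. vector_derivative W (at t)) has_real_derivative W2) (at t0)"
    using assms(2) ev by (subst DERIV_cong_ev[OF refl _ refl, where g=W1]) auto
  then show "vector_derivative (\<lambda>t. vector_derivative W (at t)) (at t0) = W2"
    by (simp add: has_real_derivative_iff_has_vector_derivative vector_derivative_at)
qed

text \<open>If \<open>P' = g' / B\<close> with \<open>B' / B = 2 g' / (g - f)\<close>, then the bracket of the natural PDE is
  \<open>B\<close> times the second derivative of \<open>P\<close> along the surface.\<close>

lemma second_derivative_substitution:
  fixes W :: "real \<Rightarrow> real"
  assumes W: "W_functions I f g"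
    and B: "\<And>y. y \<in> I \<Longrightarrow> (B has_real_derivative 2 * deriv g y / (g y - f y) * B y) (at y)"
    and B0: "\<And>y. y \<in> I \<Longrightarrow> B y > 0"
    and X: "\<And>x. x \<in> X \<Longrightarrow> s x \<in> I"
    and s: "\<And>x. x \<in> X \<Longrightarrow> (s has_real_derivative s1 x) (at x)"
      "\<And>x. x \<in> X \<Longrightarrow> (s1 has_real_derivative s2 x) (at x)"
    and \<phi>: "\<And>x. x \<in> X \<Longrightarrow> (\<phi> has_real_derivative \<phi>1 x) (at x)"
      "\<And>x. x \<in> X \<Longrightarrow> \<phi>1 x * B (s x) = \<kappa> * deriv g (s x) * s1 x"
    and W1: "\<forall>\<^sub>F t in nhds t0. (W has_real_derivative W1 t) (at t)"
    and W2: "(W1 has_real_derivative W2) (at t0)"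
    and WX: "\<forall>\<^sub>F t in nhds t0. W t \<in> X"
    and y: "y = s (W t0)"
  shows "B y * vector_derivative (\<lambda>t. vector_derivative (\<lambda>t. \<phi> (W t)) (at t)) (at t0) =
    \<kappa> * (deriv g y * vector_derivative (\<lambda>t. vector_derivative (\<lambda>t. s (W t)) (at t)) (at t0)
       + (deriv (deriv g) y - 2 * (deriv g y)\<^sup>2 / (g y - f y))
           * (vector_derivative (\<lambda>t. s (W t)) (at t0))\<^sup>2)"
proof -
  have W10: "(W has_real_derivative W1 t0) (at t0)" and X0: "W t0 \<in> X"
    using eventually_nhds_x_imp_x[OF W1] eventually_nhds_x_imp_x[OF WX] by auto
  have yI: "y \<in> I" using X[OF X0] y by simp
  define n1 where "n1 = (\<lambda>t. s1 (W t) * W1 t)"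
  define n2 where "n2 = s2 (W t0) * W1 t0 * W1 t0 + s1 (W t0) * W2"
  have n: "\<forall>\<^sub>F t in nhds t0. ((\<lambda>t. s (W t)) has_real_derivative n1 t) (at t)"
    using W1 WX unfolding n1_def by eventually_elim (auto intro!: DERIV_chain2[OF s(1)])
  have n2: "(n1 has_real_derivative n2) (at t0)"
    unfolding n1_def n2_def
    by (rule derivative_eq_intros DERIV_chain2[OF s(2)[OF X0] W10] W2 | simp)+
  \<comment> \<open>The derivative of \<phi>(W), rewritten by the hypothesis on
    \<open>\<phi>1\<close> as \<kappa> g' \<nu>_t / B with \<nu> = s(W). In this form the quotient
    rule brings in B'/B = 2 g' / (g - f), which produces the term quadratic in \<nu>_t.\<close>
  define q1 where "q1 = (\<lambda>t. \<kappa> * deriv g (s (W t)) * n1 t / B (s (W t)))"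
  have q: "\<forall>\<^sub>F t in nhds t0. ((\<lambda>t. \<phi> (W t)) has_real_derivative q1 t) (at t)"
    using W1 WX
  proof eventually_elim
    case (elim t)
    have "B (s (W t)) \<noteq> 0" using B0[OF X[OF elim(2)]] by simp
    then have "\<phi>1 (W t) * W1 t = q1 t" using \<phi>(2)[OF elim(2)]
      by (simp add: q1_def n1_def field_simps)
    then show ?case using DERIV_chain2[OF \<phi>(1)[OF elim(2)] elim(1)] by simp
  qed
  have nn: "((\<lambda>t. s (W t)) has_real_derivative n1 t0) (at t0)"
    using eventually_nhds_x_imp_x[OF n] .
  have Bn: "((\<lambda>t. B (s (W t))) has_real_derivative 2 * deriv g y / (g y - f y) * B y * n1 t0) (at t0)"
    using DERIV_chain2[OF B[OF yI, unfolded y] nn] y by simp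
  have gn: "((\<lambda>t. deriv g (s (W t))) has_real_derivative deriv (deriv g) y * n1 t0) (at t0)"
    using DERIV_chain2[OF W_functions_DERIV(4)[OF W yI, unfolded y] nn] y by simp
  have By: "B y \<noteq> 0" using B0[OF yI] by simp
  define q2 where "q2 = \<kappa> * (deriv (deriv g) y * (n1 t0)\<^sup>2 + deriv g y * n2
       - 2 * (deriv g y)\<^sup>2 / (g y - f y) * (n1 t0)\<^sup>2) / B y"
  have fg: "g y - f y \<noteq> 0" using W yI by (auto simp: W_functions_def)
  have q2: "(q1 has_real_derivative q2) (at t0)"
    unfolding q1_def
    apply (rule derivative_eq_intros gn n2 Bn refl)+
    subgoal using By y by simp
    subgoal using By fg y unfolding q2_def y[symmetric]
      apply (simp add: divide_simps)
      by algebra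
    done
  have "B y * q2 = \<kappa> * (deriv (deriv g) y * (n1 t0)\<^sup>2 + deriv g y * n2
       - 2 * (deriv g y)\<^sup>2 / (g y - f y) * (n1 t0)\<^sup>2)"
    using By by (simp add: q2_def)
  also have "\<dots> = \<kappa> * (deriv g y * n2
       + (deriv (deriv g) y - 2 * (deriv g y)\<^sup>2 / (g y - f y)) * (n1 t0)\<^sup>2)"
    by (simp add: algebra_simps)
  finally show ?thesis
    unfolding eventually_nhds_deriv_line[OF n n2] eventually_nhds_deriv_line(2)[OF q q2] .
qed

lemma has_vector_derivative_du:
  assumes "h differentiable at (x, y)"
  shows "((\<lambda>s. h (s, y)) has_vector_derivative du h (x, y)) (at x)"
proof -
  obtain h' where h': "(h has_derivative h') (at (x, y))" using assms by (auto simp: differentiable_def)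
  have "((\<lambda>s. h (s, y)) has_derivative (\<lambda>t. h' (t, 0))) (at x)"
    by (rule has_derivative_eq_rhs, rule has_derivative_compose[where g=h])
      (auto intro!: derivative_eq_intros h')
  then have "(\<lambda>s. h (s, y)) differentiable at x" by (auto simp: differentiable_def)
  then show ?thesis unfolding vector_derivative_works du_def by simp
qed

lemma has_vector_derivative_dv:
  assumes "h differentiable at (x, y)"
  shows "((\<lambda>t. h (x, t)) has_vector_derivative dv h (x, y)) (at y)"
proof -
  obtain h' where h': "(h has_derivative h') (at (x, y))" using assms by (auto simp: differentiable_def)
  have "((\<lambda>t. h (x, t)) has_derivative (\<lambda>t. h' (0, t))) (at y)"
    by (rule has_derivative_eq_rhs, rule has_derivative_compose[where g=h])
      (auto intro!: derivative_eq_intros h')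
  then have "(\<lambda>t. h (x, t)) differentiable at y" by (auto simp: differentiable_def)
  then show ?thesis unfolding vector_derivative_works dv_def by simp
qed

lemma eventually_nhds_line:
  assumes "open U" "(x, y) \<in> U"
  shows "\<forall>\<^sub>F s in nhds x. (s, y) \<in> U" and "\<forall>\<^sub>F t in nhds y. (x, t) \<in> U"
proof -
  have "open {s. (s, y) \<in> U}"
    using open_vimage[OF assms(1), of "\<lambda>s. (s, y)"] by (simp add: vimage_def continuous_intros)
  then show "\<forall>\<^sub>F s in nhds x. (s, y) \<in> U"
    using eventually_nhds_in_open assms(2) by fastforce
  have "open {t. (x, t) \<in> U}"
    using open_vimage[OF assms(1), of "\<lambda>t. (x, t)"] by (simp add: vimage_def continuous_intros)
  then show "\<forall>\<^sub>F t in nhds y. (x, t) \<in> U"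
    using eventually_nhds_in_open assms(2) by fastforce
qed

text \<open>Here \<open>A\<close> and \<open>B\<close> are closed forms of the two exponential factors of the natural PDE, whose
  constants \<open>\<aa>\<close>, \<open>\<bb>\<close> are chosen so that the two
  proportionality factors agree up to the sign \<open>\<sigma>\<close> of the listed operator.\<close>

lemma natural_pde_is_listedI:
  assumes W: "W_functions I f g"
    and A: "\<And>y. y \<in> I \<Longrightarrow> (A has_real_derivative 2 * deriv f y / (f y - g y) * A y) (at y)"
    and B: "\<And>y. y \<in> I \<Longrightarrow> (B has_real_derivative 2 * deriv g y / (g y - f y) * B y) (at y)"
    and A0: "\<And>y. y \<in> I \<Longrightarrow> A y > 0" and B0: "\<And>y. y \<in> I \<Longrightarrow> B y > 0"
    and X: "\<And>x. x \<in> X \<longleftrightarrow> x \<in> unknown_dom b \<and> unknown_subst b x \<in> I"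
    and s: "\<And>x. x \<in> X \<Longrightarrow> (unknown_subst b has_real_derivative s1 x) (at x)"
      "\<And>x. x \<in> X \<Longrightarrow> (s1 has_real_derivative s2 x) (at x)"
    and \<phi>: "\<And>x. x \<in> X \<Longrightarrow> (\<phi> has_real_derivative \<phi>1 x) (at x)"
      "\<And>x. x \<in> X \<Longrightarrow> \<phi>1 x * B (unknown_subst b x) = \<kappa> * deriv g (unknown_subst b x) * s1 x"
    and \<psi>: "\<And>x. x \<in> X \<Longrightarrow> (\<psi> has_real_derivative \<psi>1 x) (at x)"
      "\<And>x. x \<in> X \<Longrightarrow> \<psi>1 x * A (unknown_subst b x) = \<sigma> * \<kappa> * deriv f (unknown_subst b x) * s1 x"
    and \<kappa>: "\<kappa> \<noteq> 0" and \<sigma>: "\<sigma> * \<sigma> = 1"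
    and lhs: "\<And>w p. listed_lhs b w p = du (du (\<lambda>q. \<phi> (w q))) p + \<sigma> * dv (dv (\<lambda>q. \<psi> (w q))) p"
    and rhs: "\<And>x. x \<in> X \<Longrightarrow> listed_rhs b x * A (unknown_subst b x) * B (unknown_subst b x) =
       \<kappa> * f (unknown_subst b x) * g (unknown_subst b x) * (f (unknown_subst b x) - g (unknown_subst b x))"
  shows "natural_pde_is_listed b I f g"
proof -
  let ?s = "unknown_subst b"
  obtain \<nu>\<^sub>0 where \<nu>\<^sub>0: "\<nu>\<^sub>0 \<in> I" using W by (auto simp: W_functions_def)
  \<comment> \<open>The value 1 outside \<open>X\<close> serves only the demand that the factor
    vanish nowhere on the real line.\<close>
  define c where "c = (\<lambda>x. if x \<in> X then A (?s x) * B (?s x) / \<kappa> else 1)"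
  have c0: "c x \<noteq> 0" for x
    using A0[of "?s x"] B0[of "?s x"] \<kappa> X[of x] by (auto simp: c_def)
  have W': "W_functions I g f" using W by (rule W_functions_commute)
  show ?thesis
    unfolding natural_pde_is_listed_def
  proof (rule exI[of _ "sqrt (A \<nu>\<^sub>0)"], rule conjI, use A0[OF \<nu>\<^sub>0] in simp,
      rule exI[of _ "sqrt (B \<nu>\<^sub>0)"], rule conjI, use B0[OF \<nu>\<^sub>0] in simp,
      rule bexI[OF _ \<nu>\<^sub>0], rule exI[of _ c], intro conjI allI impI ballI)
    show "c x \<noteq> 0" for x by (rule c0)
    fix U w p
    assume U: "open U \<and> Ck_on 2 U w \<and> (\<forall>p\<in>U. w p \<in> unknown_dom b \<and> ?s (w p) \<in> I)" and p: "p \<in> U"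
    obtain x y where xy: "p = (x, y)" by (cases p)
    have XI: "?s x \<in> I" if "x \<in> X" for x using that X by auto
    have UX: "w q \<in> X" if "q \<in> U" for q using U that X by auto
    have wd: "w differentiable at q" "du w differentiable at q" "dv w differentiable at q" if "q \<in> U" for q
      using U that by (auto simp: numeral_2_eq_2)
    define r where "r = ?s (w p)"
    have rI: "r \<in> I" using UX[OF p] X by (auto simp: r_def)
    have lu: "\<forall>\<^sub>F s in nhds x. (s, y) \<in> U" and lv: "\<forall>\<^sub>F t in nhds y. (x, t) \<in> U"
      using eventually_nhds_line[of U x y] U p xy by auto
    have u1: "\<forall>\<^sub>F t in nhds x. ((\<lambda>t. w (t, y)) has_real_derivative du w (t, y)) (at t)"
      using lu by eventually_elim
        (auto simp: has_real_derivative_iff_has_vector_derivative intro!: has_vector_derivative_du wd)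
    have u2: "((\<lambda>t. du w (t, y)) has_real_derivative du (du w) (x, y)) (at x)"
      using p xy by (auto simp: has_real_derivative_iff_has_vector_derivative intro!: has_vector_derivative_du wd)
    have u3: "\<forall>\<^sub>F t in nhds x. w (t, y) \<in> X"
      using lu by eventually_elim (auto intro!: UX)
    have u: "B r * du (du (\<lambda>q. \<phi> (w q))) p = \<kappa> * (deriv g r * du (du (\<lambda>q. ?s (w q))) p +
       (deriv (deriv g) r - 2 * (deriv g r)\<^sup>2 / (g r - f r)) * (du (\<lambda>q. ?s (w q)) p)\<^sup>2)"
      using second_derivative_substitution[OF W B B0 XI s \<phi> u1 u2 u3 refl]
      unfolding du_def r_def xy by simp
    have v1: "\<forall>\<^sub>F t in nhds y. ((\<lambda>t. w (x, t)) has_real_derivative dv w (x, t)) (at t)"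
      using lv by eventually_elim
        (auto simp: has_real_derivative_iff_has_vector_derivative intro!: has_vector_derivative_dv wd)
    have v2: "((\<lambda>t. dv w (x, t)) has_real_derivative dv (dv w) (x, y)) (at y)"
      using p xy by (auto simp: has_real_derivative_iff_has_vector_derivative intro!: has_vector_derivative_dv wd)
    have v3: "\<forall>\<^sub>F t in nhds y. w (x, t) \<in> X"
      using lv by eventually_elim (auto intro!: UX)
    have v: "A r * dv (dv (\<lambda>q. \<psi> (w q))) p = \<sigma> * \<kappa> * (deriv f r * dv (dv (\<lambda>q. ?s (w q))) p +
       (deriv (deriv f) r - 2 * (deriv f r)\<^sup>2 / (f r - g r)) * (dv (\<lambda>q. ?s (w q)) p)\<^sup>2)"
      using second_derivative_substitution[OF W' A A0 XI s \<psi> v1 v2 v3 refl]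
      unfolding dv_def r_def xy by simp
    have a: "(sqrt (A \<nu>\<^sub>0))\<^sup>2 * exp (2 * wint f g \<nu>\<^sub>0 r) = A r"
      using exp_wint_eq[OF W \<nu>\<^sub>0 rI, of A] A A0 \<nu>\<^sub>0 by auto
    have b: "(sqrt (B \<nu>\<^sub>0))\<^sup>2 * exp (2 * wint g f \<nu>\<^sub>0 r) = B r"
      using exp_wint_eq[OF W' \<nu>\<^sub>0 rI, of B] B B0 \<nu>\<^sub>0 by auto
    \<comment> \<open>Since \<sigma>^2 = 1, the sign in the equation for \<psi> passes over to the
      second term of the listed operator, and both brackets carry the same factor \<kappa>.\<close>
    have "\<kappa> * natural_lhs (sqrt (A \<nu>\<^sub>0)) (sqrt (B \<nu>\<^sub>0)) \<nu>\<^sub>0 f g (\<lambda>q. ?s (w q)) p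
        = A r * (B r * du (du (\<lambda>q. \<phi> (w q))) p) + B r * (\<sigma> * (A r * dv (dv (\<lambda>q. \<psi> (w q))) p))"
      unfolding natural_lhs_def Let_def r_def[symmetric] a b u v
      using \<sigma> by (simp add: distrib_left mult.left_commute[of \<kappa>] mult.assoc[symmetric])
    also have "\<dots> = A r * B r * listed_lhs b w p" by (simp add: lhs algebra_simps)
    finally have 1: "\<kappa> * natural_lhs (sqrt (A \<nu>\<^sub>0)) (sqrt (B \<nu>\<^sub>0)) \<nu>\<^sub>0 f g (\<lambda>q. ?s (w q)) p
      = A r * B r * listed_lhs b w p" .
    have 2: "\<kappa> * natural_rhs f g (\<lambda>q. ?s (w q)) p = A r * B r * listed_rhs b (w p)"
      using rhs[OF UX[OF p]] by (simp add: natural_rhs_def r_def mult_ac)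
    have c: "c (w p) = A r * B r / \<kappa>" using UX[OF p] by (simp add: c_def r_def)
    have "natural_lhs (sqrt (A \<nu>\<^sub>0)) (sqrt (B \<nu>\<^sub>0)) \<nu>\<^sub>0 f g (\<lambda>q. ?s (w q)) p = c (w p) * listed_lhs b w p"
      using 1 \<kappa> unfolding c by (simp add: field_simps)
    moreover have "natural_rhs f g (\<lambda>q. ?s (w q)) p = c (w p) * listed_rhs b (w p)"
      using 2 \<kappa> unfolding c by (simp add: field_simps)
    ultimately show "natural_lhs (sqrt (A \<nu>\<^sub>0)) (sqrt (B \<nu>\<^sub>0)) \<nu>\<^sub>0 f g (\<lambda>q. ?s (w q)) p
        - natural_rhs f g (\<lambda>q. ?s (w q)) p = c (w p) * (listed_lhs b w p - listed_rhs b (w p))"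
      by (simp add: right_diff_distrib)
  qed
qed

section \<open>Explicit functions of the basic classes\<close>

fun basic_f :: "basic \<Rightarrow> real \<Rightarrow> real" where
  "basic_f Basic1 x = - x"
| "basic_f Basic2 x = 1 - x"
| "basic_f Basic3 x = x + 2"
| "basic_f (Basic4 \<beta>) x = (\<beta> + 1) / (\<beta> - 1) * x"
| "basic_f (Basic5 \<beta>) x = (\<beta> + 1) / (\<beta> - 1) * x"
| "basic_f (Basic6 \<beta>) x = ((\<beta> + 1) * x - 2) / (\<beta> - 1)"
| "basic_f (Basic7 \<beta>) x = ((\<beta> + 1) * x - 2) / (\<beta> - 1)"
| "basic_f Basic8 x = x"
| "basic_f Basic9 x = x - 1"
| "basic_f (Basic10 \<beta> \<gamma>) x = x - \<beta> / 2"

fun basic_g :: "basic \<Rightarrow> real \<Rightarrow> real" where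
  "basic_g Basic8 x = - 1 / x"
| "basic_g Basic9 x = 1 - 1 / x"
| "basic_g (Basic10 \<beta> \<gamma>) x = \<beta> / 2 - (\<beta>\<^sup>2 - 4 * \<gamma>) / (4 * x)"
| "basic_g _ x = x"

text \<open>One number per class suffices, because in every class the prescribed parameter makes
  \<nu>_1 an affine function.\<close>

fun basic_f' :: "basic \<Rightarrow> real" where
  "basic_f' Basic1 = - 1"
| "basic_f' Basic2 = - 1"
| "basic_f' (Basic4 \<beta>) = (\<beta> + 1) / (\<beta> - 1)"
| "basic_f' (Basic5 \<beta>) = (\<beta> + 1) / (\<beta> - 1)"
| "basic_f' (Basic6 \<beta>) = (\<beta> + 1) / (\<beta> - 1)"
| "basic_f' (Basic7 \<beta>) = (\<beta> + 1) / (\<beta> - 1)"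
| "basic_f' _ = 1"

fun basic_g' :: "basic \<Rightarrow> real \<Rightarrow> real" where
  "basic_g' Basic8 x = 1 / x\<^sup>2"
| "basic_g' Basic9 x = 1 / x\<^sup>2"
| "basic_g' (Basic10 \<beta> \<gamma>) x = (\<beta>\<^sup>2 - 4 * \<gamma>) / (4 * x\<^sup>2)"
| "basic_g' _ x = 1"

text \<open>The removed points are the umbilic values, where \<open>basic_f\<close> equals
  \<open>basic_g\<close>, and the poles of \<open>basic_g\<close>. Class (9) has one of each;
  classes (8) and (10) have only the pole.\<close>

fun basic_dom :: "basic \<Rightarrow> real set" where
  "basic_dom Basic2 = - {1/2}"
| "basic_dom Basic3 = UNIV"
| "basic_dom (Basic6 \<beta>) = - {1}"
| "basic_dom (Basic7 \<beta>) = - {1}"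
| "basic_dom Basic9 = - {0, 1}"
| "basic_dom _ = - {0}"

lemma open_basic_dom: "open (basic_dom b)"
  by (cases b) (auto intro!: open_Compl)

lemma admissible_neq:
  assumes "admissible b" and "b \<in> {Basic4 \<beta>, Basic5 \<beta>, Basic6 \<beta>, Basic7 \<beta>}"
  shows "\<beta> \<noteq> 0" and "\<beta> - 1 \<noteq> 0" and "\<beta> + 1 \<noteq> 0"
proof -
  have "\<beta>\<^sup>2 > 1 \<or> \<beta>\<^sup>2 < 1 \<and> \<beta> \<noteq> 0" using assms by auto
  then have "\<beta> \<noteq> 0 \<and> \<beta> \<noteq> 1 \<and> \<beta> \<noteq> - 1" by auto
  then show "\<beta> \<noteq> 0" "\<beta> - 1 \<noteq> 0" "\<beta> + 1 \<noteq> 0" by auto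
qed

lemma discriminant_pos: "\<gamma> < 0 \<Longrightarrow> \<beta>\<^sup>2 - 4 * \<gamma> > (0::real)"
  using zero_le_power2[of \<beta>] by linarith

text \<open>Each relation is affine in one curvature when the other is fixed, so it can be solved
  once the coefficient to be divided by is known to be non-zero. This is the uniqueness half;
  \<open>basic_rel_basic\<close> is the converse.\<close>

lemma basic_rel_iff:
  assumes b: "admissible b" and "k \<noteq> m" and rel: "basic_rel b (k * m) ((k + m) / 2) ((k - m) / 2)"
  shows "basic_param b k m \<in> basic_dom b \<and> k = basic_f b (basic_param b k m)
    \<and> m = basic_g b (basic_param b k m)"
proof (cases b)
  case Basic8
  then have "k * m = - 1" using rel by simp
  moreover from this have "k \<noteq> 0" by auto
  ultimately show ?thesis using Basic8 by (simp add: field_simps)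
next
  case Basic9
  then have r: "m * (k + 1) = k" using rel by (simp add: algebra_simps)
  have "k + 1 \<noteq> 0"
  proof
    assume k: "k + 1 = 0"
    then show False using r by simp
  qed
  moreover from this have "m = k / (k + 1)" using r by (metis nonzero_mult_div_cancel_right)
  moreover from this have "k \<noteq> 0" using \<open>k \<noteq> m\<close> by auto
  moreover have "1 - 1 / (k + 1) = k / (k + 1)" using \<open>k + 1 \<noteq> 0\<close> by (simp add: field_simps)
  ultimately show ?thesis using Basic9 by simp
next
  case (Basic10 \<beta> \<gamma>)
  then have "k * m = \<beta> * ((k - m) / 2) + \<gamma>" using rel by simp
  \<comment> \<open>Collecting the multiples of \<open>m\<close> gives the factor k + \<beta>/2.
    This is why the parameter of class (10) is shifted by \<beta>/2: \<open>m\<close> becomes a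
    constant plus a multiple of its reciprocal.\<close>
  then have r: "m * (k + \<beta> / 2) = \<beta> / 2 * (k + \<beta> / 2) - (\<beta>\<^sup>2 - 4 * \<gamma>) / 4"
    by (simp add: field_simps power2_eq_square)
  have d: "\<beta>\<^sup>2 - 4 * \<gamma> > 0" using b Basic10 by (intro discriminant_pos) simp
  have x: "k + \<beta> / 2 \<noteq> 0"
  proof
    assume "k + \<beta> / 2 = 0"
    with r d show False by simp
  qed
  have "m = (\<beta> / 2 * (k + \<beta> / 2) - (\<beta>\<^sup>2 - 4 * \<gamma>) / 4) / (k + \<beta> / 2)"
    using r x by (metis nonzero_mult_div_cancel_right)
  also have "\<dots> = \<beta> / 2 - (\<beta>\<^sup>2 - 4 * \<gamma>) / (4 * (k + \<beta> / 2))"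
  proof -
    have "(\<beta> / 2 * t - d / 4) / t = \<beta> / 2 - d / (4 * t)" if "t \<noteq> 0" for t d
      using that by (simp add: field_simps)
    then show ?thesis using x by blast
  qed
  finally show ?thesis using Basic10 x by simp
next
  case (Basic4 \<beta>)
  then have r: "k * (\<beta> - 1) = (\<beta> + 1) * m" using rel by (simp add: field_simps)
  then have "k = (\<beta> + 1) / (\<beta> - 1) * m" using admissible_neq[OF b, of \<beta>] Basic4 by (simp add: field_simps)
  then show ?thesis using Basic4 \<open>k \<noteq> m\<close> by auto
next
  case (Basic5 \<beta>)
  then have r: "k * (\<beta> - 1) = (\<beta> + 1) * m" using rel by (simp add: field_simps)
  then have "k = (\<beta> + 1) / (\<beta> - 1) * m" using admissible_neq[OF b, of \<beta>] Basic5 by (simp add: field_simps)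
  then show ?thesis using Basic5 \<open>k \<noteq> m\<close> by auto
next
  case (Basic6 \<beta>)
  then have r: "k * (\<beta> - 1) = (\<beta> + 1) * m - 2" using rel by (simp add: field_simps)
  have n: "\<beta> - 1 \<noteq> 0" using admissible_neq[OF b, of \<beta>] Basic6 by simp
  then have "k = ((\<beta> + 1) * m - 2) / (\<beta> - 1)" using r by (simp add: field_simps)
  moreover from this have "m \<noteq> 1" using \<open>k \<noteq> m\<close> n by auto
  ultimately show ?thesis using Basic6 by auto
next
  case (Basic7 \<beta>)
  then have r: "k * (\<beta> - 1) = (\<beta> + 1) * m - 2" using rel by (simp add: field_simps)
  have n: "\<beta> - 1 \<noteq> 0" using admissible_neq[OF b, of \<beta>] Basic7 by simp
  then have "k = ((\<beta> + 1) * m - 2) / (\<beta> - 1)" using r by (simp add: field_simps)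
  moreover from this have "m \<noteq> 1" using \<open>k \<noteq> m\<close> n by auto
  ultimately show ?thesis using Basic7 by auto
qed (use assms in auto)

lemma basic_f_DERIV: "admissible b \<Longrightarrow> (basic_f b has_real_derivative basic_f' b) (at x)"
  by (cases b; hypsubst; unfold basic_f.simps[abs_def]) (auto intro!: derivative_eq_intros)

lemma basic_g_DERIV: "x \<in> basic_dom b \<Longrightarrow> (basic_g b has_real_derivative basic_g' b x) (at x)"
  by (cases b; hypsubst; unfold basic_g.simps[abs_def])
    (auto intro!: derivative_eq_intros simp: power2_eq_square field_simps)

lemma basic_g'_differentiable: "x \<in> basic_dom b \<Longrightarrow> basic_g' b differentiable at x"
  by (cases b; hypsubst; unfold basic_g'.simps[abs_def]) (auto intro!: derivative_intros)

lemma basic_f'_neq_0: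
  assumes "admissible b"
  shows "basic_f' b \<noteq> 0"
proof (cases "\<exists>\<beta>. b \<in> {Basic4 \<beta>, Basic5 \<beta>, Basic6 \<beta>, Basic7 \<beta>}")
  case True
  then obtain \<beta> where "b \<in> {Basic4 \<beta>, Basic5 \<beta>, Basic6 \<beta>, Basic7 \<beta>}" ..
  with admissible_neq[OF assms this] show ?thesis by auto
next
  case False
  then show ?thesis by (cases b) auto
qed

lemma basic_g'_neq_0:
  assumes "admissible b" "x \<in> basic_dom b"
  shows "basic_g' b x \<noteq> 0"
proof (cases b)
  case (Basic10 \<beta> \<gamma>)
  then show ?thesis using discriminant_pos[of \<gamma> \<beta>] assms by simp
qed (use assms in auto)

text \<open>In classes (4) to (7) f - g is a multiple of the shifted parameter. Hence the integrals
  in the natural PDE are logarithms and its exponential factors are powers.\<close>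

lemma basic_f_minus_g:
  assumes "admissible b" and \<beta>: "b \<in> {Basic4 \<beta>, Basic5 \<beta>, Basic6 \<beta>, Basic7 \<beta>}"
  shows "basic_f b x - basic_g b x = 2 * (if b \<in> {Basic4 \<beta>, Basic5 \<beta>} then x else x - 1) / (\<beta> - 1)"
proof -
  have "\<beta> - 1 \<noteq> 0" by (rule admissible_neq[OF assms])
  then have "(\<beta> + 1) / (\<beta> - 1) * x - x = 2 * x / (\<beta> - 1)"
    and "((\<beta> + 1) * x - 2) / (\<beta> - 1) - x = 2 * (x - 1) / (\<beta> - 1)"
    by (simp_all add: divide_simps) algebra+
  with \<beta> show ?thesis by auto
qed

text \<open>In classes (8) to (10) the numerators of f - g are x^2 + 1, (x - 1)^2 and (x -
  \<beta>/2)^2 - \<gamma>. The first and the last are positive, the latter because \<gamma> < 0; the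
  second vanishes only at the excluded value 1.\<close>

lemma basic_f_neq_g:
  assumes b: "admissible b" and x: "x \<in> basic_dom b"
  shows "basic_f b x \<noteq> basic_g b x"
proof (cases "\<exists>\<beta>. b \<in> {Basic4 \<beta>, Basic5 \<beta>, Basic6 \<beta>, Basic7 \<beta>}")
  case True
  then obtain \<beta> where \<beta>: "b \<in> {Basic4 \<beta>, Basic5 \<beta>, Basic6 \<beta>, Basic7 \<beta>}" ..
  have n: "\<beta> - 1 \<noteq> 0" by (rule admissible_neq[OF b \<beta>])
  with basic_f_minus_g[OF b \<beta>] \<beta> x have "basic_f b x - basic_g b x \<noteq> 0" by auto
  then show ?thesis by simp
next
  case False
  note nFalse = this
  show ?thesis
  proof (cases b)
    case Basic8
    then have "x \<noteq> 0" using x by simp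
    moreover have "x\<^sup>2 \<noteq> - 1" using zero_le_power2[of x] by linarith
    ultimately show ?thesis using Basic8 by (simp add: field_simps power2_eq_square)
  next
    case Basic9
    then have "x \<noteq> 0" "(x - 1)\<^sup>2 \<noteq> 0" using x by auto
    moreover have "(x - 1) - (1 - 1 / x) = (x - 1)\<^sup>2 / x"
      using \<open>x \<noteq> 0\<close> by (simp add: field_simps power2_eq_square)
    ultimately show ?thesis using Basic9 by (metis basic_f.simps(9) basic_g.simps(2) divide_eq_0_iff right_minus_eq)
  next
    case (Basic10 \<beta> \<gamma>)
    then have "x \<noteq> 0" "\<gamma> < 0" using x b by auto
    then have "(x - \<beta> / 2) - (\<beta> / 2 - (\<beta>\<^sup>2 - 4 * \<gamma>) / (4 * x)) = ((x - \<beta> / 2)\<^sup>2 - \<gamma>) / x"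
      by (simp add: field_simps power2_eq_square)
    moreover have "(x - \<beta> / 2)\<^sup>2 - \<gamma> \<noteq> 0"
      using \<open>\<gamma> < 0\<close> zero_le_power2[of "x - \<beta> / 2"] by linarith
    ultimately show ?thesis using Basic10 \<open>x \<noteq> 0\<close>
      by (metis basic_f.simps(10) basic_g.simps(3) divide_eq_0_iff right_minus_eq)
  qed (use x nFalse in auto)
qed

lemma basic_rel_basic:
  assumes b: "admissible b" and x: "x \<in> basic_dom b"
  shows "basic_rel b (basic_f b x * basic_g b x) ((basic_f b x + basic_g b x) / 2)
      ((basic_f b x - basic_g b x) / 2)"
    and "basic_param b (basic_f b x) (basic_g b x) = x"
proof -
  show "basic_param b (basic_f b x) (basic_g b x) = x" by (cases b) auto
  show "basic_rel b (basic_f b x * basic_g b x) ((basic_f b x + basic_g b x) / 2)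
      ((basic_f b x - basic_g b x) / 2)"
  proof (cases "\<exists>\<beta>. b \<in> {Basic4 \<beta>, Basic5 \<beta>, Basic6 \<beta>, Basic7 \<beta>}")
    case True
    then obtain \<beta> where \<beta>: "b \<in> {Basic4 \<beta>, Basic5 \<beta>, Basic6 \<beta>, Basic7 \<beta>}" ..
    have n: "\<beta> - 1 \<noteq> 0" by (rule admissible_neq[OF b \<beta>])
    have "((\<beta> + 1) / (\<beta> - 1) * x + x) / 2 = \<beta> * (((\<beta> + 1) / (\<beta> - 1) * x - x) / 2)"
      using n by (simp add: divide_simps) algebra
    moreover have "(((\<beta> + 1) * x - 2) / (\<beta> - 1) + x) / 2 = \<beta> * ((((\<beta> + 1) * x - 2) / (\<beta> - 1) - x) / 2) + 1"
      using n by (simp add: divide_simps) algebra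
    ultimately show ?thesis using \<beta> by auto
  next
    case False
    show ?thesis
    proof (cases b)
      case Basic9
      then show ?thesis using x by (simp add: field_simps)
    next
      case (Basic10 \<beta> \<gamma>)
      then show ?thesis using x by (simp add: field_simps power2_eq_square)
    qed (use False x in auto)
  qed
qed

text \<open>\<open>W_functions\<close> speaks of \<open>deriv\<close>, which agrees with the
  explicit \<open>f'\<close> and \<open>g'\<close> only on \<open>I\<close>. Openness of
  \<open>I\<close> carries their differentiability over to \<open>deriv f\<close> and
  \<open>deriv g\<close>.\<close>

lemma W_functions_cong:
  assumes I: "open I" "is_interval I" "I \<noteq> {}"
    and f: "\<And>x. x \<in> I \<Longrightarrow> (f has_real_derivative f' x) (at x)" "\<And>x. x \<in> I \<Longrightarrow> f' differentiable at x"
    and g: "\<And>x. x \<in> I \<Longrightarrow> (g has_real_derivative g' x) (at x)" "\<And>x. x \<in> I \<Longrightarrow> g' differentiable at x"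
    and n: "\<And>x. x \<in> I \<Longrightarrow> f x \<noteq> g x \<and> f' x \<noteq> 0 \<and> g' x \<noteq> 0"
  shows "W_functions I f g"
proof -
  have d: "deriv f x = f' x" "deriv g x = g' x" if "x \<in> I" for x
    using f(1)[OF that] g(1)[OF that] by (auto intro: DERIV_imp_deriv)
  have "h differentiable at x" if h: "h' differentiable at x" "\<And>x. x \<in> I \<Longrightarrow> h x = h' x" "x \<in> I"
    for h h' :: "real \<Rightarrow> real" and x
  proof -
    obtain D where "(h' has_derivative D) (at x)" using h(1) unfolding differentiable_def by blast
    then have "(h has_derivative D) (at x)"
      by (rule has_derivative_transform_within_open[OF _ I(1) h(3)]) (simp add: h(2))
    then show ?thesis by (auto simp: differentiable_def)
  qed
  from this[OF f(2) d(1)] this[OF g(2) d(2)]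
  have "deriv f differentiable at x" "deriv g differentiable at x" if "x \<in> I" for x
    using that by auto
  moreover have "f differentiable at x" "g differentiable at x" if "x \<in> I" for x
    using f(1)[OF that] g(1)[OF that] real_differentiable_def by blast+
  ultimately show ?thesis
    using I n d unfolding W_functions_def by auto
qed

lemma basic_functions_basic:
  assumes "admissible b" and J: "open J" "is_interval J" "J \<noteq> {}" "J \<subseteq> basic_dom b"
  shows "basic_functions b J (basic_f b) (basic_g b)"
proof -
  have "W_functions J (basic_f b) (basic_g b)"
    using J(4) assms(1)
    by (intro W_functions_cong[OF J(1-3), where f'="\<lambda>_. basic_f' b" and g'="basic_g' b"])
      (auto intro!: basic_f_DERIV basic_g_DERIV basic_g'_differentiable basic_f'_neq_0
        dest: basic_f_neq_g basic_g'_neq_0)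
  then show ?thesis unfolding basic_functions_def
    using assms basic_rel_basic[OF assms(1)] by auto
qed

text \<open>\<open>basic_functions\<close> prescribes f and g on \<open>I\<close> only. Since
  \<open>I\<close> is open, this still determines their derivatives there, so the explicit formulas
  may replace arbitrary representatives.\<close>

lemma basic_functionsD:
  assumes "basic_functions b I f g" and x: "x \<in> I"
  shows "x \<in> basic_dom b" "f x = basic_f b x" "g x = basic_g b x"
    "deriv f x = basic_f' b" "deriv g x = basic_g' b x"
proof -
  have b: "admissible b" and W: "W_functions I f g"
    and r: "\<And>x. x \<in> I \<Longrightarrow> basic_rel b (f x * g x) ((f x + g x) / 2) ((f x - g x) / 2) \<and> basic_param b (f x) (g x) = x"
    using assms by (auto simp: basic_functions_def)
  have all: "x \<in> basic_dom b \<and> f x = basic_f b x \<and> g x = basic_g b x" if "x \<in> I" for x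
    using basic_rel_iff[OF b, of "f x" "g x"] r[OF that] W that by (auto simp: W_functions_def)
  then show xd: "x \<in> basic_dom b" "f x = basic_f b x" "g x = basic_g b x" using x by auto
  have I: "open I" using W by (simp add: W_functions_def)
  have "(f has_real_derivative basic_f' b) (at x)"
    by (rule has_field_derivative_transform_within_open[OF basic_f_DERIV[OF b] I x]) (simp add: all)
  then show "deriv f x = basic_f' b" by (rule DERIV_imp_deriv)
  have "(g has_real_derivative basic_g' b x) (at x)"
    by (rule has_field_derivative_transform_within_open[OF basic_g_DERIV[OF xd(1)] I x]) (simp add: all)
  then show "deriv g x = basic_g' b x" by (rule DERIV_imp_deriv)
qed

section \<open>The listed equations\<close>

text \<open>Both logarithmic derivatives equal 1/\<nu>, so both factors are multiples of \<nu> =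
  e^\<lambda>, and P and Q are multiples of \<lambda> itself. The multiple 2 normalizes the right
  side to e^\<lambda>; the opposite signs of f' and g' make the operator hyperbolic.\<close>

lemma natural_pde_Basic1:
  assumes bf: "basic_functions Basic1 I f g" and sub: "I \<subseteq> unknown_subst Basic1 ` unknown_dom Basic1"
  shows "natural_pde_is_listed Basic1 I f g"
proof -
  note bfD = basic_functionsD[OF bf]
  have W: "W_functions I f g" using bf by (simp add: basic_functions_def)
  have pos: "y > 0" if "y \<in> I" for y using sub that by auto
  show ?thesis
    by (rule natural_pde_is_listedI[OF W, where A="\<lambda>y. 2 * y" and B="\<lambda>y. 2 * y" and \<kappa>=2 and \<sigma>="- 1"
          and \<phi>="\<lambda>x. x" and \<psi>="\<lambda>x. x" and X="{x. exp x \<in> I}" and ?s1.0=exp and ?s2.0=exp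
          and ?\<phi>1.0="\<lambda>_. 1" and ?\<psi>1.0="\<lambda>_. 1"])
      (auto simp: bfD pos lap_bar_def unknown_subst.simps[abs_def] intro!: derivative_eq_intros dest: pos)
qed

text \<open>Both factors solve the equation with logarithmic derivative -2 / (1 - 2 \<nu>), so they
  are multiples of 1 - 2 \<nu> = e^\<lambda>, and again P and Q are linear in \<lambda>. The
  inclusion \<open>sub\<close> supplies \<nu> < 1/2.\<close>

lemma natural_pde_Basic2:
  assumes bf: "basic_functions Basic2 I f g" and sub: "I \<subseteq> unknown_subst Basic2 ` unknown_dom Basic2"
  shows "natural_pde_is_listed Basic2 I f g"
proof -
  note bfD = basic_functionsD[OF bf]
  have W: "W_functions I f g" using bf by (simp add: basic_functions_def)
  have pos: "y * 2 < 1" if "y \<in> I" for y using sub that by auto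
  have pos': "2 * y \<noteq> 1" if "y \<in> I" for y using pos[OF that] by simp
  show ?thesis
    by (rule natural_pde_is_listedI[OF W, where A="\<lambda>y. 1 - 2 * y" and B="\<lambda>y. 1 - 2 * y" and \<kappa>="- 2"
          and \<sigma>="- 1" and \<phi>="\<lambda>x. x" and \<psi>="\<lambda>x. x" and X="{x. (1 - exp x) / 2 \<in> I}"
          and ?s1.0="\<lambda>x. - exp x / 2" and ?s2.0="\<lambda>x. - exp x / 2"
          and ?\<phi>1.0="\<lambda>_. 1" and ?\<psi>1.0="\<lambda>_. 1"])
      (auto simp: bfD pos pos' lap_bar_def unknown_subst.simps[abs_def] sinh_field_def exp_minus
        field_simps intro!: derivative_eq_intros dest: pos pos')
qed

text \<open>Here f - g = 2 is constant, so the two factors are e^\<nu> and its reciprocal. Hence P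
  is e^\<nu> and Q is a multiple of e^(-\<nu>), which is the pair in the starred operator.\<close>

lemma natural_pde_Basic3:
  assumes bf: "basic_functions Basic3 I f g"
  shows "natural_pde_is_listed Basic3 I f g"
proof -
  note bfD = basic_functionsD[OF bf]
  have W: "W_functions I f g" using bf by (simp add: basic_functions_def)
  show ?thesis
    by (rule natural_pde_is_listedI[OF W, where A=exp and B="\<lambda>y. inverse (exp y)" and \<kappa>=1
          and \<sigma>="- 1" and \<phi>=exp and \<psi>="\<lambda>x. inverse (exp x)" and X=I
          and ?s1.0="\<lambda>x. 1" and ?s2.0="\<lambda>x. 0"
          and ?\<phi>1.0=exp and ?\<psi>1.0="\<lambda>x. - inverse (exp x)"])
      (auto simp: bfD lap_bar_star_def unknown_subst.simps[abs_def]
        field_simps power2_eq_square intro!: derivative_eq_intros)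
qed

text \<open>Both f'/A and g'/B equal 1 / (1 + \<nu>^2), so P and Q are both arctan \<nu>, that is
  \<lambda>/2. As f' and g' have the same sign, the operator is the elliptic Laplacian.\<close>

lemma natural_pde_Basic8:
  assumes bf: "basic_functions Basic8 I f g"
  shows "natural_pde_is_listed Basic8 I f g"
proof -
  note bfD = basic_functionsD[OF bf]
  have W: "W_functions I f g" using bf by (simp add: basic_functions_def)
  have nz: "y \<noteq> 0" if "y \<in> I" for y using bfD[OF that] by simp
  have sq: "y\<^sup>2 + 1 > 0" "y\<^sup>2 + 1 \<noteq> 0" for y :: real by (simp_all add: add_nonneg_pos add_nonneg_eq_0_iff)
  have fg: "y + 1 / y = (y\<^sup>2 + 1) / y" if "y \<in> I" for y :: real
    using nz[OF that] by (simp add: field_simps power2_eq_square)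
  show ?thesis
  proof (rule natural_pde_is_listedI[OF W, where A="\<lambda>y. y\<^sup>2 + 1" and B="\<lambda>y. (y\<^sup>2 + 1) / y\<^sup>2" and \<kappa>=2
          and \<sigma>=1 and \<phi>="\<lambda>x. x" and \<psi>="\<lambda>x. x" and X="{x. cos (x / 2) \<noteq> 0 \<and> tan (x / 2) \<in> I}"
          and ?s1.0="\<lambda>x. ((tan (x / 2))\<^sup>2 + 1) / 2" and ?s2.0="\<lambda>x. tan (x / 2) * ((tan (x / 2))\<^sup>2 + 1) / 2"
          and ?\<phi>1.0="\<lambda>_. 1" and ?\<psi>1.0="\<lambda>_. 1"])
    fix y assume y: "y \<in> I"
    show "((\<lambda>y. y\<^sup>2 + 1) has_real_derivative 2 * deriv f y / (f y - g y) * (y\<^sup>2 + 1)) (at y)"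
      using y nz[OF y] sq[of y] by (auto intro!: derivative_eq_intros simp: bfD fg)
    have "2 * deriv g y / (g y - f y) * ((y\<^sup>2 + 1) / y\<^sup>2) = - 2 / y ^ 3"
    proof -
      have "g y - f y = - ((y\<^sup>2 + 1) / y)" using fg[OF y] by (simp add: bfD[OF y])
      moreover have "2 * (1 / y\<^sup>2) / (- (q / y)) * (q / y\<^sup>2) = - 2 / y ^ 3" if "q \<noteq> 0" for q
        using that nz[OF y] by (simp add: power2_eq_square power3_eq_cube)
      ultimately show ?thesis using sq[of y] by (simp only: bfD[OF y] basic_g'.simps)
    qed
    moreover have "((\<lambda>y. (y\<^sup>2 + 1) / y\<^sup>2) has_real_derivative - 2 / y ^ 3) (at y)"
      using nz[OF y] by (auto intro!: derivative_eq_intros simp: field_simps power2_eq_square power3_eq_cube)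
    ultimately show "((\<lambda>y. (y\<^sup>2 + 1) / y\<^sup>2) has_real_derivative
        2 * deriv g y / (g y - f y) * ((y\<^sup>2 + 1) / y\<^sup>2)) (at y)" by simp
    show "y\<^sup>2 + 1 > 0" by (rule sq)
    show "(y\<^sup>2 + 1) / y\<^sup>2 > 0" using nz[OF y] sq[of y] by simp
  next
    fix x assume "x \<in> {x. cos (x / 2) \<noteq> 0 \<and> tan (x / 2) \<in> I}"
    then have c: "cos (x / 2) \<noteq> 0" and y: "tan (x / 2) \<in> I" by auto
    have inv: "inverse ((cos (x / 2))\<^sup>2) = (tan (x / 2))\<^sup>2 + 1" using tan_sec[OF c] by (simp add: power_inverse)
    show "(unknown_subst Basic8 has_real_derivative ((tan (x / 2))\<^sup>2 + 1) / 2) (at x)"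
      unfolding unknown_subst.simps[abs_def] using c
      by (auto intro!: derivative_eq_intros simp: inv)
    show "((\<lambda>x. ((tan (x / 2))\<^sup>2 + 1) / 2) has_real_derivative tan (x / 2) * ((tan (x / 2))\<^sup>2 + 1) / 2) (at x)"
      using c by (auto intro!: derivative_eq_intros simp: inv)
    let ?t = "tan (x / 2)"
    have "x = 2 * (x / 2)" by simp
    then have "sin x = 2 * sin (x / 2) * cos (x / 2)" by (metis sin_double)
    also have "\<dots> = 2 * ?t * (cos (x / 2))\<^sup>2" using c by (simp add: tan_def power2_eq_square)
    also have "\<dots> = 2 * ?t / (?t\<^sup>2 + 1)"
      using inv sq[of ?t] c by (metis divide_inverse inverse_inverse_eq)
    finally have "sin x = 2 * ?t / (?t\<^sup>2 + 1)" .
    then show "listed_rhs Basic8 x * ((unknown_subst Basic8 x)\<^sup>2 + 1) *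
       (((unknown_subst Basic8 x)\<^sup>2 + 1) / (unknown_subst Basic8 x)\<^sup>2) =
      2 * f (unknown_subst Basic8 x) * g (unknown_subst Basic8 x) *
         (f (unknown_subst Basic8 x) - g (unknown_subst Basic8 x))"
      using nz[OF y] sq[of ?t] fg[OF y] by (simp add: bfD[OF y] power2_eq_square, simp add: field_simps)
  qed (auto simp: bfD nz lap_def field_simps intro!: derivative_eq_intros)
qed

text \<open>Integrating 2 f' / (f - g) = 2 / (\<nu> - 1) + 2 / (\<nu> - 1)^2 gives a square times an
  exponential. The listed unknown is the exponent 2 - 2 / (\<nu> - 1), and the summand 2 is its
  normalization.\<close>

lemma natural_pde_Basic9:
  assumes bf: "basic_functions Basic9 I f g"
  shows "natural_pde_is_listed Basic9 I f g"
proof -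
  note bfD = basic_functionsD[OF bf]
  have W: "W_functions I f g" using bf by (simp add: basic_functions_def)
  have nz: "y \<noteq> 0" "y - 1 \<noteq> 0" if "y \<in> I" for y using bfD[OF that] by auto
  have fg: "f y - g y = (y - 1)\<^sup>2 / y" if "y \<in> I" for y :: real
    using nz[OF that] by (simp add: bfD[OF that] field_simps power2_eq_square)
  have fg': "g y - f y = - ((y - 1)\<^sup>2 / y)" if "y \<in> I" for y using fg[OF that] by simp
  show ?thesis
  proof (rule natural_pde_is_listedI[OF W, where A="\<lambda>y. (y - 1)\<^sup>2 * exp (2 - 2 / (y - 1))"
          and B="\<lambda>y. (1 - 1 / y)\<^sup>2 * exp (2 / (y - 1) - 2)" and \<kappa>=2
          and \<sigma>="- 1" and \<phi>=exp and \<psi>="\<lambda>x. inverse (exp x)" and X="{x. x \<noteq> 2 \<and> (x - 4) / (x - 2) \<in> I}"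
          and ?s1.0="\<lambda>x. 2 / (x - 2)\<^sup>2" and ?s2.0="\<lambda>x. - 4 / (x - 2) ^ 3"
          and ?\<phi>1.0=exp and ?\<psi>1.0="\<lambda>x. - inverse (exp x)"])
    fix y assume y: "y \<in> I"
    have d: "((\<lambda>y. 2 / (y - 1)) has_real_derivative - 2 / (y - 1)\<^sup>2) (at y)"
      using nz[OF y] by (auto intro!: derivative_eq_intros simp: power2_eq_square)
    have "((\<lambda>y. (y - 1)\<^sup>2 * exp (2 - 2 / (y - 1))) has_real_derivative
        (2 * (y - 1) + 2) * exp (2 - 2 / (y - 1))) (at y)"
    proof -
      have e: "2 * (y - 1) + (y - 1)\<^sup>2 * (2 / (y - 1)\<^sup>2) = 2 * (y - 1) + 2" using nz[OF y] by simp
      have "((\<lambda>y. (y - 1)\<^sup>2 * exp (2 - 2 / (y - 1))) has_real_derivative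
        (2 * (y - 1) + (y - 1)\<^sup>2 * (2 / (y - 1)\<^sup>2)) * exp (2 - 2 / (y - 1))) (at y)"
        by (rule derivative_eq_intros d refl nz[OF y] | use nz[OF y] in \<open>simp add: algebra_simps power2_eq_square\<close>)+
      then show ?thesis unfolding e .
    qed
    moreover have "2 * deriv f y / (f y - g y) * ((y - 1)\<^sup>2 * exp (2 - 2 / (y - 1))) =
        (2 * (y - 1) + 2) * exp (2 - 2 / (y - 1))"
      using nz[OF y] unfolding fg[OF y] by (simp add: bfD(4)[OF y])
    ultimately show "((\<lambda>y. (y - 1)\<^sup>2 * exp (2 - 2 / (y - 1))) has_real_derivative
        2 * deriv f y / (f y - g y) * ((y - 1)\<^sup>2 * exp (2 - 2 / (y - 1)))) (at y)" by simp
    have "((\<lambda>y. (1 - 1 / y)\<^sup>2 * exp (2 / (y - 1) - 2)) has_real_derivative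
        (2 * (1 - 1 / y) / y\<^sup>2 - 2 / y\<^sup>2) * exp (2 / (y - 1) - 2)) (at y)"
    proof -
      have "1 - 1 / y = (y - 1) / y" using nz[OF y] by (simp add: field_simps)
      then have e: "2 * (1 - 1 / y) / y\<^sup>2 - (1 - 1 / y)\<^sup>2 * (2 / (y - 1)\<^sup>2) = 2 * (1 - 1 / y) / y\<^sup>2 - 2 / y\<^sup>2"
        using nz[OF y] by (simp add: power_divide)
      have "((\<lambda>y. (1 - 1 / y)\<^sup>2 * exp (2 / (y - 1) - 2)) has_real_derivative
        (2 * (1 - 1 / y) / y\<^sup>2 - (1 - 1 / y)\<^sup>2 * (2 / (y - 1)\<^sup>2)) * exp (2 / (y - 1) - 2)) (at y)"
        by (rule derivative_eq_intros d refl nz[OF y] | use nz[OF y] in \<open>simp add: algebra_simps power2_eq_square\<close>)+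
      then show ?thesis unfolding e .
    qed
    moreover have "2 * deriv g y / (g y - f y) * ((1 - 1 / y)\<^sup>2 * exp (2 / (y - 1) - 2)) =
      (2 * (1 - 1 / y) / y\<^sup>2 - 2 / y\<^sup>2) * exp (2 / (y - 1) - 2)"
    proof -
      have "1 - 1 / y = (y - 1) / y" using nz[OF y] by (simp add: field_simps)
      then have "2 * deriv g y / (g y - f y) * (1 - 1 / y)\<^sup>2 = - 2 / y ^ 3"
        using nz[OF y] unfolding fg'[OF y]
        by (simp add: bfD(5)[OF y] power_divide power2_eq_square power3_eq_cube)
      also have "\<dots> = 2 * (1 - 1 / y) / y\<^sup>2 - 2 / y\<^sup>2"
        using nz[OF y] by (simp add: field_simps power2_eq_square power3_eq_cube)
      finally show ?thesis by (simp only: mult.assoc[symmetric])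
    qed
    ultimately show "((\<lambda>y. (1 - 1 / y)\<^sup>2 * exp (2 / (y - 1) - 2)) has_real_derivative
       2 * deriv g y / (g y - f y) * ((1 - 1 / y)\<^sup>2 * exp (2 / (y - 1) - 2))) (at y)" by simp
    show "(y - 1)\<^sup>2 * exp (2 - 2 / (y - 1)) > 0" using nz[OF y] by simp
    show "(1 - 1 / y)\<^sup>2 * exp (2 / (y - 1) - 2) > 0" using nz[OF y] by simp
  next
    fix x assume "x \<in> {x. x \<noteq> 2 \<and> (x - 4) / (x - 2) \<in> I}"
    then have c: "x - 2 \<noteq> 0" and y: "(x - 4) / (x - 2) \<in> I" by auto
    let ?y = "(x - 4) / (x - 2)"
    have y1: "?y - 1 = - 2 / (x - 2)" using c by (simp add: field_simps)
    have e: "2 / (?y - 1) = 2 - x" unfolding y1 using c by (simp, simp add: field_simps)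
    have i: "1 - 1 / ?y = (?y - 1) / ?y" 
    proof -
      have "1 - 1 / t = (t - 1) / t" if "t \<noteq> 0" for t :: real using that by (simp add: diff_divide_distrib)
      then show ?thesis using nz(1)[OF y] by blast
    qed
    have s1: "2 / (x - 2)\<^sup>2 = (?y - 1)\<^sup>2 / 2" unfolding y1 by (simp add: power_divide)
    show "(unknown_subst Basic9 has_real_derivative 2 / (x - 2)\<^sup>2) (at x)"
      unfolding unknown_subst.simps[abs_def] using c
      by (auto intro!: derivative_eq_intros simp: power2_eq_square)
    have "((\<lambda>u. 2 / u\<^sup>2) has_real_derivative - 4 / u ^ 3) (at u)" if "u \<noteq> 0" for u :: real
      using that by (auto intro!: derivative_eq_intros simp: field_simps power2_eq_square power3_eq_cube)
    moreover have "((\<lambda>x. x - 2) has_real_derivative 1) (at x)" by (auto intro!: derivative_eq_intros)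
    ultimately show "((\<lambda>x. 2 / (x - 2)\<^sup>2) has_real_derivative - 4 / (x - 2) ^ 3) (at x)"
      using DERIV_chain2[where f="\<lambda>u. 2 / u\<^sup>2" and g="\<lambda>x. x - 2" and x=x and s=UNIV and Db=1] c
      by fastforce
    show "(exp has_real_derivative exp x) (at x)" by (rule DERIV_exp)
    show "((\<lambda>x. inverse (exp x)) has_real_derivative - inverse (exp x)) (at x)"
      by (auto intro!: derivative_eq_intros simp: power2_eq_square)
    show "exp x * ((1 - 1 / unknown_subst Basic9 x)\<^sup>2 * exp (2 / (unknown_subst Basic9 x - 1) - 2)) =
         2 * deriv g (unknown_subst Basic9 x) * (2 / (x - 2)\<^sup>2)"
      unfolding unknown_subst.simps s1 e i using nz[OF y]
      by (simp add: bfD[OF y] exp_diff exp_minus power_divide power_mult_distrib)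
    show "- inverse (exp x) * ((unknown_subst Basic9 x - 1)\<^sup>2 * exp (2 - 2 / (unknown_subst Basic9 x - 1))) =
         - 1 * 2 * deriv f (unknown_subst Basic9 x) * (2 / (x - 2)\<^sup>2)"
      unfolding unknown_subst.simps s1 e
      by (simp add: bfD[OF y])
    have "f ?y * g ?y = (?y - 1)\<^sup>2 / ?y"
      using i nz[OF y] by (simp add: bfD[OF y] power2_eq_square del: diff_divide_eq_iff)
    then show "listed_rhs Basic9 x * ((unknown_subst Basic9 x - 1)\<^sup>2 * exp (2 - 2 / (unknown_subst Basic9 x - 1))) *
         ((1 - 1 / unknown_subst Basic9 x)\<^sup>2 * exp (2 / (unknown_subst Basic9 x - 1) - 2)) =
         2 * f (unknown_subst Basic9 x) * g (unknown_subst Basic9 x) *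
         (f (unknown_subst Basic9 x) - g (unknown_subst Basic9 x))"
    proof -
      have "2 * ((t - 1)\<^sup>2 * e1) * (((t - 1) / t)\<^sup>2 * e2) = 2 * p * q * ((t - 1)\<^sup>2 / t)"
        if "p * q = (t - 1)\<^sup>2 / t" "e1 * e2 = 1" for t p q e1 e2 :: real
      proof -
        have "2 * ((t - 1)\<^sup>2 * e1) * (((t - 1) / t)\<^sup>2 * e2) = 2 * ((t - 1)\<^sup>2 / t) * ((t - 1)\<^sup>2 / t) * (e1 * e2)"
          by (simp add: power_divide power2_eq_square)
        then show ?thesis unfolding that(2) that(1)[symmetric] by simp
      qed
      note this[OF \<open>f ?y * g ?y = _\<close>, of "exp (2 - (2 - x))" "exp (2 - x - 2)"]
      moreover have "exp (2 - (2 - x)) * exp (2 - x - 2) = 1" by (simp only: mult_exp_exp) simp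
      ultimately show ?thesis unfolding unknown_subst.simps listed_rhs.simps e i fg[OF y] by blast
    qed
  qed (auto simp: lap_bar_star_def)
qed

text \<open>Common computation for classes (4) to (7), where \<nu> = s \<lambda> + k. The factors
  are proportional to \<lambda>^(\<beta> + 1) and \<lambda>^(1 - \<beta>), so P and Q are multiples
  of \<lambda>^\<beta> and of its reciprocal.\<close>

lemma natural_pde_powr:
  assumes bf: "basic_functions b I f g" and s: "s \<noteq> 0"
    and sub: "I \<subseteq> unknown_subst b ` unknown_dom b"
    and b: "unknown_dom b = {0<..}" "unknown_subst b = (\<lambda>x. s * x + k)"
    and \<beta>: "\<beta> \<noteq> 0" "\<beta> - 1 \<noteq> 0" "\<beta> + 1 \<noteq> 0"
    and \<tau>: "\<tau> * \<tau> = 1" "\<tau> * ((\<beta> - 1) / (\<beta> + 1)) > 0"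
    and f': "basic_f' b = (\<beta> + 1) / (\<beta> - 1)" and g': "\<And>x. basic_g' b x = 1"
    and fg: "\<And>y. basic_f b y - basic_g b y = 2 * (y - k) / (\<beta> - 1)"
    and lhs: "\<And>w p. listed_lhs b w p =
      du (du (\<lambda>q. w q powr \<beta>)) p + (- \<tau>) * dv (dv (\<lambda>q. inverse (w q powr \<beta>))) p"
    and rhs: "\<And>x. x > 0 \<Longrightarrow> listed_rhs b x * x =
      2 * \<beta> / (\<beta> - 1) * (basic_f b (s * x + k) * basic_g b (s * x + k))"
  shows "natural_pde_is_listed b I f g"
proof -
  note bfD = basic_functionsD[OF bf]
  have W: "W_functions I f g" using bf by (simp add: basic_functions_def)
  have pos: "(y - k) / s > 0" if "y \<in> I" for y
  proof -
    have "y \<in> (\<lambda>x. s * x + k) ` {0<..}" using sub that unfolding b by blast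
    then obtain x where "x > 0" "y = s * x + k" by auto
    then show ?thesis using s by simp
  qed
  have powr: "x powr (\<beta> + 1) = x * x powr \<beta>" "x powr (1 - \<beta>) = x / x powr \<beta>"
    "x powr (\<beta> - 1) = x powr \<beta> / x" "x powr (- \<beta>) = inverse (x powr \<beta>)" if "x > 0" for x :: real
    using that by (simp_all add: powr_add powr_diff powr_minus)
  \<comment> \<open>The two proportionality constants agree exactly if c \<tau> (\<beta> + 1) /
    (\<beta> - 1) = 1. As \<open>B\<close> must be positive, so must c, and thus \<tau> is the sign
    of (\<beta> - 1) / (\<beta> + 1): it decides which of the two starred operators occurs.\<close>
  define c where "c = \<tau> * ((\<beta> - 1) / (\<beta> + 1))"
  have c: "c > 0" using \<tau> by (simp add: c_def)
  have \<tau>0: "\<tau> \<noteq> 0" using \<tau> by auto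
  show ?thesis
  proof (rule natural_pde_is_listedI[OF W, where A="\<lambda>y. ((y - k) / s) powr (\<beta> + 1)"
          and B="\<lambda>y. c * ((y - k) / s) powr (1 - \<beta>)" and \<kappa>="\<beta> * c / s" and \<sigma>="- \<tau>"
          and \<phi>="\<lambda>x. x powr \<beta>" and \<psi>="\<lambda>x. inverse (x powr \<beta>)" and X="{x. x > 0 \<and> s * x + k \<in> I}"
          and ?s1.0="\<lambda>x. s" and ?s2.0="\<lambda>x. 0"
          and ?\<phi>1.0="\<lambda>x. \<beta> * x powr (\<beta> - 1)" and ?\<psi>1.0="\<lambda>x. - \<beta> / (x * x powr \<beta>)"])
    fix y assume y: "y \<in> I"
    define t where "t = (y - k) / s"
    have t: "t > 0" using pos[OF y] by (simp add: t_def)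
    have yk: "y - k = s * t" using s by (simp add: t_def)
    have d: "((\<lambda>y. ((y - k) / s) powr r) has_real_derivative (r * t powr (r - 1)) * (1 / s)) (at y)" for r
      by (rule DERIV_chain2[where g="\<lambda>y. (y - k) / s" and f="\<lambda>x. x powr r"])
        (use has_real_derivative_powr[OF t] s in \<open>auto intro!: derivative_eq_intros simp: t_def\<close>)
    have fy: "f y - g y = 2 * (s * t) / (\<beta> - 1)" "g y - f y = - (2 * (s * t) / (\<beta> - 1))"
      using fg[of y] by (simp_all add: bfD[OF y] yk)
    show "((\<lambda>y. ((y - k) / s) powr (\<beta> + 1)) has_real_derivative
        2 * deriv f y / (f y - g y) * ((y - k) / s) powr (\<beta> + 1)) (at y)"
    proof -
      have "((\<beta> + 1) * t powr (\<beta> + 1 - 1)) * (1 / s) = 2 * deriv f y / (f y - g y) * t powr (\<beta> + 1)"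
        using s \<beta> t unfolding fy powr(1)[OF t] by (simp add: bfD(4)[OF y] f', simp add: field_simps)
      then show ?thesis using d[of "\<beta> + 1"] by (simp add: t_def)
    qed
    show "((\<lambda>y. c * ((y - k) / s) powr (1 - \<beta>)) has_real_derivative
        2 * deriv g y / (g y - f y) * (c * ((y - k) / s) powr (1 - \<beta>))) (at y)"
    proof -
      have "c * (((1 - \<beta>) * t powr (1 - \<beta> - 1)) * (1 / s)) =
          2 * deriv g y / (g y - f y) * (c * t powr (1 - \<beta>))"
        using s \<beta> t unfolding fy by (simp add: bfD(5)[OF y] g' powr[OF t] field_simps)
      then show ?thesis using DERIV_cmult[OF d[of "1 - \<beta>"], of c] by (simp add: t_def)
    qed
    show "((y - k) / s) powr (\<beta> + 1) > 0" "c * ((y - k) / s) powr (1 - \<beta>) > 0"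
      unfolding t_def[symmetric] using t c by simp_all
  next
    fix x assume "x \<in> {x. x > 0 \<and> s * x + k \<in> I}"
    then have x: "x > 0" and y: "s * x + k \<in> I" by auto
    have p: "x powr \<beta> > 0" using x by simp
    show "(unknown_subst b has_real_derivative s) (at x)"
      unfolding b by (auto intro!: derivative_eq_intros)
    show "((\<lambda>x. x powr \<beta>) has_real_derivative \<beta> * x powr (\<beta> - 1)) (at x)"
      using has_real_derivative_powr[OF x] .
    show "((\<lambda>x. inverse (x powr \<beta>)) has_real_derivative - \<beta> / (x * x powr \<beta>)) (at x)"
      by (rule DERIV_cong[OF DERIV_inverse'[OF has_real_derivative_powr[OF x]]])
        (use x p in \<open>simp_all add: powr[OF x] field_simps\<close>)
    have u: "(unknown_subst b x - k) / s = x" using s by (simp add: b)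
    show "\<beta> * x powr (\<beta> - 1) * (c * ((unknown_subst b x - k) / s) powr (1 - \<beta>)) =
         \<beta> * c / s * deriv g (unknown_subst b x) * s"
      using s p x unfolding u by (simp add: b bfD(5)[OF y] g' powr[OF x])
    have cf: "c * ((\<beta> + 1) / (\<beta> - 1)) = \<tau>" using \<beta> by (simp add: c_def)
    have "(- \<tau>) * (\<beta> * c / s) * ((\<beta> + 1) / (\<beta> - 1)) * s = - \<beta> * (\<tau> * (c * ((\<beta> + 1) / (\<beta> - 1))))"
      using s by simp
    also have "\<dots> = - \<beta>" using \<tau> unfolding cf by simp
    finally show "- \<beta> / (x * x powr \<beta>) * ((unknown_subst b x - k) / s) powr (\<beta> + 1) =
         - \<tau> * (\<beta> * c / s) * deriv f (unknown_subst b x) * s"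
      using p x unfolding u by (simp add: b bfD(4)[OF y] f' powr[OF x])
    have "f (unknown_subst b x) - g (unknown_subst b x) = 2 * (s * x) / (\<beta> - 1)"
      using fg[of "s * x + k"] by (simp add: b bfD[OF y])
    then have "\<beta> * c / s * f (unknown_subst b x) * g (unknown_subst b x) *
         (f (unknown_subst b x) - g (unknown_subst b x))
      = c * x * (2 * \<beta> / (\<beta> - 1) * (basic_f b (s * x + k) * basic_g b (s * x + k)))"
      using s by (simp add: b bfD[OF y])
    also have "\<dots> = listed_rhs b x * x * x * c" unfolding rhs[OF x, symmetric] by simp
    finally show "listed_rhs b x * ((unknown_subst b x - k) / s) powr (\<beta> + 1) *
         (c * ((unknown_subst b x - k) / s) powr (1 - \<beta>)) =
         \<beta> * c / s * f (unknown_subst b x) * g (unknown_subst b x) *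
         (f (unknown_subst b x) - g (unknown_subst b x))"
      unfolding u using p by (simp add: powr[OF x])
  qed (use c s \<beta> \<tau> b lhs in auto)
qed

lemma powr_sign:
  fixes \<beta> :: real
  shows "\<beta>\<^sup>2 > 1 \<Longrightarrow> 1 * ((\<beta> - 1) / (\<beta> + 1)) > 0"
    and "\<beta>\<^sup>2 < 1 \<Longrightarrow> (- 1) * ((\<beta> - 1) / (\<beta> + 1)) > 0"
proof -
  assume "\<beta>\<^sup>2 > 1"
  then have "\<bar>\<beta>\<bar> > 1" by (metis abs_one abs_le_square_iff not_le one_power2)
  then show "1 * ((\<beta> - 1) / (\<beta> + 1)) > 0" by (auto simp: zero_less_divide_iff)
next
  assume "\<beta>\<^sup>2 < 1"
  then have "\<bar>\<beta>\<bar> < 1" by (simp add: abs_square_less_1)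
  then show "(- 1) * ((\<beta> - 1) / (\<beta> + 1)) > 0" by (auto simp: divide_less_0_iff)
qed

lemma natural_pde_Basic4567:
  assumes bf: "basic_functions b I f g" and sub: "I \<subseteq> unknown_subst b ` unknown_dom b"
    and b: "b \<in> {Basic4 \<beta>, Basic5 \<beta>, Basic6 \<beta>, Basic7 \<beta>}"
  shows "natural_pde_is_listed b I f g"
proof -
  have ad: "admissible b" using bf by (simp add: basic_functions_def)
  note n = admissible_neq[OF ad b]
  \<comment> \<open>In classes (6) and (7) the unknown is \<lambda> = 2 H' = f - g = 2 (\<nu> - 1) /
    (\<beta> - 1); solving for \<nu> gives these values of s and k.\<close>
  define s k \<tau> where "s = (if b \<in> {Basic4 \<beta>, Basic5 \<beta>} then 1 else (\<beta> - 1) / 2)"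
    and "k = (if b \<in> {Basic4 \<beta>, Basic5 \<beta>} then 0 else 1 :: real)"
    and "\<tau> = (if b \<in> {Basic4 \<beta>, Basic6 \<beta>} then 1 else - 1 :: real)"
  note defs = s_def k_def \<tau>_def
  show ?thesis
  proof (rule natural_pde_powr[OF bf _ sub, where s=s and k=k and \<tau>=\<tau> and \<beta>=\<beta>])
    show "s \<noteq> 0" using n by (auto simp: s_def)
    show "unknown_dom b = {0<..}" using b by auto
    show "unknown_subst b = (\<lambda>x. s * x + k)" using b by (auto simp: defs fun_eq_iff field_simps)
    show "\<tau> * \<tau> = 1" by (auto simp: defs)
    show "\<tau> * ((\<beta> - 1) / (\<beta> + 1)) > 0"
      using b ad powr_sign[of \<beta>] unfolding \<tau>_def by (elim insertE) (auto simp del: times_divide_eq_right)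
    show "basic_f' b = (\<beta> + 1) / (\<beta> - 1)" using b by auto
    show "basic_g' b x = 1" for x using b by auto
    show "basic_f b y - basic_g b y = 2 * (y - k) / (\<beta> - 1)" for y
      using b basic_f_minus_g[OF ad b, of y] by (auto simp: k_def)
    show "listed_lhs b w p =
      du (du (\<lambda>q. w q powr \<beta>)) p + (- \<tau>) * dv (dv (\<lambda>q. inverse (w q powr \<beta>))) p" for w p
      using b by (auto simp: defs lap_star_def lap_bar_star_def)
    show "listed_rhs b x * x = 2 * \<beta> / (\<beta> - 1) * (basic_f b (s * x + k) * basic_g b (s * x + k))"
      if "x > 0" for x
      using b
    proof (elim insertE emptyE)
      assume "b = Basic4 \<beta>" then show ?thesis using n by (simp add: defs power2_eq_square)
    next
      assume "b = Basic5 \<beta>" then show ?thesis using n by (simp add: defs power2_eq_square)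
    next
      assume b: "b = Basic6 \<beta>"
      have "((\<beta> + 1) * ((\<beta> - 1) / 2 * x + 1) - 2) / (\<beta> - 1) = ((\<beta> + 1) * x + 2) / 2"
        using n by (simp add: divide_simps) algebra
      then show ?thesis using n that b by (simp add: defs, simp add: divide_simps, algebra?)
    next
      assume b: "b = Basic7 \<beta>"
      have "((\<beta> + 1) * ((\<beta> - 1) / 2 * x + 1) - 2) / (\<beta> - 1) = ((\<beta> + 1) * x + 2) / 2"
        using n by (simp add: divide_simps) algebra
      then show ?thesis using n that b by (simp add: defs, simp add: divide_simps, algebra?)
    qed
  qed (use n in auto)
qed

lemma natural_pde_Basic10:
  assumes bf: "basic_functions (Basic10 \<beta> \<gamma>) I f g"
  shows "natural_pde_is_listed (Basic10 \<beta> \<gamma>) I f g"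
proof -
  note bfD = basic_functionsD[OF bf]
  have W: "W_functions I f g" and \<beta>: "\<beta> \<noteq> 0" and \<gamma>: "\<gamma> < 0" using bf by (auto simp: basic_functions_def)
  have nz: "y \<noteq> 0" if "y \<in> I" for y using bfD[OF that] by auto
  \<comment> \<open>An antiderivative of 1 / (x^2 - \<gamma>). With x = \<nu> - \<beta>/2 one has 2
    f' / (f - g) = (2 x + \<beta>) / (x^2 - \<gamma>), and the summand with \<beta> integrates to
    \<beta> times this function.\<close>
  define i where "i = (\<lambda>x. 1 / sqrt (- \<gamma>) * arctan (x / sqrt (- \<gamma>)))"
  have q: "x\<^sup>2 - \<gamma> > 0" "x\<^sup>2 - \<gamma> \<noteq> 0" for x using \<gamma> zero_le_power2[of x] by linarith+
  have i: "(i has_real_derivative 1 / (x\<^sup>2 - \<gamma>)) (at x)" for x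
  proof -
    have r: "(sqrt (- \<gamma>))\<^sup>2 = - \<gamma>" "sqrt (- \<gamma>) \<noteq> 0" using \<gamma> by auto
    have "1 + (x / sqrt (- \<gamma>))\<^sup>2 = (x\<^sup>2 - \<gamma>) / (sqrt (- \<gamma>))\<^sup>2"
      using \<gamma> unfolding power_divide r(1) by (simp add: field_simps)
    then have "1 / (x\<^sup>2 - \<gamma>) = 1 / sqrt (- \<gamma>) * (inverse (1 + (x / sqrt (- \<gamma>))\<^sup>2) * (1 / sqrt (- \<gamma>)))"
    proof -
      have "1 / p = 1 / r * (inverse (p / r\<^sup>2) * (1 / r))" if "r \<noteq> 0" for p r :: real
        using that by (simp add: power2_eq_square)
      then show ?thesis using r(2) \<open>1 + (x / sqrt (- \<gamma>))\<^sup>2 = _\<close> by metis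
    qed
    moreover have "(i has_real_derivative
        1 / sqrt (- \<gamma>) * (inverse (1 + (x / sqrt (- \<gamma>))\<^sup>2) * (1 / sqrt (- \<gamma>)))) (at x)"
      unfolding i_def
      by (rule DERIV_cmult[OF DERIV_chain2[OF DERIV_arctan DERIV_cdivide[OF DERIV_ident]]])
    ultimately show ?thesis by simp
  qed
  define d where "d = \<beta>\<^sup>2 - 4 * \<gamma>"
  have d: "d > 0" unfolding d_def by (rule discriminant_pos[OF \<gamma>])
  \<comment> \<open>A common scale of both factors. It is fixed by the right side of the listed
    equation, which requires - \<gamma> b / 4 = 1; the quotient b/d in \<open>A\<close> equalizes
    the two proportionality constants.\<close>
  define b where "b = - 4 / \<gamma>"
  have b: "b > 0" using \<gamma> by (simp add: b_def divide_neg_neg)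
  define B1 where "B1 = (\<lambda>y. b * ((y - \<beta> / 2)\<^sup>2 - \<gamma>) / (4 * y\<^sup>2))"
  have fg: "f y - g y = ((y - \<beta> / 2)\<^sup>2 - \<gamma>) / y" "g y - f y = - (((y - \<beta> / 2)\<^sup>2 - \<gamma>) / y)" if "y \<in> I" for y
    using nz[OF that] by (simp_all add: bfD[OF that] field_simps power2_eq_square)
  show ?thesis
  proof (rule natural_pde_is_listedI[OF W, where A="\<lambda>y. b / d * (((y - \<beta> / 2)\<^sup>2 - \<gamma>) * exp (\<beta> * i (y - \<beta> / 2)))"
          and B="\<lambda>y. B1 y * exp (- (\<beta> * i (y - \<beta> / 2)))"
          and \<kappa>="\<beta> * b / d" and \<sigma>="- 1" and \<phi>="\<lambda>x. exp (\<beta> * i x)" and \<psi>="\<lambda>x. inverse (exp (\<beta> * i x))"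
          and X="{x. x + \<beta> / 2 \<in> I}" and ?s1.0="\<lambda>x. 1" and ?s2.0="\<lambda>x. 0"
          and ?\<phi>1.0="\<lambda>x. \<beta> / (x\<^sup>2 - \<gamma>) * exp (\<beta> * i x)" and ?\<psi>1.0="\<lambda>x. - \<beta> / (x\<^sup>2 - \<gamma>) * inverse (exp (\<beta> * i x))"])
    fix y assume y: "y \<in> I"
    define x where "x = y - \<beta> / 2"
    define e where "e = exp (\<beta> * i x)"
    have di: "((\<lambda>y. i (y - \<beta> / 2)) has_real_derivative 1 / (x\<^sup>2 - \<gamma>)) (at y)"
    proof -
      have "((\<lambda>y. y - \<beta> / 2) has_real_derivative 1) (at y)" by (auto intro!: derivative_eq_intros)
      from DERIV_chain2[OF i this] show ?thesis by (simp add: x_def)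
    qed
    have "((\<lambda>y. b / d * (((y - \<beta> / 2)\<^sup>2 - \<gamma>) * exp (\<beta> * i (y - \<beta> / 2)))) has_real_derivative
      b / d * (2 * x * e + (x\<^sup>2 - \<gamma>) * (e * (\<beta> * (1 / (x\<^sup>2 - \<gamma>)))))) (at y)"
      by (rule derivative_eq_intros di refl | simp add: x_def e_def)+
    moreover have "b / d * (2 * x * e + (x\<^sup>2 - \<gamma>) * (e * (\<beta> * (1 / (x\<^sup>2 - \<gamma>))))) = b / d * ((2 * x + \<beta>) * e)"
    proof -
      have "(x\<^sup>2 - \<gamma>) * (e * (\<beta> * (1 / (x\<^sup>2 - \<gamma>)))) = \<beta> * e" using q[of x] by simp
      then show ?thesis by (simp only:) (simp add: algebra_simps)
    qed
    moreover have "2 * deriv f y / (f y - g y) * (b / d * ((x\<^sup>2 - \<gamma>) * e)) = b / d * ((2 * x + \<beta>) * e)"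
      using q[of x] unfolding fg[OF y] x_def[symmetric] by (simp add: bfD(4)[OF y]) (simp add: x_def)
    ultimately show "((\<lambda>y. b / d * (((y - \<beta> / 2)\<^sup>2 - \<gamma>) * exp (\<beta> * i (y - \<beta> / 2)))) has_real_derivative
      2 * deriv f y / (f y - g y) * (b / d * (((y - \<beta> / 2)\<^sup>2 - \<gamma>) * exp (\<beta> * i (y - \<beta> / 2))))) (at y)"
      unfolding e_def x_def by (simp only:)
    have "(B1 has_real_derivative b * (2 * x * y - 2 * (x\<^sup>2 - \<gamma>)) / (4 * y ^ 3)) (at y)"
    proof -
      have n: "((\<lambda>y. b * ((y - \<beta> / 2)\<^sup>2 - \<gamma>)) has_real_derivative b * (2 * x)) (at y)"
        by (auto intro!: derivative_eq_intros simp: x_def)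
      have m: "((\<lambda>y. 4 * y\<^sup>2) has_real_derivative 8 * y) (at y)"
        by (auto intro!: derivative_eq_intros)
      have "(p * (4 * y\<^sup>2) - r * (8 * y)) / (4 * y\<^sup>2 * (4 * y\<^sup>2)) = (p * y - 2 * r) / (4 * y ^ 3)" for p r
        using nz[OF y]
        by (simp add: divide_simps) (simp add: power2_eq_square power3_eq_cube power4_eq_xxxx algebra_simps)
      then have "(b * (2 * x) * (4 * y\<^sup>2) - b * (x\<^sup>2 - \<gamma>) * (8 * y)) / (4 * y\<^sup>2 * (4 * y\<^sup>2)) =
          (b * (2 * x) * y - 2 * (b * (x\<^sup>2 - \<gamma>))) / (4 * y ^ 3)" by blast
      also have "\<dots> = b * (2 * x * y - 2 * (x\<^sup>2 - \<gamma>)) / (4 * y ^ 3)" by (simp add: right_diff_distrib)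
      finally have "(b * (2 * x) * (4 * y\<^sup>2) - b * (x\<^sup>2 - \<gamma>) * (8 * y)) / (4 * y\<^sup>2 * (4 * y\<^sup>2)) =
          b * (2 * x * y - 2 * (x\<^sup>2 - \<gamma>)) / (4 * y ^ 3)" .
      moreover have "(B1 has_real_derivative (b * (2 * x) * (4 * y\<^sup>2) - b * (x\<^sup>2 - \<gamma>) * (8 * y)) /
          (4 * y\<^sup>2 * (4 * y\<^sup>2))) (at y)"
        using DERIV_divide[OF n m] nz[OF y] unfolding B1_def x_def by simp
      ultimately show ?thesis by simp
    qed
    then have "((\<lambda>y. B1 y * exp (- (\<beta> * i (y - \<beta> / 2)))) has_real_derivative
      (b * (2 * x * y - 2 * (x\<^sup>2 - \<gamma>)) / (4 * y ^ 3)) * exp (- (\<beta> * i x))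
       + B1 y * (exp (- (\<beta> * i x)) * (- (\<beta> * (1 / (x\<^sup>2 - \<gamma>)))))) (at y)"
      by (auto intro!: derivative_eq_intros di simp: x_def)
    \<comment> \<open>The exponential is generalized to an arbitrary \<open>h\<close>, which leaves
      a rational identity. It rests on y = x + \<beta>/2, by which the numerator reduces to
      -d.\<close>
    moreover have "(b * (2 * x * y - 2 * (x\<^sup>2 - \<gamma>)) / (4 * y ^ 3)) * h
       + B1 y * (h * (- (\<beta> * (1 / (x\<^sup>2 - \<gamma>))))) = 2 * deriv g y / (g y - f y) * (B1 y * h)" for h
    proof -
      have "B1 y * (- (\<beta> * (1 / (x\<^sup>2 - \<gamma>)))) = - b * \<beta> / (4 * y\<^sup>2)"
        using q[of x] by (simp add: B1_def x_def)
      moreover have "2 * deriv g y / (g y - f y) * B1 y = - b * d / (8 * y ^ 3)"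
      proof -
        have gd: "deriv g y = d / (4 * y\<^sup>2)" by (simp add: bfD(5)[OF y] d_def)
        have gen: "2 * (d / (4 * y\<^sup>2)) / - (p / y) * (b * p / (4 * y\<^sup>2)) = - b * d / (8 * y ^ 3)" if "p \<noteq> 0" for p
          using that nz[OF y] by (simp add: power2_eq_square power3_eq_cube mult_ac)
        show ?thesis unfolding fg[OF y] B1_def x_def[symmetric] gd by (rule gen[OF q(2)])
      qed
      moreover have "b * (2 * x * y - 2 * (x\<^sup>2 - \<gamma>)) / (4 * y ^ 3) + - b * \<beta> / (4 * y\<^sup>2) = - b * d / (8 * y ^ 3)"
      proof -
        have "2 * (2 * x * y - 2 * (x\<^sup>2 - \<gamma>)) - 2 * \<beta> * y = - d"
          by (simp add: d_def x_def power2_eq_square algebra_simps)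
        moreover have "b * p / (4 * y ^ 3) + - b * \<beta> / (4 * y\<^sup>2) = b * (2 * p - 2 * \<beta> * y) / (8 * y ^ 3)" for p
          using nz[OF y] by (simp add: divide_simps) (simp add: power2_eq_square power3_eq_cube algebra_simps)
        ultimately show ?thesis by simp
      qed
      ultimately show ?thesis by algebra
    qed
    ultimately show "((\<lambda>y. B1 y * exp (- (\<beta> * i (y - \<beta> / 2)))) has_real_derivative
      2 * deriv g y / (g y - f y) * (B1 y * exp (- (\<beta> * i (y - \<beta> / 2))))) (at y)"
      unfolding x_def by simp
    show "b / d * (((y - \<beta> / 2)\<^sup>2 - \<gamma>) * exp (\<beta> * i (y - \<beta> / 2))) > 0"
      using b d q by simp
    show "B1 y * exp (- (\<beta> * i (y - \<beta> / 2))) > 0"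
      using b q nz[OF y] by (simp add: B1_def)
  next
    fix x assume "x \<in> {x. x + \<beta> / 2 \<in> I}"
    then have y: "x + \<beta> / 2 \<in> I" by simp
    have ny: "2 * x + \<beta> \<noteq> 0" using nz[OF y] by simp
    have B1x: "B1 (x + \<beta> / 2) = b * (x\<^sup>2 - \<gamma>) / (2 * x + \<beta>)\<^sup>2"
      by (simp add: B1_def power2_eq_square algebra_simps)
    have g1: "deriv g (x + \<beta> / 2) = d / (2 * x + \<beta>)\<^sup>2"
      by (simp add: bfD(5)[OF y] d_def power2_eq_square algebra_simps)
    show "(unknown_subst (Basic10 \<beta> \<gamma>) has_real_derivative 1) (at x)"
      unfolding unknown_subst.simps[abs_def] by (auto intro!: derivative_eq_intros)
    show "((\<lambda>x. exp (\<beta> * i x)) has_real_derivative \<beta> / (x\<^sup>2 - \<gamma>) * exp (\<beta> * i x)) (at x)"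
      by (auto intro!: derivative_eq_intros i)
    show "((\<lambda>x. inverse (exp (\<beta> * i x))) has_real_derivative - \<beta> / (x\<^sup>2 - \<gamma>) * inverse (exp (\<beta> * i x))) (at x)"
      by (auto intro!: derivative_eq_intros i simp: power2_eq_square)
    show "\<beta> / (x\<^sup>2 - \<gamma>) * exp (\<beta> * i x) * (B1 (unknown_subst (Basic10 \<beta> \<gamma>) x) *
        exp (- (\<beta> * i (unknown_subst (Basic10 \<beta> \<gamma>) x - \<beta> / 2)))) =
         \<beta> * b / d * deriv g (unknown_subst (Basic10 \<beta> \<gamma>) x) * 1"
      using q[of x] d by (simp add: B1x g1 exp_minus)
    show "- \<beta> / (x\<^sup>2 - \<gamma>) * inverse (exp (\<beta> * i x)) *
        (b / d * (((unknown_subst (Basic10 \<beta> \<gamma>) x - \<beta> / 2)\<^sup>2 - \<gamma>) *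
          exp (\<beta> * i (unknown_subst (Basic10 \<beta> \<gamma>) x - \<beta> / 2)))) =
         - 1 * (\<beta> * b / d) * deriv f (unknown_subst (Basic10 \<beta> \<gamma>) x) * 1"
      using q[of x] by (simp add: bfD(4)[OF y])
    have gx: "g (x + \<beta> / 2) = (\<beta> * x + 2 * \<gamma>) / (2 * x + \<beta>)"
    proof -
      have "g (x + \<beta> / 2) = \<beta> / 2 - (\<beta>\<^sup>2 - 4 * \<gamma>) / (2 * (2 * x + \<beta>))" by (simp add: bfD[OF y] algebra_simps)
      also have "\<dots> = (\<beta> * x + 2 * \<gamma>) / (2 * x + \<beta>)" using ny by (simp add: field_simps power2_eq_square)
      finally show ?thesis .
    qed
    have fgx: "f (x + \<beta> / 2) - g (x + \<beta> / 2) = 2 * (x\<^sup>2 - \<gamma>) / (2 * x + \<beta>)"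
      using ny unfolding fg[OF y] by (simp add: divide_simps) (simp add: algebra_simps)
    have "- (\<beta> * \<gamma> / 2) * (x * (\<beta> * x + 2 * \<gamma>) / (x\<^sup>2 - \<gamma>)) * (b / d * (x\<^sup>2 - \<gamma>)) *
          (b * (x\<^sup>2 - \<gamma>) / (2 * x + \<beta>)\<^sup>2) =
        (- \<gamma> * b / 4) * (\<beta> * b / d * x * ((\<beta> * x + 2 * \<gamma>) / (2 * x + \<beta>)) * (2 * (x\<^sup>2 - \<gamma>) / (2 * x + \<beta>)))"
    proof -
      have "- (\<beta> * \<gamma> / 2) * (x * l / p) * (b / d * p) * (b * p / m\<^sup>2) =
          (- \<gamma> * b / 4) * (\<beta> * b / d * x * (l / m) * (2 * p / m))" if "p \<noteq> 0" for p l m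
        using that by (simp add: power2_eq_square mult_ac)
      then show ?thesis using q(2) by blast
    qed
    moreover have "- \<gamma> * b / 4 = 1" using \<gamma> by (simp add: b_def)
    ultimately have e: "- (\<beta> * \<gamma> / 2) * (x * (\<beta> * x + 2 * \<gamma>) / (x\<^sup>2 - \<gamma>)) * (b / d * (x\<^sup>2 - \<gamma>)) *
          (b * (x\<^sup>2 - \<gamma>) / (2 * x + \<beta>)\<^sup>2) =
        \<beta> * b / d * x * ((\<beta> * x + 2 * \<gamma>) / (2 * x + \<beta>)) * (2 * (x\<^sup>2 - \<gamma>) / (2 * x + \<beta>))"
      by (simp only: mult_1)
    have ee: "exp (\<beta> * i x) * exp (- (\<beta> * i x)) = 1" by (simp only: mult_exp_exp) simp
    have m: "r * (c * (p * exp (\<beta> * i x))) * (t * exp (- (\<beta> * i x))) = r * (c * p) * t" for r c p t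
    proof -
      have "r * (c * (p * exp (\<beta> * i x))) * (t * exp (- (\<beta> * i x))) =
          r * (c * p) * t * (exp (\<beta> * i x) * exp (- (\<beta> * i x)))" by (simp only: mult_ac)
      then show ?thesis by (simp only: ee mult_1_right)
    qed
    have fx: "f (x + \<beta> / 2) = x" "x + \<beta> / 2 - \<beta> / 2 = x" by (simp_all add: bfD(2)[OF y])
    show "listed_rhs (Basic10 \<beta> \<gamma>) x *
         (b / d * (((unknown_subst (Basic10 \<beta> \<gamma>) x - \<beta> / 2)\<^sup>2 - \<gamma>) *
          exp (\<beta> * i (unknown_subst (Basic10 \<beta> \<gamma>) x - \<beta> / 2)))) *
         (B1 (unknown_subst (Basic10 \<beta> \<gamma>) x) *
          exp (- (\<beta> * i (unknown_subst (Basic10 \<beta> \<gamma>) x - \<beta> / 2)))) =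
         \<beta> * b / d * f (unknown_subst (Basic10 \<beta> \<gamma>) x) *
         g (unknown_subst (Basic10 \<beta> \<gamma>) x) *
         (f (unknown_subst (Basic10 \<beta> \<gamma>) x) - g (unknown_subst (Basic10 \<beta> \<gamma>) x))"
      unfolding unknown_subst.simps listed_rhs.simps B1x fgx
      unfolding gx fx m by (rule e)
  qed (use \<beta> b d in \<open>auto simp: lap_bar_star_def i_def\<close>)
qed

lemma natural_pde_basic:
  assumes bf: "basic_functions b I f g" and sub: "I \<subseteq> unknown_subst b ` unknown_dom b"
  shows "natural_pde_is_listed b I f g"
proof (cases b)
  case Basic1 then show ?thesis using natural_pde_Basic1 assms by simp
next
  case Basic2 then show ?thesis using natural_pde_Basic2 assms by simp
next
  case Basic3 then show ?thesis using natural_pde_Basic3 assms by simp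
next
  case Basic8 then show ?thesis using natural_pde_Basic8 assms by simp
next
  case Basic9 then show ?thesis using natural_pde_Basic9 assms by simp
next
  case Basic10 then show ?thesis using natural_pde_Basic10 assms by simp
qed (use natural_pde_Basic4567[OF assms] in auto)

section \<open>Calculus of smooth functions of two variables\<close>

text \<open>\<open>Ck_on\<close> demands total differentiability, so the rules for partial
  derivatives can all be read off from the rules for the total derivative in the coordinate
  directions.\<close>

lemma du_eqI: "(h has_derivative h') (at p) \<Longrightarrow> du h p = h' (1, 0)"
proof -
  assume h: "(h has_derivative h') (at p)"
  interpret bounded_linear h' using h by (rule has_derivative_bounded_linear)
  obtain x y where p: "p = (x, y)" by (cases p)
  have "((\<lambda>s. h (s, y)) has_derivative (\<lambda>t. h' (t, 0))) (at x)"
    by (rule has_derivative_eq_rhs, rule has_derivative_compose[where g=h])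
      (use h p in \<open>auto intro!: derivative_eq_intros\<close>)
  moreover have "(\<lambda>t. h' (t, 0)) = (\<lambda>t. t *\<^sub>R h' (1, 0))"
  proof
    show "h' (t, 0) = t *\<^sub>R h' (1, 0)" for t using scale[of t "(1, 0)"] by simp
  qed
  ultimately show ?thesis unfolding du_def p
    by (intro vector_derivative_at) (simp add: has_vector_derivative_def)
qed

lemma dv_eqI: "(h has_derivative h') (at p) \<Longrightarrow> dv h p = h' (0, 1)"
proof -
  assume h: "(h has_derivative h') (at p)"
  interpret bounded_linear h' using h by (rule has_derivative_bounded_linear)
  obtain x y where p: "p = (x, y)" by (cases p)
  have "((\<lambda>s. h (x, s)) has_derivative (\<lambda>t. h' (0, t))) (at y)"
    by (rule has_derivative_eq_rhs, rule has_derivative_compose[where g=h])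
      (use h p in \<open>auto intro!: derivative_eq_intros\<close>)
  moreover have "(\<lambda>t. h' (0, t)) = (\<lambda>t. t *\<^sub>R h' (0, 1))"
  proof
    show "h' (0, t) = t *\<^sub>R h' (0, 1)" for t using scale[of t "(0, 1)"] by simp
  qed
  ultimately show ?thesis unfolding dv_def p
    by (intro vector_derivative_at) (simp add: has_vector_derivative_def)
qed

lemma
  assumes "open S" "p \<in> S" "\<And>q. q \<in> S \<Longrightarrow> h q = h' q"
  shows du_cong: "du h p = du h' p" and dv_cong: "dv h p = dv h' p"
proof -
  obtain x y where p: "p = (x, y)" by (cases p)
  note l = eventually_nhds_line[OF assms(1,2)[unfolded p]]
  have "\<forall>\<^sub>F s in nhds x. h (s, y) = h' (s, y)" using l(1) by eventually_elim (rule assms)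
  then show "du h p = du h' p" unfolding du_def p by (auto intro!: vector_derivative_cong_eq)
  have "\<forall>\<^sub>F s in nhds y. h (x, s) = h' (x, s)" using l(2) by eventually_elim (rule assms)
  then show "dv h p = dv h' p" unfolding dv_def p by (auto intro!: vector_derivative_cong_eq)
qed

lemma
  assumes "bounded_bilinear B" "h1 differentiable at p" "h2 differentiable at p"
  shows differentiable_bilinear: "(\<lambda>q. B (h1 q) (h2 q)) differentiable at p"
    and du_bilinear: "du (\<lambda>q. B (h1 q) (h2 q)) p = B (h1 p) (du h2 p) + B (du h1 p) (h2 p)"
    and dv_bilinear: "dv (\<lambda>q. B (h1 q) (h2 q)) p = B (h1 p) (dv h2 p) + B (dv h1 p) (h2 p)"
proof -
  obtain h1' h2' where h: "(h1 has_derivative h1') (at p)" "(h2 has_derivative h2') (at p)"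
    using assms(2,3) unfolding differentiable_def by blast
  note d = bounded_bilinear.FDERIV[OF assms(1) h]
  show "(\<lambda>q. B (h1 q) (h2 q)) differentiable at p" using d unfolding differentiable_def by blast
  show "du (\<lambda>q. B (h1 q) (h2 q)) p = B (h1 p) (du h2 p) + B (du h1 p) (h2 p)"
    by (simp add: du_eqI[OF d] du_eqI[OF h(1)] du_eqI[OF h(2)])
  show "dv (\<lambda>q. B (h1 q) (h2 q)) p = B (h1 p) (dv h2 p) + B (dv h1 p) (h2 p)"
    by (simp add: dv_eqI[OF d] dv_eqI[OF h(1)] dv_eqI[OF h(2)])
qed

lemma
  assumes "h1 differentiable at p" "h2 differentiable at p"
  shows du_add: "du (\<lambda>q. h1 q + h2 q) p = du h1 p + du h2 p"
    and dv_add: "dv (\<lambda>q. h1 q + h2 q) p = dv h1 p + dv h2 p"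
proof -
  obtain h1' h2' where h: "(h1 has_derivative h1') (at p)" "(h2 has_derivative h2') (at p)"
    using assms unfolding differentiable_def by blast
  show "du (\<lambda>q. h1 q + h2 q) p = du h1 p + du h2 p"
    by (simp add: du_eqI[OF has_derivative_add[OF h]] du_eqI[OF h(1)] du_eqI[OF h(2)])
  show "dv (\<lambda>q. h1 q + h2 q) p = dv h1 p + dv h2 p"
    by (simp add: dv_eqI[OF has_derivative_add[OF h]] dv_eqI[OF h(1)] dv_eqI[OF h(2)])
qed

lemma
  assumes "bounded_linear L" "h differentiable at p"
  shows du_linear: "du (\<lambda>q. L (h q)) p = L (du h p)"
    and dv_linear: "dv (\<lambda>q. L (h q)) p = L (dv h p)"
    and differentiable_linear: "(\<lambda>q. L (h q)) differentiable at p"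
proof -
  obtain h' where h: "(h has_derivative h') (at p)"
    using assms unfolding differentiable_def by blast
  note d = bounded_linear.has_derivative[OF assms(1) h]
  show "du (\<lambda>q. L (h q)) p = L (du h p)" by (simp add: du_eqI[OF d] du_eqI[OF h])
  show "dv (\<lambda>q. L (h q)) p = L (dv h p)" by (simp add: dv_eqI[OF d] dv_eqI[OF h])
  show "(\<lambda>q. L (h q)) differentiable at p" using d unfolding differentiable_def by blast
qed

lemma du_const [simp]: "du (\<lambda>_. c) = (\<lambda>_. 0)" and dv_const [simp]: "dv (\<lambda>_. c) = (\<lambda>_. 0)"
  by (auto simp: fun_eq_iff intro: du_eqI[OF has_derivative_const, THEN trans] dv_eqI[OF has_derivative_const, THEN trans])

section \<open>Closure properties of the classes C^k\<close>

lemma Ck_on_Suc_imp: "Ck_on (Suc k) S h \<Longrightarrow> Ck_on k S h"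
proof (induction k arbitrary: h)
  case 0
  then have "isCont h p" if "p \<in> S" for p
    using that differentiable_imp_continuous_within by fastforce
  then show ?case by (simp add: continuous_at_imp_continuous_on)
next
  case (Suc k)
  then show ?case unfolding Ck_on.simps(2)[of "Suc k"] Ck_on.simps(2)[of k S h] by blast
qed

lemma Ck_on_cong:
  assumes S: "open S" and eq: "\<And>q. q \<in> S \<Longrightarrow> h q = h' q" and "Ck_on k S h"
  shows "Ck_on k S h'"
  using eq assms(3)
proof (induction k arbitrary: h h')
  case 0
  then show ?case by (simp cong: continuous_on_cong)
next
  case (Suc k)
  have "h' differentiable at p" if "p \<in> S" for p
  proof -
    have "h differentiable at p" using Suc.prems that by simp
    then obtain d where "(h has_derivative d) (at p)" unfolding differentiable_def by blast
    then have "(h' has_derivative d) (at p)"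
      by (rule has_derivative_transform_within_open[OF _ S that]) (use Suc.prems in auto)
    then show ?thesis by (auto simp: differentiable_def)
  qed
  moreover have "Ck_on k S (du h')"
    by (rule Suc.IH[of "du h"]) (use Suc.prems du_cong[OF S, of _ h h'] in auto)
  moreover have "Ck_on k S (dv h')"
    by (rule Suc.IH[of "dv h"]) (use Suc.prems dv_cong[OF S, of _ h h'] in auto)
  ultimately show ?case by simp
qed

lemma Ck_on_subset: "Ck_on k S h \<Longrightarrow> V \<subseteq> S \<Longrightarrow> Ck_on k V h"
  by (induction k arbitrary: h) (auto intro: continuous_on_subset)

lemma Ck_on_const: "Ck_on k S (\<lambda>_. c)"
  by (induction k arbitrary: c) auto

lemma Ck_on_add: "open S \<Longrightarrow> Ck_on k S h1 \<Longrightarrow> Ck_on k S h2 \<Longrightarrow> Ck_on k S (\<lambda>q. h1 q + h2 q)"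
proof (induction k arbitrary: h1 h2)
  case 0
  then show ?case by (auto intro: continuous_on_add)
next
  case (Suc k)
  have "Ck_on k S (du (\<lambda>q. h1 q + h2 q))"
    by (rule Ck_on_cong[OF Suc.prems(1) _ Suc.IH[of "du h1" "du h2"]]) (use Suc.prems in \<open>auto simp: du_add\<close>)
  moreover have "Ck_on k S (dv (\<lambda>q. h1 q + h2 q))"
    by (rule Ck_on_cong[OF Suc.prems(1) _ Suc.IH[of "dv h1" "dv h2"]]) (use Suc.prems in \<open>auto simp: dv_add\<close>)
  ultimately show ?case using Suc.prems by auto
qed

text \<open>The product rule pairs a derivative of one factor with the other factor itself, so the
  induction also needs that C^(k+1) implies C^k. It is applied to real products and to
  \<open>mink\<close>.\<close>

lemma Ck_on_bilinear:
  assumes B: "bounded_bilinear B" and S: "open S"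
  shows "Ck_on k S h1 \<Longrightarrow> Ck_on k S h2 \<Longrightarrow> Ck_on k S (\<lambda>q. B (h1 q) (h2 q))"
proof (induction k arbitrary: h1 h2)
  case 0
  then show ?case by (auto intro: bounded_bilinear.continuous_on[OF B])
next
  case (Suc k)
  note c = Ck_on_Suc_imp[OF Suc.prems(1)] Ck_on_Suc_imp[OF Suc.prems(2)]
  have "Ck_on k S (\<lambda>q. B (h1 q) (du h2 q) + B (du h1 q) (h2 q))"
    using Suc.prems c by (intro Ck_on_add S Suc.IH) auto
  then have "Ck_on k S (du (\<lambda>q. B (h1 q) (h2 q)))"
    by (rule Ck_on_cong[OF S, rotated]) (use Suc.prems in \<open>auto simp: du_bilinear[OF B]\<close>)
  moreover have "Ck_on k S (\<lambda>q. B (h1 q) (dv h2 q) + B (dv h1 q) (h2 q))"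
    using Suc.prems c by (intro Ck_on_add S Suc.IH) auto
  then have "Ck_on k S (dv (\<lambda>q. B (h1 q) (h2 q)))"
    by (rule Ck_on_cong[OF S, rotated]) (use Suc.prems in \<open>auto simp: dv_bilinear[OF B]\<close>)
  ultimately show ?case using Suc.prems differentiable_bilinear[OF B] by auto
qed

text \<open>The derivatives are written with products only, so that \<open>Ck_on_bilinear\<close>
  and the induction hypothesis apply literally in the proof of \<open>Ck_on_inverse\<close>.\<close>

lemma
  fixes h :: "real \<times> real \<Rightarrow> real"
  assumes "h differentiable at p" "h p \<noteq> 0"
  shows differentiable_inverse_real: "(\<lambda>q. inverse (h q)) differentiable at p"
    and du_inverse: "du (\<lambda>q. inverse (h q)) p = - 1 * (du h p * (inverse (h p) * inverse (h p)))"
    and dv_inverse: "dv (\<lambda>q. inverse (h q)) p = - 1 * (dv h p * (inverse (h p) * inverse (h p)))"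
proof -
  obtain h' where h: "(h has_derivative h') (at p)"
    using assms unfolding differentiable_def by blast
  have d: "((\<lambda>q. inverse (h q)) has_derivative (\<lambda>v. - (inverse (h p) * h' v * inverse (h p)))) (at p)"
    using assms(2) h by (rule Deriv.has_derivative_inverse)
  show "(\<lambda>q. inverse (h q)) differentiable at p" using d unfolding differentiable_def by blast
  show "du (\<lambda>q. inverse (h q)) p = - 1 * (du h p * (inverse (h p) * inverse (h p)))"
    by (simp add: du_eqI[OF d] du_eqI[OF h])
  show "dv (\<lambda>q. inverse (h q)) p = - 1 * (dv h p * (inverse (h p) * inverse (h p)))"
    by (simp add: dv_eqI[OF d] dv_eqI[OF h])
qed

lemma Ck_on_inverse:
  fixes h :: "real \<times> real \<Rightarrow> real"
  assumes S: "open S" and h0: "\<And>q. q \<in> S \<Longrightarrow> h q \<noteq> 0"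
  shows "Ck_on k S h \<Longrightarrow> Ck_on k S (\<lambda>q. inverse (h q))"
proof (induction k)
  case 0
  then show ?case using h0 by (auto intro: continuous_on_inverse)
next
  case (Suc k)
  note m = Ck_on_bilinear[OF bounded_bilinear_mult S]
  have IH: "Ck_on k S (\<lambda>q. inverse (h q))" by (rule Suc.IH[OF Ck_on_Suc_imp[OF Suc.prems]])
  have "Ck_on k S (\<lambda>q. - 1 * (du h q * (inverse (h q) * inverse (h q))))"
    using Suc.prems IH by (intro m Ck_on_const) auto
  then have "Ck_on k S (du (\<lambda>q. inverse (h q)))"
    by (rule Ck_on_cong[OF S, rotated]) (use Suc.prems h0 in \<open>auto simp: du_inverse\<close>)
  moreover have "Ck_on k S (\<lambda>q. - 1 * (dv h q * (inverse (h q) * inverse (h q))))"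
    using Suc.prems IH by (intro m Ck_on_const) auto
  then have "Ck_on k S (dv (\<lambda>q. inverse (h q)))"
    by (rule Ck_on_cong[OF S, rotated]) (use Suc.prems h0 in \<open>auto simp: dv_inverse\<close>)
  ultimately show ?case using Suc.prems h0 differentiable_inverse_real by auto
qed

lemma smooth2_onD:
  assumes "smooth2_on S h"
  shows "p \<in> S \<Longrightarrow> h differentiable at p" and "smooth2_on S (du h)" and "smooth2_on S (dv h)"
    and "continuous_on S h"
proof -
  have "Ck_on (Suc k) S h" for k using assms unfolding smooth2_on_def by blast
  then show "p \<in> S \<Longrightarrow> h differentiable at p" "smooth2_on S (du h)" "smooth2_on S (dv h)"
    unfolding smooth2_on_def by auto
  have "Ck_on 0 S h" using assms unfolding smooth2_on_def by blast
  then show "continuous_on S h" by simp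
qed

lemma smooth2_on_subset: "smooth2_on S h \<Longrightarrow> V \<subseteq> S \<Longrightarrow> smooth2_on V h"
  unfolding smooth2_on_def using Ck_on_subset by blast

lemma smooth2_on_const: "smooth2_on S (\<lambda>_. c)"
  unfolding smooth2_on_def using Ck_on_const by blast

lemma smooth2_on_add: "open S \<Longrightarrow> smooth2_on S h1 \<Longrightarrow> smooth2_on S h2 \<Longrightarrow> smooth2_on S (\<lambda>q. h1 q + h2 q)"
  unfolding smooth2_on_def using Ck_on_add by blast

lemma smooth2_on_bilinear:
  "bounded_bilinear B \<Longrightarrow> open S \<Longrightarrow> smooth2_on S h1 \<Longrightarrow> smooth2_on S h2 \<Longrightarrow> smooth2_on S (\<lambda>q. B (h1 q) (h2 q))"
  unfolding smooth2_on_def using Ck_on_bilinear by blast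

lemma smooth2_on_inverse:
  fixes h :: "real \<times> real \<Rightarrow> real"
  shows "open S \<Longrightarrow> (\<And>q. q \<in> S \<Longrightarrow> h q \<noteq> 0) \<Longrightarrow> smooth2_on S h \<Longrightarrow> smooth2_on S (\<lambda>q. inverse (h q))"
  unfolding smooth2_on_def using Ck_on_inverse by blast

lemma smooth2_on_cong:
  "open S \<Longrightarrow> (\<And>q. q \<in> S \<Longrightarrow> h q = h' q) \<Longrightarrow> smooth2_on S h \<Longrightarrow> smooth2_on S h'"
  unfolding smooth2_on_def using Ck_on_cong by blast

section \<open>Symmetry of the mixed second partial derivatives\<close>

text \<open>The mean value theorem is applied first in s to the difference of two horizontal edges,
  then in t to the resulting partial derivative.\<close>

lemma second_difference:
  fixes h hu huv :: "real \<Rightarrow> real \<Rightarrow> real"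
  assumes r: "r > 0"
    and hu: "\<And>s t. s \<in> {x..x+r} \<Longrightarrow> t \<in> {y..y+r} \<Longrightarrow> ((\<lambda>s. h s t) has_real_derivative hu s t) (at s)"
    and huv: "\<And>s t. s \<in> {x..x+r} \<Longrightarrow> t \<in> {y..y+r} \<Longrightarrow> ((\<lambda>t. hu s t) has_real_derivative huv s t) (at t)"
  shows "\<exists>\<xi>\<in>{x..x+r}. \<exists>\<eta>\<in>{y..y+r}. h (x+r) (y+r) - h x (y+r) - (h (x+r) y - h x y) = r * r * huv \<xi> \<eta>"
proof -
  have "((\<lambda>s. h s (y+r) - h s y) has_real_derivative hu s (y+r) - hu s y) (at s)" if "x \<le> s" "s \<le> x + r" for s
    using that r by (intro DERIV_diff hu) auto
  then obtain \<xi> where \<xi>: "x < \<xi>" "\<xi> < x + r"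
    "(h (x+r) (y+r) - h (x+r) y) - (h x (y+r) - h x y) = (x + r - x) * (hu \<xi> (y+r) - hu \<xi> y)"
    using MVT2[of x "x + r" "\<lambda>s. h s (y+r) - h s y" "\<lambda>s. hu s (y+r) - hu s y"] r by auto
  have "((\<lambda>t. hu \<xi> t) has_real_derivative huv \<xi> t) (at t)" if "y \<le> t" "t \<le> y + r" for t
    using that \<xi> by (intro huv) auto
  then obtain \<eta> where \<eta>: "y < \<eta>" "\<eta> < y + r" "hu \<xi> (y+r) - hu \<xi> y = (y + r - y) * huv \<xi> \<eta>"
    using MVT2[of y "y + r" "hu \<xi>" "huv \<xi>"] r by auto
  show ?thesis using \<xi> \<eta> by (intro bexI[of _ \<xi>] bexI[of _ \<eta>]) auto
qed

text \<open>The second difference over a small square does not depend on the order of the variables.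
  It equals the area times either mixed derivative at some point of the square, so continuity forces
  the two to agree.\<close>

lemma symmetric_partials_real:
  fixes h :: "real \<times> real \<Rightarrow> real"
  assumes S: "open S" and p: "p \<in> S" and h: "smooth2_on S h"
  shows "dv (du h) p = du (dv h) p"
proof (rule ccontr)
  assume ne: "dv (du h) p \<noteq> du (dv h) p"
  obtain x y where xy: "p = (x, y)" by (cases p)
  \<comment> \<open>Half the assumed gap: two values strictly within \<open>e\<close> of the two
    mixed derivatives at \<open>p\<close> cannot coincide.\<close>
  define e where "e = \<bar>dv (du h) p - du (dv h) p\<bar> / 2"
  have e: "e > 0" using ne by (simp add: e_def)
  note sm = smooth2_onD(2,3)[OF h]
  have c: "isCont (dv (du h)) p" "isCont (du (dv h)) p"
    using smooth2_onD(4)[OF smooth2_onD(3)[OF sm(1)]] smooth2_onD(4)[OF smooth2_onD(2)[OF sm(2)]] S p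
    by (auto simp: continuous_on_eq_continuous_at)
  obtain d1 where d1: "d1 > 0" "\<And>q. dist q p < d1 \<Longrightarrow> dist (dv (du h) q) (dv (du h) p) < e"
    using c(1) e unfolding continuous_at_eps_delta by blast
  obtain d2 where d2: "d2 > 0" "\<And>q. dist q p < d2 \<Longrightarrow> dist (du (dv h) q) (du (dv h) p) < e"
    using c(2) e unfolding continuous_at_eps_delta by blast
  obtain d3 where d3: "d3 > 0" "ball p d3 \<subseteq> S" using S p open_contains_ball by blast
  obtain m where m: "m > 0" "m \<le> d1" "m \<le> d2" "m \<le> d3"
  proof
    show "min d1 (min d2 d3) > 0" using d1 d2 d3 by simp
  qed auto
  \<comment> \<open>Points of the square are at distance at most 2 r from \<open>p\<close>, which is
    strictly below \<open>m\<close>.\<close>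
  define r where "r = m / 3"
  have r: "r > 0" using m by (simp add: r_def)
  have near: "dist (s, t) p < m" if "s \<in> {x..x+r}" "t \<in> {y..y+r}" for s t
  proof -
    have "dist (s, t) p \<le> \<bar>s - x\<bar> + \<bar>t - y\<bar>"
      unfolding xy dist_Pair_Pair dist_real_def using sqrt_sum_squares_le_sum_abs by simp
    also have "\<dots> \<le> 2 * r" using that by auto
    also have "\<dots> < m" using m by (simp add: r_def)
    finally show ?thesis .
  qed
  then have inS: "(s, t) \<in> S" if "s \<in> {x..x+r}" "t \<in> {y..y+r}" for s t
    using near[OF that] m d3(2) by (auto simp: dist_commute subset_iff)
  have D: "((\<lambda>s. h (s, t)) has_real_derivative du h (s, t)) (at s)"
      "((\<lambda>t. du h (s, t)) has_real_derivative dv (du h) (s, t)) (at t)"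
      "((\<lambda>t. h (s, t)) has_real_derivative dv h (s, t)) (at t)"
      "((\<lambda>s. dv h (s, t)) has_real_derivative du (dv h) (s, t)) (at s)"
    if "s \<in> {x..x+r}" "t \<in> {y..y+r}" for s t
    unfolding has_real_derivative_iff_has_vector_derivative
    using has_vector_derivative_du has_vector_derivative_dv inS[OF that]
      smooth2_onD(1)[OF h] smooth2_onD(1)[OF sm(1)] smooth2_onD(1)[OF sm(2)] by blast+
  obtain s1 t1 where 1: "s1 \<in> {x..x+r}" "t1 \<in> {y..y+r}"
    "h (x+r, y+r) - h (x, y+r) - (h (x+r, y) - h (x, y)) = r * r * dv (du h) (s1, t1)"
    using second_difference[OF r, of x y "\<lambda>s t. h (s, t)" "\<lambda>s t. du h (s, t)" "\<lambda>s t. dv (du h) (s, t)"]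
      D(1,2) by blast
  obtain t2 s2 where 2: "t2 \<in> {y..y+r}" "s2 \<in> {x..x+r}"
    "h (x+r, y+r) - h (x+r, y) - (h (x, y+r) - h (x, y)) = r * r * du (dv h) (s2, t2)"
    using second_difference[OF r, of y x "\<lambda>t s. h (s, t)" "\<lambda>t s. dv h (s, t)" "\<lambda>t s. du (dv h) (s, t)"]
      D(3,4) by blast
  have "r * r * dv (du h) (s1, t1) = r * r * du (dv h) (s2, t2)" using 1(3) 2(3) by linarith
  then have eq: "dv (du h) (s1, t1) = du (dv h) (s2, t2)" using r by simp
  have "\<bar>dv (du h) (s1, t1) - dv (du h) p\<bar> < e" using d1(2)[of "(s1, t1)"] near[OF 1(1,2)] m by (simp add: dist_real_def)
  moreover have "\<bar>du (dv h) (s2, t2) - du (dv h) p\<bar> < e" using d2(2)[of "(s2, t2)"] near[OF 2(2,1)] m by (simp add: dist_real_def)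
  ultimately show False using eq by (simp add: e_def abs_if split: if_splits)
qed

lemma smooth2_on_linear:
  assumes L: "bounded_linear L" and S: "open S" and h: "smooth2_on S h"
  shows "smooth2_on S (\<lambda>q. L (h q))"
proof -
  have "Ck_on k S h \<Longrightarrow> Ck_on k S (\<lambda>q. L (h q))" for k h
  proof (induction k arbitrary: h)
    case 0
    then show ?case by (auto intro: bounded_linear.continuous_on[OF L])
  next
    case (Suc k)
    have "Ck_on k S (du (\<lambda>q. L (h q)))"
      by (rule Ck_on_cong[OF S _ Suc.IH[of "du h"]]) (use Suc.prems in \<open>auto simp: du_linear[OF L]\<close>)
    moreover have "Ck_on k S (dv (\<lambda>q. L (h q)))"
      by (rule Ck_on_cong[OF S _ Suc.IH[of "dv h"]]) (use Suc.prems in \<open>auto simp: dv_linear[OF L]\<close>)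
    ultimately show ?case using Suc.prems differentiable_linear[OF L] by auto
  qed
  then show ?thesis using h unfolding smooth2_on_def by blast
qed

lemma symmetric_partials:
  fixes h :: "real \<times> real \<Rightarrow> real ^ 'n"
  assumes S: "open S" and p: "p \<in> S" and h: "smooth2_on S h"
  shows "dv (du h) p = du (dv h) p"
proof (rule vec_eq_iff[THEN iffD2], rule allI)
  fix i
  let ?L = "\<lambda>x :: real ^ 'n. x $ i"
  note L = bounded_linear_vec_nth[of i]
  have "?L (dv (du h) p) = dv (\<lambda>q. ?L (du h q)) p"
    by (rule dv_linear[OF L, symmetric]) (rule smooth2_onD(1)[OF smooth2_onD(2)[OF h] p])
  also have "\<dots> = dv (du (\<lambda>q. ?L (h q))) p"
    by (rule dv_cong[OF S p], rule du_linear[OF L, symmetric]) (rule smooth2_onD(1)[OF h])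
  also have "\<dots> = du (dv (\<lambda>q. ?L (h q))) p"
    by (rule symmetric_partials_real[OF S p smooth2_on_linear[OF L S h]])
  also have "\<dots> = du (\<lambda>q. ?L (dv h q)) p"
    by (rule du_cong[OF S p], rule dv_linear[OF L]) (rule smooth2_onD(1)[OF h])
  also have "\<dots> = ?L (du (dv h) p)"
    by (rule du_linear[OF L]) (rule smooth2_onD(1)[OF smooth2_onD(3)[OF h] p])
  finally show "dv (du h) p $ i = du (dv h) p $ i" .
qed

section \<open>Parallel surfaces\<close>

lemma bounded_bilinear_mink: "bounded_bilinear mink"
  unfolding bilinear_conv_bounded_bilinear[symmetric] bilinear_def mink_def
  by (auto intro!: linearI simp: algebra_simps)

lemma mink_commute: "mink x y = mink y x"
  by (simp add: mink_def mult.commute)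

lemma mink_simps:
  "mink (x + y) w = mink x w + mink y w" "mink x (y + w) = mink x y + mink x w"
  "mink (a *\<^sub>R x) w = a * mink x w" "mink x (a *\<^sub>R w) = a * mink x w"
  by (simp_all add: mink_def algebra_simps)

text \<open>As \<open>mink\<close> is indefinite, the argument avoids positivity: the map to the
  three products is onto, because the vectors are non-null and pairwise orthogonal, hence injective
  by dimension.\<close>

lemma mink_orthogonal_frame:
  assumes "mink x x \<noteq> 0" "mink y y \<noteq> 0" "mink w w \<noteq> 0"
    and "mink x y = 0" "mink x w = 0" "mink y w = 0"
    and v: "mink v x = 0" "mink v y = 0" "mink v w = 0"
  shows "v = 0"
proof -
  define f :: "real^3 \<Rightarrow> real^3" where "f = (\<lambda>u. vector [mink u x, mink u y, mink u w])"
  have lin: "linear f"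
    by (intro linearI) (simp_all add: f_def vec_eq_iff forall_3 mink_simps)
  have "surj f"
  proof (rule surjI)
    fix t
    show "f ((t$1 / mink x x) *\<^sub>R x + (t$2 / mink y y) *\<^sub>R y + (t$3 / mink w w) *\<^sub>R w) = t"
      using assms mink_commute[of y x] mink_commute[of w x] mink_commute[of w y]
      by (simp add: f_def vec_eq_iff forall_3 mink_simps)
  qed
  then have "inj f" using lin linear_surjective_imp_injective by blast
  moreover have "f v = f 0" using v by (simp add: f_def vec_eq_iff forall_3 mink_def)
  ultimately show ?thesis by (simp add: inj_eq)
qed

lemma principal_surfaceD:
  assumes "principal_surface D z l"
  shows "open D" "connected D" "smooth2_on D z" "smooth2_on D l"
    and "p \<in> D \<Longrightarrow> ff_E z p < 0" "p \<in> D \<Longrightarrow> ff_G z p > 0" "p \<in> D \<Longrightarrow> mink (l p) (l p) = 1"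
      "p \<in> D \<Longrightarrow> mink (l p) (du z p) = 0" "p \<in> D \<Longrightarrow> mink (l p) (dv z p) = 0"
      "p \<in> D \<Longrightarrow> ff_F z p = 0" "p \<in> D \<Longrightarrow> sf_M z l p = 0"
  using assms unfolding principal_surface_def by blast+

text \<open>Differentiating the three identities for the normal gives the products of
  \<open>du l\<close> and \<open>dv l\<close> with the frame formed by z_u, z_v and l. The
  differences from the claimed vectors are orthogonal to that frame, hence zero.\<close>

lemma weingarten:
  assumes ps: "principal_surface D z l" and p: "p \<in> D"
  shows "du l p = - curv1 z l p *\<^sub>R du z p" and "dv l p = - curv2 z l p *\<^sub>R dv z p"
proof -
  note S = principal_surfaceD[OF ps]
  note zd = smooth2_onD(1)[OF S(3) p] smooth2_onD(1)[OF smooth2_onD(2)[OF S(3)] p]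
    smooth2_onD(1)[OF smooth2_onD(3)[OF S(3)] p]
  note ld = smooth2_onD(1)[OF S(4) p]
  note B = bounded_bilinear_mink
  have "du (\<lambda>q. mink (l q) (l q)) p = 0" "dv (\<lambda>q. mink (l q) (l q)) p = 0"
    using du_cong[OF S(1) p, of "\<lambda>q. mink (l q) (l q)" "\<lambda>_. 1"] dv_cong[OF S(1) p, of "\<lambda>q. mink (l q) (l q)" "\<lambda>_. 1"]
      S(7) by simp_all
  then have ll: "mink (du l p) (l p) = 0" "mink (dv l p) (l p) = 0"
    using du_bilinear[OF B ld ld] dv_bilinear[OF B ld ld]
      mink_commute[of "l p" "du l p"] mink_commute[of "l p" "dv l p"] by simp_all
  have "du (\<lambda>q. mink (l q) (du z q)) p = 0" "dv (\<lambda>q. mink (l q) (du z q)) p = 0"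
    using du_cong[OF S(1) p, of "\<lambda>q. mink (l q) (du z q)" "\<lambda>_. 0"] dv_cong[OF S(1) p, of "\<lambda>q. mink (l q) (du z q)" "\<lambda>_. 0"]
      S(8) by simp_all
  then have lu: "mink (du l p) (du z p) = - sf_L z l p" "mink (dv l p) (du z p) = 0"
    using du_bilinear[OF B ld zd(2)] dv_bilinear[OF B ld zd(2)] S(11)[OF p]
    by (simp_all add: sf_L_def sf_M_def)
  have "du (\<lambda>q. mink (l q) (dv z q)) p = 0" "dv (\<lambda>q. mink (l q) (dv z q)) p = 0"
    using du_cong[OF S(1) p, of "\<lambda>q. mink (l q) (dv z q)" "\<lambda>_. 0"] dv_cong[OF S(1) p, of "\<lambda>q. mink (l q) (dv z q)" "\<lambda>_. 0"]
      S(9) by simp_all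
  \<comment> \<open>Symmetry of the partials is needed because \<open>sf_M\<close> takes the
    u-derivative first, whereas differentiating the product of l and z_v along u yields the other
    order.\<close>
  then have lv: "mink (du l p) (dv z p) = 0" "mink (dv l p) (dv z p) = - sf_N z l p"
    using du_bilinear[OF B ld zd(3)] dv_bilinear[OF B ld zd(3)] S(11)[OF p]
    by (simp_all add: sf_N_def sf_M_def symmetric_partials[OF S(1) p S(3)])
  have E: "mink (du z p) (du z p) \<noteq> 0" and G: "mink (dv z p) (dv z p) \<noteq> 0" and F: "mink (du z p) (dv z p) = 0"
    using S(5,6,10)[OF p] by (auto simp: ff_E_def ff_G_def ff_F_def)
  have F': "mink (dv z p) (du z p) = 0" using F mink_commute by metis
  have lz: "mink (du z p) (l p) = 0" "mink (dv z p) (l p) = 0" using S(8,9)[OF p] mink_commute by metis+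
  have l1: "mink (l p) (l p) \<noteq> 0" using S(7)[OF p] by simp
  note frame = mink_orthogonal_frame[OF E G l1 F lz]
  have "du l p + curv1 z l p *\<^sub>R du z p = 0"
    by (rule frame) (use E F ll lu lv lz in \<open>simp_all add: mink_simps curv1_def ff_E_def\<close>)
  then show "du l p = - curv1 z l p *\<^sub>R du z p" by (simp add: add_eq_0_iff2)
  have "dv l p + curv2 z l p *\<^sub>R dv z p = 0"
    by (rule frame) (use G F' ll lu lv lz in \<open>simp_all add: mink_simps curv2_def ff_G_def\<close>)
  then show "dv l p = - curv2 z l p *\<^sub>R dv z p" by (simp add: add_eq_0_iff2)
qed

lemma smooth2_on_curv:
  assumes ps: "principal_surface D z l"
  shows "smooth2_on D (curv1 z l)" and "smooth2_on D (curv2 z l)"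
proof -
  note S = principal_surfaceD[OF ps]
  note sm = smooth2_on_bilinear[OF _ S(1)]
  note zu = smooth2_onD(2)[OF S(3)] and zv = smooth2_onD(3)[OF S(3)]
  note zuu = smooth2_onD(2)[OF zu] and zvv = smooth2_onD(3)[OF zv]
  have "smooth2_on D (\<lambda>q. mink (l q) (du (du z) q) * inverse (mink (du z q) (du z q)))"
    by (intro sm[OF bounded_bilinear_mult] sm[OF bounded_bilinear_mink] smooth2_on_inverse S zu zuu)
      (use S(5) in \<open>force simp: ff_E_def\<close>)
  then show "smooth2_on D (curv1 z l)"
    by (rule smooth2_on_cong[OF S(1), rotated]) (simp add: curv1_def sf_L_def ff_E_def divide_inverse)
  have "smooth2_on D (\<lambda>q. mink (l q) (dv (dv z) q) * inverse (mink (dv z q) (dv z q)))"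
    by (intro sm[OF bounded_bilinear_mult] sm[OF bounded_bilinear_mink] smooth2_on_inverse S zv zvv)
      (use S(6) in \<open>force simp: ff_G_def\<close>)
  then show "smooth2_on D (curv2 z l)"
    by (rule smooth2_on_cong[OF S(1), rotated]) (simp add: curv2_def sf_N_def ff_G_def divide_inverse)
qed

text \<open>By the Weingarten formulas the tangent vectors are only rescaled, by c (1 - a \<nu>_i),
  so the parameters stay principal and the same normal line serves. The homothety c and the
  orientation \<sigma> of the normal are included to scale both curvatures by any non-zero
  number.\<close>

lemma parallel_surface:
  assumes ps: "principal_surface D z l" and V: "open V" "connected V" "V \<subseteq> D"
    and a: "\<And>q. q \<in> V \<Longrightarrow> (1 - a * curv1 z l q) * (1 - a * curv2 z l q) \<noteq> 0"
    and c: "c > 0" and \<sigma>: "\<sigma> * \<sigma> = 1"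
  defines "z' \<equiv> \<lambda>q. c *\<^sub>R (z q + a *\<^sub>R l q)" and "l' \<equiv> \<lambda>q. \<sigma> *\<^sub>R l q"
  shows "principal_surface V z' l'"
    and "q \<in> V \<Longrightarrow> ff_E z' q = (c * (1 - a * curv1 z l q))\<^sup>2 * ff_E z q"
    and "q \<in> V \<Longrightarrow> ff_G z' q = (c * (1 - a * curv2 z l q))\<^sup>2 * ff_G z q"
    and "q \<in> V \<Longrightarrow> curv1 z' l' q = \<sigma> / c * (curv1 z l q / (1 - a * curv1 z l q))"
    and "q \<in> V \<Longrightarrow> curv2 z' l' q = \<sigma> / c * (curv2 z l q / (1 - a * curv2 z l q))"
proof -
  note S = principal_surfaceD[OF ps]
  define m1 m2 where "m1 = (\<lambda>q. c * (1 - a * curv1 z l q))" and "m2 = (\<lambda>q. c * (1 - a * curv2 z l q))"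
  have m0: "m1 q \<noteq> 0" "m2 q \<noteq> 0" if "q \<in> V" for q using a[OF that] c by (auto simp: m1_def m2_def)
  note zs = smooth2_on_subset[OF S(3) V(3)] and ls = smooth2_on_subset[OF S(4) V(3)]
  have z's: "smooth2_on V z'" unfolding z'_def
    by (intro smooth2_on_linear[OF bounded_linear_scaleR_right V(1)] smooth2_on_add V(1) zs ls)
  have l's: "smooth2_on V l'" unfolding l'_def
    by (intro smooth2_on_linear[OF bounded_linear_scaleR_right V(1)] ls)
  have md: "m1 differentiable at q" "m2 differentiable at q" if "q \<in> V" for q
  proof -
    have "q \<in> D" using that V by auto
    then have "curv1 z l differentiable at q" "curv2 z l differentiable at q"
      using smooth2_on_curv[OF ps, THEN smooth2_onD(1)] by auto
    then show "m1 differentiable at q" "m2 differentiable at q"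
      unfolding m1_def m2_def by (auto intro!: derivative_intros)
  qed
  have z': "du z' q = m1 q *\<^sub>R du z q" "dv z' q = m2 q *\<^sub>R dv z q" if "q \<in> V" for q
  proof -
    note zd = smooth2_onD(1)[OF zs that] and ld = smooth2_onD(1)[OF ls that]
    note L = bounded_linear_scaleR_right
    note ald = differentiable_linear[OF L[of a] ld]
    have qD: "q \<in> D" using that V by auto
    have "(\<lambda>q. z q + a *\<^sub>R l q) differentiable at q" using zd ald by (rule differentiable_add)
    then have "du z' q = c *\<^sub>R (du z q + a *\<^sub>R du l q)" "dv z' q = c *\<^sub>R (dv z q + a *\<^sub>R dv l q)"
      unfolding z'_def
      by (simp_all add: du_linear[OF L] dv_linear[OF L] du_add[OF zd ald] dv_add[OF zd ald] ld)
    then show "du z' q = m1 q *\<^sub>R du z q" "dv z' q = m2 q *\<^sub>R dv z q"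
      unfolding weingarten[OF ps qD] m1_def m2_def by (simp_all add: algebra_simps)
  qed
  \<comment> \<open>The derivatives of \<open>m1\<close> and \<open>m2\<close> enter only with
    tangential vectors, so they disappear from the second fundamental form.\<close>
  have z'': "du (du z') q = m1 q *\<^sub>R du (du z) q + du m1 q *\<^sub>R du z q"
    "dv (du z') q = m1 q *\<^sub>R dv (du z) q + dv m1 q *\<^sub>R du z q"
    "dv (dv z') q = m2 q *\<^sub>R dv (dv z) q + dv m2 q *\<^sub>R dv z q" if "q \<in> V" for q
  proof -
    note zud = smooth2_onD(1)[OF smooth2_onD(2)[OF zs] that] and zvd = smooth2_onD(1)[OF smooth2_onD(3)[OF zs] that]
    note B = bounded_bilinear_scaleR
    show "du (du z') q = m1 q *\<^sub>R du (du z) q + du m1 q *\<^sub>R du z q"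
      using du_cong[OF V(1) that, of "du z'" "\<lambda>q. m1 q *\<^sub>R du z q"] z' du_bilinear[OF B md(1)[OF that] zud] by simp
    show "dv (du z') q = m1 q *\<^sub>R dv (du z) q + dv m1 q *\<^sub>R du z q"
      using dv_cong[OF V(1) that, of "du z'" "\<lambda>q. m1 q *\<^sub>R du z q"] z' dv_bilinear[OF B md(1)[OF that] zud] by simp
    show "dv (dv z') q = m2 q *\<^sub>R dv (dv z) q + dv m2 q *\<^sub>R dv z q"
      using dv_cong[OF V(1) that, of "dv z'" "\<lambda>q. m2 q *\<^sub>R dv z q"] z' dv_bilinear[OF B md(2)[OF that] zvd] by simp
  qed
  have E: "ff_E z' q = (m1 q)\<^sup>2 * ff_E z q" and G: "ff_G z' q = (m2 q)\<^sup>2 * ff_G z q"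
    and F: "ff_F z' q = 0"
    and L: "sf_L z' l' q = \<sigma> * m1 q * sf_L z l q" and N: "sf_N z' l' q = \<sigma> * m2 q * sf_N z l q"
    and M: "sf_M z' l' q = 0"
    and l: "mink (l' q) (l' q) = 1" "mink (l' q) (du z' q) = 0" "mink (l' q) (dv z' q) = 0"
    if "q \<in> V" for q
  proof -
    have qD: "q \<in> D" using that V by auto
    note P = S(7-11)[OF qD]
    show "ff_E z' q = (m1 q)\<^sup>2 * ff_E z q" "ff_G z' q = (m2 q)\<^sup>2 * ff_G z q"
      by (simp_all add: ff_E_def ff_G_def z'[OF that] mink_simps power2_eq_square)
    show "ff_F z' q = 0" using P(4) by (simp add: ff_F_def z'[OF that] mink_simps)
    show "sf_L z' l' q = \<sigma> * m1 q * sf_L z l q" "sf_N z' l' q = \<sigma> * m2 q * sf_N z l q" "sf_M z' l' q = 0"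
      using P by (simp_all add: sf_L_def sf_M_def sf_N_def z''[OF that] l'_def mink_simps)
    show "mink (l' q) (l' q) = 1" using P(1) \<sigma> by (simp add: l'_def mink_simps)
    show "mink (l' q) (du z' q) = 0" "mink (l' q) (dv z' q) = 0"
      using P by (simp_all add: l'_def z'[OF that] mink_simps)
  qed
  show "principal_surface V z' l'"
    unfolding principal_surface_def
    using V z's l's F M l m0 S(5,6) by (auto simp: E G mult_less_0_iff zero_less_mult_iff)
  show "q \<in> V \<Longrightarrow> ff_E z' q = (c * (1 - a * curv1 z l q))\<^sup>2 * ff_E z q"
    "q \<in> V \<Longrightarrow> ff_G z' q = (c * (1 - a * curv2 z l q))\<^sup>2 * ff_G z q"
    by (simp_all add: E G m1_def m2_def)
  show "curv1 z' l' q = \<sigma> / c * (curv1 z l q / (1 - a * curv1 z l q))" if "q \<in> V"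
    using m0[OF that] c unfolding curv1_def[of z' l'] E[OF that] L[OF that]
    by (simp add: curv1_def[symmetric] power2_eq_square) (simp add: m1_def curv1_def)
  show "curv2 z' l' q = \<sigma> / c * (curv2 z l q / (1 - a * curv2 z l q))" if "q \<in> V"
    using m0[OF that] c unfolding curv2_def[of z' l'] G[OF that] N[OF that]
    by (simp add: curv2_def[symmetric] power2_eq_square) (simp add: m2_def curv2_def)
qed

text \<open>This is why parameters that are natural for a surface are natural for its parallel surfaces.\<close>

lemma exp_wint_parallel:
  assumes V: "open V" "connected V"
    and W: "W_functions I f g" "\<nu>\<^sub>0 \<in> I" and W': "W_functions J f' g'" "\<nu>\<^sub>0' \<in> J"
    and \<nu>: "\<And>q. q \<in> V \<Longrightarrow> \<nu> q \<in> I \<and> \<nu> differentiable at q"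
    and \<nu>': "\<And>q. q \<in> V \<Longrightarrow> \<nu>' q \<in> J \<and> \<nu>' differentiable at q"
    and a: "\<And>q. q \<in> V \<Longrightarrow> 1 - a * f (\<nu> q) \<noteq> 0 \<and> 1 - a * g (\<nu> q) \<noteq> 0"
    and \<mu>: "\<mu> \<noteq> 0"
    and f': "\<And>q. q \<in> V \<Longrightarrow> f' (\<nu>' q) = \<mu> * (f (\<nu> q) / (1 - a * f (\<nu> q)))"
    and g': "\<And>q. q \<in> V \<Longrightarrow> g' (\<nu>' q) = \<mu> * (g (\<nu> q) / (1 - a * g (\<nu> q)))"
  shows "\<exists>C. \<forall>q\<in>V. (1 - a * f (\<nu> q)) * exp (wint f' g' \<nu>\<^sub>0' (\<nu>' q)) = C * exp (wint f g \<nu>\<^sub>0 (\<nu> q))"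
proof -
  \<comment> \<open>It is enough that this quotient has zero derivative on the connected set
    \<open>V\<close>; its value is the required C.\<close>
  let ?R = "\<lambda>q. (1 - a * f (\<nu> q)) * exp (wint f' g' \<nu>\<^sub>0' (\<nu>' q) - wint f g \<nu>\<^sub>0 (\<nu> q))"
  have "(?R has_derivative (\<lambda>v. 0)) (at q)" if q: "q \<in> V" for q
  proof -
    obtain h1 h2 where h1: "(\<nu> has_derivative h1) (at q)" and h2: "(\<nu>' has_derivative h2) (at q)"
      using \<nu>[OF q] \<nu>'[OF q] unfolding differentiable_def by blast
    have I: "\<nu> q \<in> I" "\<nu>' q \<in> J" using \<nu> \<nu>' q by auto
    let ?k = "f (\<nu> q)" and ?m = "g (\<nu> q)"
    have nz: "1 - a * ?k \<noteq> 0" "1 - a * ?m \<noteq> 0" "?k - ?m \<noteq> 0" "f' (\<nu>' q) - g' (\<nu>' q) \<noteq> 0"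
      using a[OF q] W(1) W'(1) I by (auto simp: W_functions_def)
    have chain: "((\<lambda>q. F (n q)) has_derivative (\<lambda>v. h v * D)) (at q)"
      if "(F has_real_derivative D) (at (n q))" "(n has_derivative h) (at q)" for F n h D
      using has_derivative_compose[OF that(2)] that(1) unfolding has_field_derivative_def
      by (fastforce simp: mult.commute)
    note fd = chain[OF W_functions_DERIV(1)[OF W(1) I(1)] h1]
    note wd = chain[OF wint_has_derivative[OF W I(1)] h1] and wd' = chain[OF wint_has_derivative[OF W' I(2)] h2]
    have "((\<lambda>q. f' (\<nu>' q)) has_derivative (\<lambda>v. h2 v * deriv f' (\<nu>' q))) (at q)"
      by (rule chain[OF W_functions_DERIV(1)[OF W'(1) I(2)] h2])
    \<comment> \<open>The new parameter is tied to the old one only through its curvature. Computing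
      the derivative of that curvature in two ways eliminates the unknown differential
      \<open>h2\<close>.\<close>
    moreover have "((\<lambda>q. f' (\<nu>' q)) has_derivative (\<lambda>v. h1 v * deriv f (\<nu> q) * (\<mu> / (1 - a * ?k)\<^sup>2))) (at q)"
    proof (rule has_derivative_transform_within_open[OF _ V(1) q])
      have "((\<lambda>k. \<mu> * (k / (1 - a * k))) has_real_derivative \<mu> / (1 - a * ?k)\<^sup>2) (at ?k)"
        using nz(1) by (auto intro!: derivative_eq_intros simp: power2_eq_square algebra_simps)
      from chain[where n="\<lambda>q. f (\<nu> q)", OF this fd]
      show "((\<lambda>q. \<mu> * (f (\<nu> q) / (1 - a * f (\<nu> q)))) has_derivative
        (\<lambda>v. h1 v * deriv f (\<nu> q) * (\<mu> / (1 - a * ?k)\<^sup>2))) (at q)" .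
    qed (simp add: f')
    ultimately have "(\<lambda>v. h2 v * deriv f' (\<nu>' q)) = (\<lambda>v. h1 v * deriv f (\<nu> q) * (\<mu> / (1 - a * ?k)\<^sup>2))"
      by (rule has_derivative_unique)
    then have h: "h2 v * deriv f' (\<nu>' q) = h1 v * deriv f (\<nu> q) * (\<mu> / (1 - a * ?k)\<^sup>2)" for v by meson
    have "f' (\<nu>' q) - g' (\<nu>' q) = \<mu> * (?k - ?m) / ((1 - a * ?k) * (1 - a * ?m))"
      using nz unfolding f'[OF q] g'[OF q] by (simp add: divide_simps) (simp add: algebra_simps)
    then have "\<mu> / (1 - a * ?k)\<^sup>2 / (f' (\<nu>' q) - g' (\<nu>' q)) = (1 - a * ?m) / ((1 - a * ?k) * (?k - ?m))"
      using nz \<mu> by (simp add: power2_eq_square)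
    then have w: "h2 v * (deriv f' (\<nu>' q) / (f' (\<nu>' q) - g' (\<nu>' q))) =
        h1 v * deriv f (\<nu> q) * ((1 - a * ?m) / ((1 - a * ?k) * (?k - ?m)))" for v
      unfolding times_divide_eq_right h by (metis times_divide_eq_right)
    \<comment> \<open>The change of the logarithmic derivative of the exponential is a dk / (1 - a
      k), which cancels that of the factor 1 - a k.\<close>
    have "(1 - a * ?k) * ((1 - a * ?m) / ((1 - a * ?k) * (?k - ?m)) - 1 / (?k - ?m)) = a"
      using nz by (simp add: divide_simps) (simp add: algebra_simps)
    then have z: "(1 - a * ?k) * (e * (X * ((1 - a * ?m) / ((1 - a * ?k) * (?k - ?m))) - X / (?k - ?m))) - a * X * e = 0"
      for e X
    proof -
      have "p * (e * (X * u - X / r)) - a * X * e = e * X * (p * (u - 1 / r) - a)" for p u r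
        by (simp add: algebra_simps)
      then show ?thesis by (simp only: \<open>(1 - a * ?k) * _ = a\<close>) simp
    qed
    let ?e = "exp (wint f' g' \<nu>\<^sub>0' (\<nu>' q) - wint f g \<nu>\<^sub>0 (\<nu> q))"
    have "(?R has_derivative (\<lambda>v. (1 - a * ?k) * ((h2 v * (deriv f' (\<nu>' q) / (f' (\<nu>' q) - g' (\<nu>' q)))
        - h1 v * (deriv f (\<nu> q) / (?k - ?m))) * ?e) + (0 - a * (h1 v * deriv f (\<nu> q))) * ?e)) (at q)"
      by (intro has_derivative_mult has_derivative_diff has_derivative_const has_derivative_mult_right
          chain[OF DERIV_exp has_derivative_diff[OF wd' wd]] fd)
    moreover have "(1 - a * ?k) * ((h2 v * (deriv f' (\<nu>' q) / (f' (\<nu>' q) - g' (\<nu>' q)))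
        - h1 v * (deriv f (\<nu> q) / (?k - ?m))) * ?e) + (0 - a * (h1 v * deriv f (\<nu> q))) * ?e = 0" for v
      using z[of ?e "h1 v * deriv f (\<nu> q)"] unfolding w mult.commute[of _ ?e] by simp
    ultimately show ?thesis by (simp only:)
  qed
  then have const: "?R q = ?R q'" if "q \<in> V" "q' \<in> V" for q q'
    using has_derivative_zero_unique_connected[OF V _ that] by blast
  obtain C where C: "?R q = C" if "q \<in> V" for q
  proof (cases "V = {}")
    case False
    then obtain q' where "q' \<in> V" by blast
    then show ?thesis using const that by blast
  qed auto
  have "(1 - a * f (\<nu> q)) * exp (wint f' g' \<nu>\<^sub>0' (\<nu>' q)) = C * exp (wint f g \<nu>\<^sub>0 (\<nu> q))" if "q \<in> V" for q
    using C[OF that] by (simp add: exp_diff field_simps)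
  then show ?thesis by blast
qed

section \<open>Transfer to the basic surfaces\<close>

lemma natural_parameters_parallel:
  assumes Ws: "W_surface D z l I f g \<nu>" and Ws': "W_surface V z' l' J f' g' \<nu>'" and V: "V \<subseteq> D"
    and a: "\<And>q. q \<in> V \<Longrightarrow> (1 - a * curv1 z l q) * (1 - a * curv2 z l q) \<noteq> 0"
    and \<mu>: "\<mu> \<noteq> 0" and c: "c > 0"
    and E: "\<And>q. q \<in> V \<Longrightarrow> ff_E z' q = (c * (1 - a * curv1 z l q))\<^sup>2 * ff_E z q"
    and G: "\<And>q. q \<in> V \<Longrightarrow> ff_G z' q = (c * (1 - a * curv2 z l q))\<^sup>2 * ff_G z q"
    and k: "\<And>q. q \<in> V \<Longrightarrow> curv1 z' l' q = \<mu> * (curv1 z l q / (1 - a * curv1 z l q))"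
      "\<And>q. q \<in> V \<Longrightarrow> curv2 z' l' q = \<mu> * (curv2 z l q / (1 - a * curv2 z l q))"
    and nat: "natural_parameters D z I f g \<nu>"
  shows "natural_parameters V z' J f' g' \<nu>'"
proof -
  have W: "W_functions I f g" "\<And>q. q \<in> D \<Longrightarrow> \<nu> q \<in> I \<and> \<nu> differentiable at q"
      "\<And>q. q \<in> D \<Longrightarrow> curv1 z l q = f (\<nu> q) \<and> curv2 z l q = g (\<nu> q)"
    using Ws smooth2_onD(1) unfolding W_surface_def by blast+
  have W': "W_functions J f' g'" "\<And>q. q \<in> V \<Longrightarrow> \<nu>' q \<in> J \<and> \<nu>' differentiable at q"
      "\<And>q. q \<in> V \<Longrightarrow> curv1 z' l' q = f' (\<nu>' q) \<and> curv2 z' l' q = g' (\<nu>' q)"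
    using Ws' smooth2_onD(1) unfolding W_surface_def by blast+
  have oV: "open V" "connected V" using Ws' principal_surfaceD(1,2) unfolding W_surface_def by blast+
  obtain \<nu>\<^sub>0 K1 K2 where \<nu>\<^sub>0: "\<nu>\<^sub>0 \<in> I"
    and K1: "\<And>q. q \<in> D \<Longrightarrow> sqrt (- ff_E z q) * exp (wint f g \<nu>\<^sub>0 (\<nu> q)) = K1"
    and K2: "\<And>q. q \<in> D \<Longrightarrow> sqrt (ff_G z q) * exp (wint g f \<nu>\<^sub>0 (\<nu> q)) = K2"
    using nat unfolding natural_parameters_def constant_on_def by blast
  obtain \<nu>\<^sub>0' where \<nu>\<^sub>0': "\<nu>\<^sub>0' \<in> J" using W'(1) unfolding W_functions_def by blast
  have a': "1 - a * f (\<nu> q) \<noteq> 0 \<and> 1 - a * g (\<nu> q) \<noteq> 0" if "q \<in> V" for q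
    using a[OF that] W(3)[of q] that V by auto
  have k': "f' (\<nu>' q) = \<mu> * (f (\<nu> q) / (1 - a * f (\<nu> q)))"
    "g' (\<nu>' q) = \<mu> * (g (\<nu> q) / (1 - a * g (\<nu> q)))" if "q \<in> V" for q
    using k[OF that] W(3)[of q] W'(3)[OF that] that V by auto
  have \<nu>: "\<nu> q \<in> I \<and> \<nu> differentiable at q" if "q \<in> V" for q using W(2)[of q] that V by auto
  obtain C1 where C1: "\<And>q. q \<in> V \<Longrightarrow>
      (1 - a * f (\<nu> q)) * exp (wint f' g' \<nu>\<^sub>0' (\<nu>' q)) = C1 * exp (wint f g \<nu>\<^sub>0 (\<nu> q))"
    using exp_wint_parallel[OF oV W(1) \<nu>\<^sub>0 W'(1) \<nu>\<^sub>0' \<nu> W'(2) a' \<mu> k'] by blast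
  obtain C2 where C2: "\<And>q. q \<in> V \<Longrightarrow>
      (1 - a * g (\<nu> q)) * exp (wint g' f' \<nu>\<^sub>0' (\<nu>' q)) = C2 * exp (wint g f \<nu>\<^sub>0 (\<nu> q))"
    using exp_wint_parallel[OF oV W_functions_commute[OF W(1)] \<nu>\<^sub>0 W_functions_commute[OF W'(1)] \<nu>\<^sub>0' \<nu> W'(2) _ \<mu> k'(2,1)]
      a' by blast
  have "sqrt (- ff_E z' q) * exp (wint f' g' \<nu>\<^sub>0' (\<nu>' q)) = c * \<bar>C1\<bar> * K1" if q: "q \<in> V" for q
  proof -
    have qD: "q \<in> D" using q V by auto
    \<comment> \<open>Absolute values appear because 1 - a \<nu>_1 may be negative, while the square
      root of the rescaled coefficient is not.\<close>
    have "\<bar>1 - a * f (\<nu> q)\<bar> * exp (wint f' g' \<nu>\<^sub>0' (\<nu>' q)) = \<bar>C1\<bar> * exp (wint f g \<nu>\<^sub>0 (\<nu> q))"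
      using arg_cong[OF C1[OF q], of abs] by (simp add: abs_mult)
    moreover have "sqrt (- ff_E z' q) = c * \<bar>1 - a * f (\<nu> q)\<bar> * sqrt (- ff_E z q)"
    proof -
      have "- ff_E z' q = (c * (1 - a * f (\<nu> q)))\<^sup>2 * - ff_E z q" using E[OF q] W(3)[OF qD] by simp
      then show ?thesis using c by (simp only: real_sqrt_mult real_sqrt_abs abs_mult abs_of_pos)
    qed
    ultimately have "sqrt (- ff_E z' q) * exp (wint f' g' \<nu>\<^sub>0' (\<nu>' q)) =
        c * \<bar>C1\<bar> * (sqrt (- ff_E z q) * exp (wint f g \<nu>\<^sub>0 (\<nu> q)))" by (simp add: mult_ac)
    then show ?thesis using K1[OF qD] by simp
  qed
  moreover have "sqrt (ff_G z' q) * exp (wint g' f' \<nu>\<^sub>0' (\<nu>' q)) = c * \<bar>C2\<bar> * K2" if q: "q \<in> V" for q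
  proof -
    have qD: "q \<in> D" using q V by auto
    have "\<bar>1 - a * g (\<nu> q)\<bar> * exp (wint g' f' \<nu>\<^sub>0' (\<nu>' q)) = \<bar>C2\<bar> * exp (wint g f \<nu>\<^sub>0 (\<nu> q))"
      using arg_cong[OF C2[OF q], of abs] by (simp add: abs_mult)
    moreover have "sqrt (ff_G z' q) = c * \<bar>1 - a * g (\<nu> q)\<bar> * sqrt (ff_G z q)"
    proof -
      have "ff_G z' q = (c * (1 - a * g (\<nu> q)))\<^sup>2 * ff_G z q" using G[OF q] W(3)[OF qD] by simp
      then show ?thesis using c by (simp only: real_sqrt_mult real_sqrt_abs abs_mult abs_of_pos)
    qed
    ultimately have "sqrt (ff_G z' q) * exp (wint g' f' \<nu>\<^sub>0' (\<nu>' q)) =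
        c * \<bar>C2\<bar> * (sqrt (ff_G z q) * exp (wint g f \<nu>\<^sub>0 (\<nu> q)))" by (simp add: mult_ac)
    then show ?thesis using K2[OF qD] by simp
  qed
  ultimately show ?thesis
    using \<nu>\<^sub>0' unfolding natural_parameters_def constant_on_def by blast
qed

text \<open>Parameter values in \<open>basic_dom\<close> that the listed unknown attains. In classes
  (6) and (7) the inequality expresses \<lambda> > 0, that is H' > 0.\<close>

fun unknown_range :: "basic \<Rightarrow> real set" where
  "unknown_range Basic2 = {..<1/2}"
| "unknown_range (Basic6 \<beta>) = {x. (x - 1) / (\<beta> - 1) > 0}"
| "unknown_range (Basic7 \<beta>) = {x. (x - 1) / (\<beta> - 1) > 0}"
| "unknown_range Basic3 = UNIV"
| "unknown_range Basic8 = - {0}"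
| "unknown_range Basic9 = - {0, 1}"
| "unknown_range (Basic10 \<beta> \<gamma>) = - {0}"
| "unknown_range _ = {0<..}"

lemma unknown_range:
  assumes "admissible b"
  shows "open (unknown_range b)" and "unknown_range b \<subseteq> basic_dom b"
    and "unknown_range b \<subseteq> unknown_subst b ` unknown_dom b"
proof -
  have o: "open {x. (x - 1) / (\<beta> - 1) > 0}" for \<beta> :: real
  proof (cases "\<beta> = 1")
    case False
    then show ?thesis by (intro open_Collect_less continuous_intros) auto
  qed simp
  show "open (unknown_range b)" by (cases b) (auto intro: o)
  show "unknown_range b \<subseteq> basic_dom b" by (cases b) auto
  have r: "x \<in> (\<lambda>x. ((\<beta> - 1) * x + 2) / 2) ` {0<..}" if "(x - 1) / (\<beta> - 1) > 0" for x \<beta> :: real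
  proof (rule image_eqI)
    show "2 * ((x - 1) / (\<beta> - 1)) \<in> {0<..}"
      unfolding greaterThan_iff using that by (rule mult_pos_pos[OF zero_less_numeral])
    have "\<beta> - 1 \<noteq> 0" using that by auto
    then show "x = ((\<beta> - 1) * (2 * ((x - 1) / (\<beta> - 1))) + 2) / 2" by simp
  qed
  show "unknown_range b \<subseteq> unknown_subst b ` unknown_dom b"
  proof (cases b)
    case Basic1
    show ?thesis unfolding Basic1
    proof
      fix x assume "x \<in> unknown_range Basic1"
      then show "x \<in> unknown_subst Basic1 ` unknown_dom Basic1"
        by (intro image_eqI[of _ _ "ln x"]) auto
    qed
  next
    case Basic2
    show ?thesis unfolding Basic2
    proof
      fix x assume "x \<in> unknown_range Basic2"
      then show "x \<in> unknown_subst Basic2 ` unknown_dom Basic2"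
        by (intro image_eqI[of _ _ "ln (1 - 2 * x)"]) auto
    qed
  next
    case Basic8
    show ?thesis unfolding Basic8
    proof
      fix x assume "x \<in> unknown_range Basic8"
      then show "x \<in> unknown_subst Basic8 ` unknown_dom Basic8"
        by (intro image_eqI[of _ _ "2 * arctan x"]) (auto simp: tan_arctan)
    qed
  next
    case Basic9
    show ?thesis unfolding Basic9
    proof
      fix x assume "x \<in> unknown_range Basic9"
      then show "x \<in> unknown_subst Basic9 ` unknown_dom Basic9"
        by (intro image_eqI[of _ _ "2 + 2 / (1 - x)"]) (auto simp: divide_simps)
    qed
  next
    case (Basic10 \<beta> \<gamma>)
    show ?thesis unfolding Basic10
    proof
      fix x assume "x \<in> unknown_range (Basic10 \<beta> \<gamma>)"
      then show "x \<in> unknown_subst (Basic10 \<beta> \<gamma>) ` unknown_dom (Basic10 \<beta> \<gamma>)"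
        by (intro image_eqI[of _ _ "x - \<beta> / 2"]) auto
    qed
  qed (use r in auto)
qed

lemma smooth2_on_basic_param:
  assumes "open S" "smooth2_on S k" "smooth2_on S m"
  shows "smooth2_on S (\<lambda>q. basic_param b (k q) (m q))"
  using assms smooth2_on_add[OF assms(1,2) smooth2_on_const] by (cases b) auto

lemma open_negative:
  assumes "admissible b" "b = Basic2 \<or> (\<exists>\<beta>. b = Basic7 \<beta>)"
  shows "open {x. basic_f b x < basic_g b x}"
  using assms(2)
proof
  assume "b = Basic2"
  then show ?thesis by (auto intro!: open_Collect_less continuous_intros)
next
  assume "\<exists>\<beta>. b = Basic7 \<beta>"
  then obtain \<beta> where b: "b = Basic7 \<beta>" ..
  then have "\<beta> - 1 \<noteq> 0" using admissible_neq[OF assms(1)] by auto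
  then show ?thesis using b by (auto intro!: open_Collect_less continuous_intros)
qed

text \<open>Reduces the local claim to algebra: the scaled relation near \<open>p\<close> and, at
  \<open>p\<close> alone, regularity and the range of the parameter. The latter two are open
  conditions and persist on a small ball.\<close>

lemma locally_basicI:
  assumes Ws: "W_surface D z l I f g \<nu>" and N: "open N" "N \<subseteq> D" "p \<in> N"
    and b: "admissible b" and \<mu>: "\<mu> \<noteq> 0"
    and rel: "\<And>q X Y. q \<in> N \<Longrightarrow> 1 - a * curv1 z l q \<noteq> 0 \<Longrightarrow> 1 - a * curv2 z l q \<noteq> 0 \<Longrightarrow>
      X = \<mu> * (curv1 z l q / (1 - a * curv1 z l q)) \<Longrightarrow> Y = \<mu> * (curv2 z l q / (1 - a * curv2 z l q)) \<Longrightarrow>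
      basic_rel b (X * Y) ((X + Y) / 2) ((X - Y) / 2)"
    and ap: "1 - a * curv1 z l p \<noteq> 0" "1 - a * curv2 z l p \<noteq> 0"
    and XY: "X = \<mu> * (curv1 z l p / (1 - a * curv1 z l p))" "Y = \<mu> * (curv2 z l p / (1 - a * curv2 z l p))"
    and range: "basic_param b X Y \<in> unknown_range b \<or> (b = Basic2 \<or> (\<exists>\<beta>. b = Basic7 \<beta>)) \<and> X < Y"
  shows "locally_basic D z l I f g \<nu> p"
proof -
  have ps: "principal_surface D z l" and W: "W_functions I f g" and \<nu>I: "\<And>q. q \<in> D \<Longrightarrow> \<nu> q \<in> I"
    and kf: "\<And>q. q \<in> D \<Longrightarrow> curv1 z l q = f (\<nu> q) \<and> curv2 z l q = g (\<nu> q)"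
    using Ws unfolding W_surface_def by blast+
  have kne: "curv1 z l q \<noteq> curv2 z l q" if "q \<in> D" for q
    using W \<nu>I[OF that] kf[OF that] unfolding W_functions_def by auto
  \<comment> \<open>A homothety by c divides curvatures by c, and reversing the normal changes their
    sign; together they realize the factor \<mu>.\<close>
  define c \<sigma> where "c = 1 / \<bar>\<mu>\<bar>" and "\<sigma> = sgn \<mu>"
  have c: "c > 0" and \<sigma>: "\<sigma> * \<sigma> = 1" and \<sigma>c: "\<sigma> / c = \<mu>"
    using \<mu> by (auto simp: c_def \<sigma>_def sgn_if)
  define z' l' where "z' = (\<lambda>q. c *\<^sub>R (z q + a *\<^sub>R l q))" and "l' = (\<lambda>q. \<sigma> *\<^sub>R l q)"
  define n where "n = (\<lambda>q. basic_param b (curv1 z' l' q) (curv2 z' l' q))"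
  \<comment> \<open>The open region of parameter values in which the alternative that holds at
    \<open>p\<close> stays true; the interval \<open>J\<close> is taken inside it.\<close>
  define S where "S = (if basic_param b X Y \<in> unknown_range b then unknown_range b
     else {x. basic_f b x < basic_g b x} \<inter> basic_dom b)"
  let ?h = "\<lambda>q. (1 - a * curv1 z l q) * (1 - a * curv2 z l q)"
  have "continuous_on N ?h"
    using smooth2_on_curv[OF ps, THEN smooth2_onD(4)] N(2)
    by (auto intro!: continuous_intros elim: continuous_on_subset)
  then have oh: "open {q \<in> N. ?h q \<noteq> 0}"
    using continuous_open_preimage[OF _ N(1), of ?h "- {0}"] by (simp add: Int_def vimage_def open_Compl)
  have "p \<in> {q \<in> N. ?h q \<noteq> 0}" using N(3) ap by simp
  from openE[OF oh this] obtain e0 where e0: "e0 > 0" "ball p e0 \<subseteq> {q \<in> N. ?h q \<noteq> 0}" .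
  \<comment> \<open>Stated for every radius up to \<open>e0\<close>: the ball of radius
    \<open>e0\<close> serves to define and control the parameter \<open>n\<close>, a smaller one to
    keep \<open>n\<close> inside \<open>J\<close>.\<close>
  have par: "principal_surface V z' l'" "\<And>q. q \<in> V \<Longrightarrow> ff_E z' q = (c * (1 - a * curv1 z l q))\<^sup>2 * ff_E z q"
      "\<And>q. q \<in> V \<Longrightarrow> ff_G z' q = (c * (1 - a * curv2 z l q))\<^sup>2 * ff_G z q"
      "\<And>q. q \<in> V \<Longrightarrow> curv1 z' l' q = \<mu> * (curv1 z l q / (1 - a * curv1 z l q))"
      "\<And>q. q \<in> V \<Longrightarrow> curv2 z' l' q = \<mu> * (curv2 z l q / (1 - a * curv2 z l q))"
    if "V = ball p r" "r \<le> e0" for V r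
  proof -
    have V: "open V" "connected V" "V \<subseteq> D" "\<And>q. q \<in> V \<Longrightarrow> ?h q \<noteq> 0"
      using that e0 N(2) subset_ball[OF that(2), of p] by (auto simp: connected_ball)
    show "principal_surface V z' l'" "\<And>q. q \<in> V \<Longrightarrow> ff_E z' q = (c * (1 - a * curv1 z l q))\<^sup>2 * ff_E z q"
      "\<And>q. q \<in> V \<Longrightarrow> ff_G z' q = (c * (1 - a * curv2 z l q))\<^sup>2 * ff_G z q"
      "\<And>q. q \<in> V \<Longrightarrow> curv1 z' l' q = \<mu> * (curv1 z l q / (1 - a * curv1 z l q))"
      "\<And>q. q \<in> V \<Longrightarrow> curv2 z' l' q = \<mu> * (curv2 z l q / (1 - a * curv2 z l q))"
      using parallel_surface[OF ps V c \<sigma>] unfolding z'_def l'_def \<sigma>c by blast+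
  qed
  note par0 = par[OF refl order_refl]
  have basic: "curv1 z' l' q = basic_f b (n q) \<and> curv2 z' l' q = basic_g b (n q) \<and> n q \<in> basic_dom b \<and>
      basic_rel b (curv1 z' l' q * curv2 z' l' q) ((curv1 z' l' q + curv2 z' l' q) / 2) ((curv1 z' l' q - curv2 z' l' q) / 2)"
    if q: "q \<in> ball p e0" for q
  proof -
    have h: "q \<in> N" "1 - a * curv1 z l q \<noteq> 0" "1 - a * curv2 z l q \<noteq> 0" using q e0(2) by auto
    have qD: "q \<in> D" using h N by auto
    have r: "basic_rel b (curv1 z' l' q * curv2 z' l' q) ((curv1 z' l' q + curv2 z' l' q) / 2)
      ((curv1 z' l' q - curv2 z' l' q) / 2)"
      by (rule rel[OF h]) (use par0(4,5) q in auto)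
    have "curv1 z' l' q \<noteq> curv2 z' l' q"
      unfolding par0(4)[OF q] par0(5)[OF q] using h \<mu> kne[OF qD] by (simp add: divide_simps) (simp add: algebra_simps)
    then show ?thesis using basic_rel_iff[OF b _ r] r by (simp add: n_def)
  qed
  have pb: "p \<in> ball p e0" using e0 by simp
  have np: "n p = basic_param b X Y" unfolding n_def par0(4)[OF pb] par0(5)[OF pb] XY ..
  have XYb: "X = basic_f b (n p)" "Y = basic_g b (n p)"
    using basic[OF pb] par0(4,5)[OF pb] XY by auto
  have S: "open S" "S \<subseteq> basic_dom b" "n p \<in> S"
  proof -
    have "open S \<and> S \<subseteq> basic_dom b \<and> n p \<in> S"
    proof (cases "basic_param b X Y \<in> unknown_range b")
      case True
      then show ?thesis using unknown_range(1,2)[OF b] by (simp add: S_def np)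
    next
      case False
      then have neg: "b = Basic2 \<or> (\<exists>\<beta>. b = Basic7 \<beta>)" and "X < Y" using range by blast+
      have S: "S = {x. basic_f b x < basic_g b x} \<inter> basic_dom b" using False by (simp add: S_def)
      have "n p \<in> S" using \<open>X < Y\<close> XYb basic[OF pb] by (simp add: S)
      then show ?thesis using open_negative[OF b neg] open_basic_dom unfolding S by blast
    qed
    then show "open S" "S \<subseteq> basic_dom b" "n p \<in> S" by blast+
  qed
  from openE[OF S(1,3)] obtain e1 where e1: "e1 > 0" "ball (n p) e1 \<subseteq> S" .
  define J where "J = ball (n p) e1"
  have J: "open J" "is_interval J" "J \<noteq> {}" "J \<subseteq> basic_dom b" "n p \<in> J"
    using e1 S by (auto simp: J_def is_interval_ball_real)
  have bfJ: "basic_functions b J (basic_f b) (basic_g b)" by (rule basic_functions_basic[OF b J(1-4)])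
  have ns: "smooth2_on (ball p e0) n"
    unfolding n_def by (intro smooth2_on_basic_param open_ball smooth2_on_curv[OF par0(1)])
  have on: "open (ball p e0 \<inter> n -` J)"
    using smooth2_onD(4)[OF ns] J(1) by (intro continuous_open_preimage) auto
  have "p \<in> ball p e0 \<inter> n -` J" using J(5) pb by simp
  from openE[OF on this] obtain r where r: "r > 0" "ball p r \<subseteq> ball p e0 \<inter> n -` J" .
  define V where "V = ball p (min r e0)"
  note parV = par[OF V_def min.cobounded2]
  have V: "p \<in> V" "V \<subseteq> ball p e0" "V \<subseteq> D" using r e0 N by (auto simp: V_def)
  have VJ: "n q \<in> J" if "q \<in> V" for q using that r(2) by (auto simp: V_def)
  have Ws': "W_surface V z' l' J (basic_f b) (basic_g b) n"
    unfolding W_surface_def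
    using parV(1) bfJ smooth2_on_subset[OF ns V(2)] basic V(2) VJ by (auto simp: basic_functions_def)
  have bs: "basic_surface b V z' l' J (basic_f b) (basic_g b) n"
    unfolding basic_surface_def using bfJ Ws' basic V(2)
    by (auto simp: curv_K_def curv_H_def curv_H'_def n_def)
  have hV: "?h q \<noteq> 0" if "q \<in> V" for q using V(2) e0(2) that by blast
  have nat: "natural_parameters D z I f g \<nu> \<longrightarrow> natural_parameters V z' J (basic_f b) (basic_g b) n"
    using natural_parameters_parallel[OF Ws Ws' V(3) hV \<mu> c parV(2-5)] by blast
  have "similarity (\<lambda>x. c *\<^sub>R x)"
    unfolding similarity_def
    by (rule exI[of _ c], rule conjI[OF c], rule exI[of _ "mat 1"], rule exI[of _ 0])
      (simp add: matrix_vector_mul_lid)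
  moreover have "J \<subseteq> unknown_subst b ` unknown_dom b \<and> natural_pde_is_listed b J (basic_f b) (basic_g b) \<or>
     (b = Basic2 \<or> (\<exists>\<beta>. b = Basic7 \<beta>)) \<and> (\<forall>x\<in>J. basic_f b x < basic_g b x)"
  proof (cases "basic_param b X Y \<in> unknown_range b")
    case True
    then have "J \<subseteq> unknown_subst b ` unknown_dom b"
      using e1(2) unknown_range(3)[OF b] by (auto simp: J_def S_def)
    then show ?thesis using natural_pde_basic[OF bfJ] by blast
  next
    case False
    then show ?thesis using range e1(2) by (auto simp: J_def S_def)
  qed
  ultimately show ?thesis
    unfolding locally_basic_def using V(1,3) hV bs nat unfolding z'_def by blast
qed

section \<open>Classification of the linear relations\<close>

text \<open>The substitution is inverted by noting that 1 + a X is the reciprocal of 1 - a x.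
  Multiplying the old relation by (1 + a X) (1 + a Y) then removes all denominators.\<close>

lemma parallel_curvature_relation:
  fixes \<alpha> \<beta> \<gamma> \<delta> :: real
  assumes rel: "\<delta> * (x * y) = \<alpha> * ((x + y) / 2) + \<beta> * ((x - y) / 2) + \<gamma>"
    and "1 - a * x \<noteq> 0" "1 - a * y \<noteq> 0"
    and X: "X = x / (1 - a * x)" and Y: "Y = y / (1 - a * y)"
  shows "(\<delta> - a * \<alpha> - \<gamma> * a\<^sup>2) * (X * Y) = (\<alpha> + 2 * a * \<gamma>) * ((X + Y) / 2) + \<beta> * ((X - Y) / 2) + \<gamma>"
proof -
  have x: "X * (1 - a * x) = x" and y: "Y * (1 - a * y) = y" using assms by simp_all
  define s t where "s = 1 - a * x" and "t = 1 - a * y"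
  have st: "s \<noteq> 0" "t \<noteq> 0" "x = X * s" "y = Y * t" "s = 1 - a * (X * s)" "t = 1 - a * (Y * t)"
    using assms x y by (simp_all add: s_def t_def)
  have st1: "s * (1 + a * X) = 1" "t * (1 + a * Y) = 1" using st(5,6) by (simp_all add: algebra_simps)
  have "2 * \<delta> * (X * Y) * s * t = \<alpha> * (X * s + Y * t) + \<beta> * (X * s - Y * t) + 2 * \<gamma>"
    using rel st(3,4) by (simp add: field_simps)
  then have "(1 + a * X) * (1 + a * Y) * (2 * \<delta> * (X * Y) * s * t) =
      (1 + a * X) * (1 + a * Y) * (\<alpha> * (X * s + Y * t) + \<beta> * (X * s - Y * t) + 2 * \<gamma>)" by simp
  moreover have "(1 + a * X) * (1 + a * Y) * (2 * \<delta> * (X * Y) * s * t) = 2 * \<delta> * (X * Y)"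
    using st1 by algebra
  moreover have "(1 + a * X) * (1 + a * Y) * (\<alpha> * (X * s + Y * t) + \<beta> * (X * s - Y * t) + 2 * \<gamma>) =
     \<alpha> * (X * (1 + a * Y) + Y * (1 + a * X)) + \<beta> * (X * (1 + a * Y) - Y * (1 + a * X))
       + 2 * \<gamma> * ((1 + a * X) * (1 + a * Y))"
    using st1 by algebra
  ultimately show ?thesis by (simp add: field_simps power2_eq_square)
qed

text \<open>At such a root the discriminant factors as (A + \<beta>) (A - \<beta>) with A = \<alpha>
  + 2 a \<gamma>. If a x = 1, the relation becomes (a y - 1) (A + \<beta>) = 0, so a y = 1 too,
  against x \<noteq> y; symmetrically for y with A - \<beta>.\<close>

lemma parallel_regular:
  fixes \<alpha> \<beta> \<gamma> \<delta> :: real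
  assumes rel: "\<delta> * (x * y) = \<alpha> * ((x + y) / 2) + \<beta> * ((x - y) / 2) + \<gamma>" and "x \<noteq> y"
    and disc: "\<alpha>\<^sup>2 - \<beta>\<^sup>2 + 4 * \<gamma> * \<delta> \<noteq> 0" and a: "\<delta> = a * \<alpha> + \<gamma> * a\<^sup>2"
  shows "1 - a * x \<noteq> 0" and "1 - a * y \<noteq> 0" and "(\<alpha> + 2 * a * \<gamma>)\<^sup>2 \<noteq> \<beta>\<^sup>2"
proof -
  have d: "\<alpha>\<^sup>2 - \<beta>\<^sup>2 + 4 * \<gamma> * \<delta> = (\<alpha> + 2 * a * \<gamma> + \<beta>) * (\<alpha> + 2 * a * \<gamma> - \<beta>)"
    using a by (simp add: power2_eq_square algebra_simps)
  then have n: "\<alpha> + 2 * a * \<gamma> + \<beta> \<noteq> 0" "\<alpha> + 2 * a * \<gamma> - \<beta> \<noteq> 0" using disc by auto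
  show "(\<alpha> + 2 * a * \<gamma>)\<^sup>2 \<noteq> \<beta>\<^sup>2" using n by (simp add: power2_eq_iff add_eq_0_iff2)
  have r: "2 * \<delta> * (x * y) = \<alpha> * (x + y) + \<beta> * (x - y) + 2 * \<gamma>" using rel by (simp add: field_simps)
  show "1 - a * x \<noteq> 0"
  proof
    assume ax: "1 - a * x = 0"
    then have "(a * y - 1) * (\<alpha> + 2 * a * \<gamma> + \<beta>) = 0" using r a by algebra
    then have "a * y = a * x" using n ax by simp
    then show False using ax \<open>x \<noteq> y\<close> by auto
  qed
  show "1 - a * y \<noteq> 0"
  proof
    assume ay: "1 - a * y = 0"
    then have "(a * x - 1) * (\<alpha> + 2 * a * \<gamma> - \<beta>) = 0" using r a by algebra
    then have "a * x = a * y" using n ay by simp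
    then show False using ay \<open>x \<noteq> y\<close> by auto
  qed
qed

text \<open>The part of the premises of \<open>locally_basicI\<close> that concerns a single point.
  The relation \<open>scaled_rel\<close> is kept apart, because it must hold with the same class and
  factor at all nearby points.\<close>

definition classified :: "basic \<Rightarrow> real \<Rightarrow> real \<Rightarrow> real \<Rightarrow> bool" where
  "classified b \<mu> X Y \<longleftrightarrow> admissible b \<and> \<mu> \<noteq> 0 \<and>
     (basic_param b (\<mu> * X) (\<mu> * Y) \<in> unknown_range b \<or> (b = Basic2 \<or> (\<exists>\<beta>. b = Basic7 \<beta>)) \<and> \<mu> * X < \<mu> * Y)"

abbreviation scaled_rel :: "basic \<Rightarrow> real \<Rightarrow> real \<Rightarrow> real \<Rightarrow> bool" where
  "scaled_rel b \<mu> X Y \<equiv> basic_rel b (\<mu> * X * (\<mu> * Y)) ((\<mu> * X + \<mu> * Y) / 2) ((\<mu> * X - \<mu> * Y) / 2)"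

text \<open>The condition \<open>sgn\<close> is the normalization \<open>H' > 0\<close> after scaling, needed for class (6) only.\<close>

lemma classify_linear:
  fixes A \<beta> \<gamma> :: real
  assumes ne: "X0 \<noteq> Y0" and rel: "A * ((X0 + Y0) / 2) + \<beta> * ((X0 - Y0) / 2) + \<gamma> = 0"
    and disc: "A\<^sup>2 \<noteq> \<beta>\<^sup>2"
    and sgn: "A \<noteq> 0 \<Longrightarrow> \<gamma> \<noteq> 0 \<Longrightarrow> A\<^sup>2 < \<beta>\<^sup>2 \<Longrightarrow> - A / \<gamma> * (X0 - Y0) > 0"
  shows "\<exists>b \<mu>. classified b \<mu> X0 Y0 \<and>
    (\<forall>X Y. A * ((X + Y) / 2) + \<beta> * ((X - Y) / 2) + \<gamma> = 0 \<longrightarrow> scaled_rel b \<mu> X Y)"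
proof -
  have rel': "A * (X0 + Y0) + \<beta> * (X0 - Y0) + 2 * \<gamma> = 0" using rel by (simp add: field_simps)
  have n: "A + \<beta> \<noteq> 0" "A - \<beta> \<noteq> 0" using disc by (auto simp: add_eq_0_iff2)
  have pow: "(- \<beta> / A)\<^sup>2 \<noteq> 1" "(- \<beta> / A)\<^sup>2 > 1 \<longleftrightarrow> A\<^sup>2 < \<beta>\<^sup>2" if "A \<noteq> 0"
    using that disc by (auto simp: power_divide)
  have sq: "b\<^sup>2 > 1 \<or> b\<^sup>2 < 1" if "b\<^sup>2 \<noteq> 1" for b :: real using that by linarith
  \<comment> \<open>Needed for the homogeneous classes (1), (4) and (5), where the factor is the
    sign of \<open>Y0\<close> and makes the parameter \<nu>_2 positive.\<close>
  have Y00: "Y0 \<noteq> 0" if "\<gamma> = 0"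
  proof
    assume "Y0 = 0"
    then have "(A + \<beta>) * X0 = 0" using rel' that by (simp add: algebra_simps)
    then show False using n ne \<open>Y0 = 0\<close> by simp
  qed
  \<comment> \<open>The five cases lead to class (3), (1), (2), then (4) or (5), then (6) or (7). In
    the last two the size of \<beta>/A decides.\<close>
  consider "A = 0" | "A \<noteq> 0" "\<beta> = 0" "\<gamma> = 0" | "A \<noteq> 0" "\<beta> = 0" "\<gamma> \<noteq> 0"
    | "A \<noteq> 0" "\<beta> \<noteq> 0" "\<gamma> = 0" | "A \<noteq> 0" "\<beta> \<noteq> 0" "\<gamma> \<noteq> 0" by blast
  then show ?thesis
  proof cases
    case 1
    then have "\<beta> \<noteq> 0" using disc by auto
    moreover have "\<gamma> \<noteq> 0"
    proof
      assume "\<gamma> = 0"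
      then show False using 1 rel' \<open>\<beta> \<noteq> 0\<close> ne by simp
    qed
    moreover have "scaled_rel Basic3 (- \<beta> / \<gamma>) X Y"
      if "A * ((X + Y) / 2) + \<beta> * ((X - Y) / 2) + \<gamma> = 0" for X Y
    proof -
      have "\<beta> * (X - Y) = - 2 * \<gamma>" using that 1 by (simp add: field_simps)
      moreover have "- \<beta> / \<gamma> * X - - \<beta> / \<gamma> * Y = - (\<beta> * (X - Y)) / \<gamma>" by (simp add: algebra_simps diff_divide_distrib)
      ultimately show ?thesis using \<open>\<gamma> \<noteq> 0\<close> by simp
    qed
    ultimately show ?thesis
      by (intro exI[of _ Basic3] exI[of _ "- \<beta> / \<gamma>"]) (simp add: classified_def)
  next
    case 2
    define \<mu> where "\<mu> = sgn Y0"
    have "\<mu> * Y0 > 0" "\<mu> \<noteq> 0" using Y00[OF 2(3)] by (auto simp: \<mu>_def sgn_if)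
    moreover have "scaled_rel Basic1 \<mu> X Y" if "A * ((X + Y) / 2) + \<beta> * ((X - Y) / 2) + \<gamma> = 0" for X Y
    proof -
      have "X + Y = 0" using that 2 by simp
      then show ?thesis by (simp add: distrib_left[symmetric])
    qed
    ultimately show ?thesis
      by (intro exI[of _ Basic1] exI[of _ \<mu>]) (simp add: classified_def)
  next
    case 3
    define \<mu> where "\<mu> = - A / (2 * \<gamma>)"
    have \<mu>: "\<mu> \<noteq> 0" using 3 by (simp add: \<mu>_def)
    have r: "\<mu> * X + \<mu> * Y = 1" if "A * ((X + Y) / 2) + \<beta> * ((X - Y) / 2) + \<gamma> = 0" for X Y
    proof -
      have "A * (X + Y) = - 2 * \<gamma>" using that 3 by (simp add: field_simps)
      moreover have "\<mu> * X + \<mu> * Y = - (A * (X + Y)) / (2 * \<gamma>)" using 3 by (simp add: \<mu>_def field_simps)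
      ultimately show ?thesis using 3 by simp
    qed
    have "\<mu> * X0 \<noteq> \<mu> * Y0" using \<mu> ne by simp
    \<comment> \<open>The scaled curvatures add up to 1 and differ, so the second is below 1/2
      unless the first is the smaller one.\<close>
    then have "\<mu> * Y0 < 1 / 2 \<or> \<mu> * X0 < \<mu> * Y0" using r[OF rel] by linarith
    then show ?thesis using \<mu> r
      by (intro exI[of _ Basic2] exI[of _ \<mu>]) (auto simp: classified_def)
  next
    case 4
    define B where "B = - \<beta> / A"
    define b where "b = (if B\<^sup>2 > 1 then Basic4 B else Basic5 B)"
    define \<mu> where "\<mu> = sgn Y0"
    have "\<mu> * Y0 > 0" "\<mu> \<noteq> 0" using Y00[OF 4(3)] by (auto simp: \<mu>_def sgn_if)
    moreover have "admissible b" using sq[of B] pow(1)[OF 4(1)] 4 by (auto simp: b_def B_def)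
    moreover have "scaled_rel b \<mu> X Y" if "A * ((X + Y) / 2) + \<beta> * ((X - Y) / 2) + \<gamma> = 0" for X Y
    proof -
      have "A * (X + Y) = - \<beta> * (X - Y)" using that 4 by (simp add: field_simps)
      then have "X + Y = B * (X - Y)" using 4(1) by (simp add: B_def field_simps)
      then have "\<mu> * X + \<mu> * Y = B * (\<mu> * X - \<mu> * Y)" by algebra
      then show ?thesis by (simp add: b_def)
    qed
    ultimately show ?thesis
      by (intro exI[of _ b] exI[of _ \<mu>]) (simp add: classified_def b_def)
  next
    case 5
    define B where "B = - \<beta> / A"
    define b where "b = (if B\<^sup>2 > 1 then Basic6 B else Basic7 B)"
    \<comment> \<open>The only factor that turns the constant term of the relation solved for H into
      1, so no freedom of sign is left.\<close>
    define \<mu> where "\<mu> = - A / \<gamma>"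
    have \<mu>: "\<mu> \<noteq> 0" using 5 by (simp add: \<mu>_def)
    have ad: "admissible b" using sq[of B] pow(1)[OF 5(1)] 5 by (auto simp: b_def B_def)
    have r: "\<mu> * X + \<mu> * Y = B * (\<mu> * X - \<mu> * Y) + 2"
      if "A * ((X + Y) / 2) + \<beta> * ((X - Y) / 2) + \<gamma> = 0" for X Y
    proof -
      have "A * (X + Y) = - \<beta> * (X - Y) - 2 * \<gamma>" using that by (simp add: field_simps)
      then have "- (A * (X + Y)) / \<gamma> = \<beta> * (X - Y) / \<gamma> + 2" using 5 by (simp add: field_simps)
      moreover have "\<mu> * X + \<mu> * Y = - (A * (X + Y)) / \<gamma>" using 5 by (simp add: \<mu>_def field_simps)
      moreover have "B * (\<mu> * X - \<mu> * Y) = \<beta> * (X - Y) / \<gamma>"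
        using 5 by (simp add: \<mu>_def B_def algebra_simps diff_divide_distrib)
      ultimately show ?thesis by simp
    qed
    have sc: "scaled_rel b \<mu> X Y" if "A * ((X + Y) / 2) + \<beta> * ((X - Y) / 2) + \<gamma> = 0" for X Y
      using r[OF that] by (simp add: b_def)
    have m: "\<mu> * X0 \<noteq> \<mu> * Y0" using \<mu> ne by simp
    have bs: "b \<in> {Basic4 B, Basic5 B, Basic6 B, Basic7 B}" by (simp add: b_def)
    have "\<mu> * X0 - \<mu> * Y0 = 2 * (\<mu> * Y0 - 1) / (B - 1)"
      using basic_f_minus_g[OF ad bs, of "\<mu> * Y0"] basic_rel_iff[OF ad m sc[OF rel]]
      by (auto simp: b_def split: if_splits)
    then have pos: "(\<mu> * Y0 - 1) / (B - 1) > 0" if "\<mu> * X0 > \<mu> * Y0"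
    proof -
      have "2 * ((\<mu> * Y0 - 1) / (B - 1)) = \<mu> * X0 - \<mu> * Y0"
        using \<open>\<mu> * X0 - \<mu> * Y0 = _\<close> by (simp only: times_divide_eq_right)
      then show ?thesis using that by linarith
    qed
    have "basic_param b (\<mu> * X0) (\<mu> * Y0) \<in> unknown_range b \<or> (\<exists>\<beta>. b = Basic7 \<beta>) \<and> \<mu> * X0 < \<mu> * Y0"
    proof (cases "B\<^sup>2 > 1")
      case True
      then have "- A / \<gamma> * (X0 - Y0) > 0" using sgn[OF 5(1,3)] pow(2)[OF 5(1)] by (simp add: B_def)
      moreover have "\<mu> * X0 - \<mu> * Y0 = - A / \<gamma> * (X0 - Y0)" by (simp only: \<mu>_def right_diff_distrib)
      ultimately have "\<mu> * X0 > \<mu> * Y0" by linarith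
      then show ?thesis using pos True by (simp add: b_def)
    next
      case False
      moreover have "\<mu> * X0 > \<mu> * Y0 \<or> \<mu> * X0 < \<mu> * Y0" using m by linarith
      ultimately show ?thesis using pos by (auto simp: b_def)
    qed
    then show ?thesis using ad \<mu> sc
      by (intro exI[of _ b] exI[of _ \<mu>]) (auto simp: classified_def)
  qed
qed

text \<open>For \<open>\<gamma> \<noteq> 0\<close> there are two parallel surfaces with a linear relation between \<open>H\<close> and \<open>H'\<close>;
  in class (6) the sign of \<open>H'\<close> is positive for exactly one of them.\<close>

lemma classify_hyperbolic:
  fixes \<alpha> \<beta> \<gamma> \<delta> :: real
  assumes rel: "\<delta> * (x * y) = \<alpha> * ((x + y) / 2) + \<beta> * ((x - y) / 2) + \<gamma>" and ne: "x \<noteq> y"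
    and disc: "\<alpha>\<^sup>2 - \<beta>\<^sup>2 + 4 * \<gamma> * \<delta> \<noteq> 0" and nonneg: "\<alpha>\<^sup>2 + 4 * \<gamma> * \<delta> \<ge> 0" and nz: "\<alpha> \<noteq> 0 \<or> \<gamma> \<noteq> 0"
  shows "\<exists>a. \<delta> = a * \<alpha> + \<gamma> * a\<^sup>2 \<and> (\<alpha> + 2 * a * \<gamma> \<noteq> 0 \<longrightarrow> \<gamma> \<noteq> 0 \<longrightarrow> (\<alpha> + 2 * a * \<gamma>)\<^sup>2 < \<beta>\<^sup>2 \<longrightarrow>
     - (\<alpha> + 2 * a * \<gamma>) / \<gamma> * (x / (1 - a * x) - y / (1 - a * y)) > 0)"
proof (cases "\<gamma> = 0")
  case True
  then show ?thesis using nz by (intro exI[of _ "\<delta> / \<alpha>"]) simp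
next
  case False
  define r where "r = sqrt (\<alpha>\<^sup>2 + 4 * \<gamma> * \<delta>)"
  have r2: "r\<^sup>2 = \<alpha>\<^sup>2 + 4 * \<gamma> * \<delta>" using nonneg by (simp add: r_def)
  \<comment> \<open>The two roots of \<gamma> a^2 + \<alpha> a - \<delta>; the corresponding
    coefficients of H are r and -r.\<close>
  define a1 a2 where "a1 = (r - \<alpha>) / (2 * \<gamma>)" and "a2 = (- r - \<alpha>) / (2 * \<gamma>)"
  have A: "\<alpha> + 2 * a1 * \<gamma> = r" "\<alpha> + 2 * a2 * \<gamma> = - r" using False by (simp_all add: a1_def a2_def field_simps)
  have root: "\<delta> = a * \<alpha> + \<gamma> * a\<^sup>2" if "(\<alpha> + 2 * a * \<gamma>)\<^sup>2 = r\<^sup>2" for a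
  proof -
    have "4 * \<gamma> * (a * \<alpha> + \<gamma> * a\<^sup>2 - \<delta>) = 0" using that r2 by (simp add: power2_eq_square algebra_simps)
    then show ?thesis using False by simp
  qed
  have a12: "\<delta> = a1 * \<alpha> + \<gamma> * a1\<^sup>2" "\<delta> = a2 * \<alpha> + \<gamma> * a2\<^sup>2" using root A by simp_all
  show ?thesis
  proof (cases "r \<noteq> 0 \<and> r\<^sup>2 < \<beta>\<^sup>2")
    case no: False
    then show ?thesis using a12(1) A(1) by (intro exI[of _ a1]) auto
  next
    case True
    note reg1 = parallel_regular[OF rel ne disc a12(1)] and reg2 = parallel_regular[OF rel ne disc a12(2)]
    define X Y where "X = x / (1 - a1 * x)" and "Y = y / (1 - a1 * y)"
    have lin: "r * (X + Y) + \<beta> * (X - Y) + 2 * \<gamma> = 0"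
    proof -
      have "\<delta> - a1 * \<alpha> - \<gamma> * a1\<^sup>2 = 0" using a12(1) by simp
      then show ?thesis
        using parallel_curvature_relation[OF rel reg1(1,2) X_def Y_def] unfolding A(1) by (simp add: field_simps)
    qed
    \<comment> \<open>The factors by which 1 - a x and 1 - a y change on passing from the first root
      to the second.\<close>
    define u w where "u = 1 + r * X / \<gamma>" and "w = 1 + r * Y / \<gamma>"
    have a2: "a2 * \<gamma> = a1 * \<gamma> - r" using A by simp
    have q: "1 - a2 * x = u * (1 - a1 * x)" "1 - a2 * y = w * (1 - a1 * y)"
    proof -
      have "a2 = a1 - r / \<gamma>" using a2 False by (simp add: field_simps)
      moreover have "X * (1 - a1 * x) = x" "Y * (1 - a1 * y) = y" using reg1(1,2) by (simp_all add: X_def Y_def)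
      moreover have "u * (1 - a1 * x) = (1 - a1 * x) + r / \<gamma> * (X * (1 - a1 * x))"
        "w * (1 - a1 * y) = (1 - a1 * y) + r / \<gamma> * (Y * (1 - a1 * y))"
        by (simp_all add: u_def w_def distrib_right)
      ultimately show "1 - a2 * x = u * (1 - a1 * x)" "1 - a2 * y = w * (1 - a1 * y)"
        by (simp_all only:) (simp_all add: left_diff_distrib)
    qed
    have uw0: "u \<noteq> 0" "w \<noteq> 0" using q reg2(1,2) by auto
    have "r * (u + w) + \<beta> * (u - w) = 0"
    proof -
      have "r * (u + w) + \<beta> * (u - w) = r / \<gamma> * (r * (X + Y) + \<beta> * (X - Y) + 2 * \<gamma>)"
        using False by (simp add: u_def w_def field_simps)
      then show ?thesis using lin by simp
    qed
    then have uw: "u * (\<beta> + r) = w * (\<beta> - r)" by (simp add: algebra_simps)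
    \<comment> \<open>Positivity of u w under r^2 < \<beta>^2 shows that the difference of
      curvatures keeps its sign from one root to the other. The coefficient of H changes sign, so
      exactly one root meets the requirement.\<close>
    have "(u * w) * (\<beta> + r)\<^sup>2 = w\<^sup>2 * (\<beta>\<^sup>2 - r\<^sup>2)"
      using uw by (simp add: power2_eq_square) algebra
    moreover have "w\<^sup>2 * (\<beta>\<^sup>2 - r\<^sup>2) > 0" using True uw0 by simp
    ultimately have uwpos: "u * w > 0" by (metis zero_less_mult_pos2 zero_le_power2 mult_zero_right order_le_less less_irrefl)
    have d1: "x / (1 - a1 * x) - y / (1 - a1 * y) = (x - y) / ((1 - a1 * x) * (1 - a1 * y))"
      using reg1(1,2) by (simp add: divide_simps) (simp add: algebra_simps)
    have d2: "x / (1 - a2 * x) - y / (1 - a2 * y) = (x - y) / ((1 - a2 * x) * (1 - a2 * y))"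
      using reg2(1,2) by (simp add: divide_simps) (simp add: algebra_simps)
    have "(1 - a2 * x) * (1 - a2 * y) = u * w * ((1 - a1 * x) * (1 - a1 * y))" unfolding q by simp
    then have d2': "x / (1 - a2 * x) - y / (1 - a2 * y) = (x / (1 - a1 * x) - y / (1 - a1 * y)) / (u * w)"
      unfolding d1 d2 by (simp add: mult_ac)
    define e where "e = - r / \<gamma> * (x / (1 - a1 * x) - y / (1 - a1 * y))"
    have "e \<noteq> 0" using True False reg1(1,2) ne unfolding e_def d1 by simp
    then consider "e > 0" | "e < 0" by linarith
    then show ?thesis
    proof cases
      case 1
      then show ?thesis using a12(1) A(1) by (intro exI[of _ a1]) (simp add: e_def)
    next
      case 2
      have "- (\<alpha> + 2 * a2 * \<gamma>) / \<gamma> * (x / (1 - a2 * x) - y / (1 - a2 * y)) = - e / (u * w)"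
        unfolding A d2' e_def by simp
      also have "\<dots> > 0" using 2 uwpos by (simp add: divide_neg_pos)
      finally show ?thesis using a12(2) by blast
    qed
  qed
qed

lemma locally_basic_hyperbolic:
  assumes disc: "\<alpha>\<^sup>2 - \<beta>\<^sup>2 + 4 * \<gamma> * \<delta> \<noteq> 0" and nonneg: "\<alpha>\<^sup>2 + 4 * \<gamma> * \<delta> \<ge> 0"
    and Ws: "W_surface D z l I f g \<nu>" and D: "open D" and p: "p \<in> D"
    and ne: "curv1 z l p \<noteq> curv2 z l p"
    and rel: "\<And>q. q \<in> D \<Longrightarrow> \<delta> * (curv1 z l q * curv2 z l q) = \<alpha> * ((curv1 z l q + curv2 z l q) / 2)
      + \<beta> * ((curv1 z l q - curv2 z l q) / 2) + \<gamma>"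
  shows "locally_basic D z l I f g \<nu> p"
proof (cases "\<alpha> = 0 \<and> \<gamma> = 0")
  case True
  let ?k = "curv1 z l" and ?m = "curv2 z l"
  have \<beta>: "\<beta> \<noteq> 0" using disc True by auto
  have r: "2 * \<delta> * (?k q * ?m q) = \<beta> * (?k q - ?m q)" if "q \<in> D" for q
    using rel[OF that] True by (simp add: field_simps)
  have \<delta>: "\<delta> \<noteq> 0" using r[OF p] \<beta> ne by auto
  \<comment> \<open>With \<alpha> = \<gamma> = 0 no parallel surface loses the K-term. The relation
    \<delta> K = \<beta> H' is merely scaled: K is multiplied by \<mu>^2 and H' by \<mu>, which
    gives K = 2 H'.\<close>
  define \<mu> where "\<mu> = 2 * \<delta> / \<beta>"
  have \<mu>: "\<mu> \<noteq> 0" using \<beta> \<delta> by (simp add: \<mu>_def)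
  have "\<mu> * (?k q * ?m q) = ?k q - ?m q" if "q \<in> D" for q
    using r[OF that] \<beta> by (simp add: \<mu>_def field_simps)
  then have sc: "scaled_rel Basic9 \<mu> (?k q) (?m q)" if "q \<in> D" for q
    using that by (simp add: right_diff_distrib[symmetric] mult.assoc) (simp add: mult.left_commute)
  have m: "\<mu> * ?k p \<noteq> \<mu> * ?m p" using \<mu> ne by simp
  have "basic_param Basic9 (\<mu> * ?k p) (\<mu> * ?m p) \<in> unknown_range Basic9"
    using basic_rel_iff[OF _ m sc[OF p]] by simp
  then show ?thesis
    by (intro locally_basicI[OF Ws D order_refl p _ \<mu>, where b=Basic9 and a=0]) (use sc in auto)
next
  case False
  let ?k = "curv1 z l" and ?m = "curv2 z l"
  obtain a where a: "\<delta> = a * \<alpha> + \<gamma> * a\<^sup>2" and sgn: "\<alpha> + 2 * a * \<gamma> \<noteq> 0 \<Longrightarrow> \<gamma> \<noteq> 0 \<Longrightarrow>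
      (\<alpha> + 2 * a * \<gamma>)\<^sup>2 < \<beta>\<^sup>2 \<Longrightarrow>
      - (\<alpha> + 2 * a * \<gamma>) / \<gamma> * (?k p / (1 - a * ?k p) - ?m p / (1 - a * ?m p)) > 0"
    using classify_hyperbolic[OF rel[OF p] ne disc nonneg] False by blast
  have lin: "(\<alpha> + 2 * a * \<gamma>) * ((X + Y) / 2) + \<beta> * ((X - Y) / 2) + \<gamma> = 0"
    if "q \<in> D" "1 - a * ?k q \<noteq> 0" "1 - a * ?m q \<noteq> 0" "X = ?k q / (1 - a * ?k q)" "Y = ?m q / (1 - a * ?m q)" for q X Y
    using parallel_curvature_relation[OF rel[OF that(1)] that(2-5)] a by simp
  note reg = parallel_regular[OF rel[OF p] ne disc a]
  have "?k p / (1 - a * ?k p) \<noteq> ?m p / (1 - a * ?m p)"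
    using reg(1,2) ne by (simp add: divide_simps) (simp add: algebra_simps)
  from classify_linear[OF this lin[OF p reg(1,2) refl refl] reg(3) sgn]
  obtain b \<mu> where b: "classified b \<mu> (?k p / (1 - a * ?k p)) (?m p / (1 - a * ?m p))"
    and sc: "\<And>X Y. (\<alpha> + 2 * a * \<gamma>) * ((X + Y) / 2) + \<beta> * ((X - Y) / 2) + \<gamma> = 0 \<Longrightarrow> scaled_rel b \<mu> X Y"
    by blast
  have ad: "admissible b" and \<mu>: "\<mu> \<noteq> 0" using b by (auto simp: classified_def)
  show ?thesis
  proof (rule locally_basicI[OF Ws D order_refl p ad \<mu> _ reg(1,2) refl refl])
    fix q X Y
    assume "q \<in> D" "1 - a * ?k q \<noteq> 0" "1 - a * ?m q \<noteq> 0"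
      and XY: "X = \<mu> * (?k q / (1 - a * ?k q))" "Y = \<mu> * (?m q / (1 - a * ?m q))"
    then show "basic_rel b (X * Y) ((X + Y) / 2) ((X - Y) / 2)"
      unfolding XY by (intro sc lin[OF _ _ _ refl refl])
  qed (use b in \<open>simp add: classified_def\<close>)
qed

lemma locally_basic_elliptic:
  assumes neg: "\<alpha>\<^sup>2 + 4 * \<gamma> * \<delta> < 0"
    and Ws: "W_surface D z l I f g \<nu>" and D: "open D" and p: "p \<in> D"
    and ne: "curv1 z l p \<noteq> curv2 z l p"
    and rel: "\<And>q. q \<in> D \<Longrightarrow> \<delta> * (curv1 z l q * curv2 z l q) = \<alpha> * ((curv1 z l q + curv2 z l q) / 2)
      + \<beta> * ((curv1 z l q - curv2 z l q) / 2) + \<gamma>"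
    and def: "(2 * \<gamma> + \<alpha> * curv1 z l p) * (2 * \<gamma> + \<alpha> * curv2 z l p) \<noteq> 0"
  shows "locally_basic D z l I f g \<nu> p"
proof -
  let ?k = "curv1 z l" and ?m = "curv2 z l"
  have \<gamma>: "\<gamma> \<noteq> 0" using neg by auto
  define a where "a = - \<alpha> / (2 * \<gamma>)"
  define d where "d = \<delta> - a * \<alpha> - \<gamma> * a\<^sup>2"
  have A: "\<alpha> + 2 * a * \<gamma> = 0" using \<gamma> by (simp add: a_def)
  \<comment> \<open>The discriminant is invariant, and A = 0 now, so its negativity becomes
    \<gamma>/d < 0: the sign condition of class (10), and for \<beta> = 0 the negativity of
    K.\<close>
  have "4 * \<gamma> * d = \<alpha>\<^sup>2 + 4 * \<gamma> * \<delta>" using \<gamma> by (simp add: d_def a_def power2_eq_square field_simps)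
  then have gd: "\<gamma> * d < 0" using neg by simp
  then have d: "d \<noteq> 0" and gd': "\<gamma> / d < 0" by (auto simp: mult_less_0_iff divide_less_0_iff)
  have ap: "1 - a * ?k p \<noteq> 0" "1 - a * ?m p \<noteq> 0"
  proof -
    have "1 - a * t = (2 * \<gamma> + \<alpha> * t) / (2 * \<gamma>)" for t using \<gamma> by (simp add: a_def field_simps)
    then show "1 - a * ?k p \<noteq> 0" "1 - a * ?m p \<noteq> 0" using def \<gamma> by simp_all
  qed
  have r: "X * Y = \<beta> / d * ((X - Y) / 2) + \<gamma> / d"
    if "q \<in> D" "1 - a * ?k q \<noteq> 0" "1 - a * ?m q \<noteq> 0" "X = ?k q / (1 - a * ?k q)" "Y = ?m q / (1 - a * ?m q)" for q X Y
    using parallel_curvature_relation[OF rel[OF that(1)] that(2-5)] d unfolding d_def[symmetric] A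
    by (simp add: field_simps)
  define b where "b = (if \<beta> = 0 then Basic8 else Basic10 (\<beta> / d) (\<gamma> / d))"
  \<comment> \<open>For \<beta> = 0 the constant curvature K = \<gamma>/d is scaled to -1; class
    (10) keeps both constants and needs no scaling.\<close>
  define \<mu> where "\<mu> = (if \<beta> = 0 then sqrt (- (d / \<gamma>)) else 1)"
  have dg: "- (d / \<gamma>) > 0" using gd by (auto simp: divide_less_0_iff mult_less_0_iff)
  have ad: "admissible b" and \<mu>: "\<mu> \<noteq> 0" using d gd' dg by (auto simp: b_def \<mu>_def)
  have sc: "scaled_rel b \<mu> X Y" if "X * Y = \<beta> / d * ((X - Y) / 2) + \<gamma> / d" for X Y
  proof (cases "\<beta> = 0")
    case True
    then have XY: "X * Y = \<gamma> / d" using that by simp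
    have "\<mu> * X * (\<mu> * Y) = \<mu>\<^sup>2 * (X * Y)" by (simp add: power2_eq_square mult_ac)
    also have "\<dots> = \<mu>\<^sup>2 * (\<gamma> / d)" unfolding XY ..
    also have "\<dots> = - 1" using True dg d \<gamma> by (simp add: \<mu>_def)
    finally show ?thesis using True by (simp add: b_def)
  next
    case False
    then show ?thesis using that by (simp add: b_def \<mu>_def)
  qed
  let ?X = "?k p / (1 - a * ?k p)" and ?Y = "?m p / (1 - a * ?m p)"
  have "?X \<noteq> ?Y" using ap ne by (simp add: divide_simps) (simp add: algebra_simps)
  then have m: "\<mu> * ?X \<noteq> \<mu> * ?Y" using mult_left_cancel[OF \<mu>] by blast
  have "basic_param b (\<mu> * ?X) (\<mu> * ?Y) \<in> basic_dom b"
    using basic_rel_iff[OF ad m sc[OF r[OF p ap refl refl]]] by blast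
  then have range: "basic_param b (\<mu> * ?X) (\<mu> * ?Y) \<in> unknown_range b" by (auto simp: b_def)
  show ?thesis
  proof (rule locally_basicI[OF Ws D order_refl p ad \<mu> _ ap refl refl])
    fix q X Y
    assume "q \<in> D" "1 - a * ?k q \<noteq> 0" "1 - a * ?m q \<noteq> 0"
      and XY: "X = \<mu> * (?k q / (1 - a * ?k q))" "Y = \<mu> * (?m q / (1 - a * ?m q))"
    then show "basic_rel b (X * Y) ((X + Y) / 2) ((X - Y) / 2)"
      unfolding XY by (intro sc r[OF _ _ _ refl refl])
  qed (use range in blast)
qed

section \<open>Constant principal curvatures and degenerate parallel surfaces\<close>

text \<open>Constant distinct curvatures have constant non-zero H', which a scaling turns into 1, so
  the surface itself belongs to class (3).\<close>

lemma locally_basic_constant: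
  assumes Ws: "W_surface D z l I f g \<nu>" and N: "open N" "N \<subseteq> D" "p \<in> N"
    and const: "\<And>q. q \<in> N \<Longrightarrow> \<nu> q = \<nu> p"
  shows "locally_basic D z l I f g \<nu> p"
proof -
  have W: "W_functions I f g" "\<And>q. q \<in> D \<Longrightarrow> \<nu> q \<in> I \<and> curv1 z l q = f (\<nu> q) \<and> curv2 z l q = g (\<nu> q)"
    using Ws unfolding W_surface_def by blast+
  have k: "curv1 z l q = f (\<nu> p)" "curv2 z l q = g (\<nu> p)" if "q \<in> N" for q
    using W(2)[of q] N that const[OF that] by auto
  have ne: "f (\<nu> p) - g (\<nu> p) \<noteq> 0" using W N unfolding W_functions_def by blast
  define \<mu> where "\<mu> = 2 / (f (\<nu> p) - g (\<nu> p))"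
  have "\<mu> * f (\<nu> p) - \<mu> * g (\<nu> p) = \<mu> * (f (\<nu> p) - g (\<nu> p))" by (simp only: right_diff_distrib)
  also have "\<dots> = 2" 
  proof -
    have "2 / t * t = 2" if "t \<noteq> 0" for t :: real using that by simp
    then show ?thesis unfolding \<mu>_def using ne by blast
  qed
  finally have \<mu>: "\<mu> \<noteq> 0" "\<mu> * f (\<nu> p) - \<mu> * g (\<nu> p) = 2" by auto
  show ?thesis
    by (rule locally_basicI[OF Ws N _ \<mu>(1), where a=0 and b=Basic3]) (use k N \<mu> in auto)
qed

text \<open>By the mean value theorem, since f' has no zero on the interval. It limits each
  curvature to at most one parameter value for a given number.\<close>

lemma W_functions_inj_on:
  assumes W: "W_functions I f g"
  shows "inj_on f I"
proof (rule inj_onI)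
  have neq: "f x \<noteq> f y" if xy: "x \<in> I" "y \<in> I" "x < y" for x y
  proof
    assume "f x = f y"
    have sub: "t \<in> I" if "x \<le> t" "t \<le> y" for t
      using W mem_is_interval_1_I[of I x y t] xy that unfolding W_functions_def by blast
    then have "\<And>t. x \<le> t \<Longrightarrow> t \<le> y \<Longrightarrow> (f has_real_derivative deriv f t) (at t)"
      using W_functions_DERIV(1)[OF W] by blast
    from MVT2[OF xy(3) this] obtain t where "t > x" "t < y" "f y - f x = (y - x) * deriv f t" by blast
    then have "deriv f t = 0" "t \<in> I" using \<open>f x = f y\<close> xy sub by auto
    then show False using W unfolding W_functions_def by auto
  qed
  fix x y assume "x \<in> I" "y \<in> I" "f x = f y"
  then show "x = y" using neq[of x y] neq[of y x] by (cases x y rule: linorder_cases) auto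
qed

text \<open>Where the parallel surface of the elliptic case degenerates on an open set, both principal
  curvatures are constant there, so the surface is (up to scale) itself in class (3).\<close>

lemma locally_basic_degenerate:
  assumes Ws: "W_surface D z l I f g \<nu>" and N: "open N" "N \<subseteq> D" "p \<in> N" and \<gamma>: "\<gamma> \<noteq> 0"
    and deg: "\<And>q. q \<in> N \<Longrightarrow> (2 * \<gamma> + \<alpha> * curv1 z l q) * (2 * \<gamma> + \<alpha> * curv2 z l q) = 0"
  shows "locally_basic D z l I f g \<nu> p"
proof -
  from openE[OF N(1,3)] obtain e where e: "e > 0" "ball p e \<subseteq> N" .
  have W: "W_functions I f g" "\<And>q. q \<in> D \<Longrightarrow> \<nu> q \<in> I \<and> curv1 z l q = f (\<nu> q) \<and> curv2 z l q = g (\<nu> q)"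
    and \<nu>: "continuous_on D \<nu>"
    using Ws smooth2_onD(4) unfolding W_surface_def by blast+
  \<comment> \<open>By injectivity this set has at most two elements, while \<nu> maps a ball to a
    connected subset of it, hence to a single point.\<close>
  define R where "R = {x \<in> I. f x = - 2 * \<gamma> / \<alpha>} \<union> {x \<in> I. g x = - 2 * \<gamma> / \<alpha>}"
  have "finite (f -` {- 2 * \<gamma> / \<alpha>} \<inter> I)" "finite (g -` {- 2 * \<gamma> / \<alpha>} \<inter> I)"
    using W_functions_inj_on W(1) W_functions_commute[OF W(1)]
    by (blast intro: finite_vimage_IntI)+
  then have "finite R" by (auto simp: R_def vimage_def Int_def conj_commute)
  moreover have "\<nu> ` ball p e \<subseteq> R"
  proof (rule image_subsetI)
    fix q assume "q \<in> ball p e"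
    then have q: "q \<in> N" "q \<in> D" using e N by auto
    have "\<alpha> \<noteq> 0" using deg[OF q(1)] \<gamma> by auto
    have "2 * \<gamma> + \<alpha> * f (\<nu> q) = 0 \<or> 2 * \<gamma> + \<alpha> * g (\<nu> q) = 0" using deg[OF q(1)] W(2)[OF q(2)] by auto
    then have "f (\<nu> q) = - 2 * \<gamma> / \<alpha> \<or> g (\<nu> q) = - 2 * \<gamma> / \<alpha>"
      using \<open>\<alpha> \<noteq> 0\<close> by (simp add: field_simps) linarith
    then show "\<nu> q \<in> R" using W(2)[OF q(2)] by (auto simp: R_def)
  qed
  ultimately have "finite (\<nu> ` ball p e)" by (rule rev_finite_subset)
  moreover have "connected (\<nu> ` ball p e)"
    using continuous_on_subset[OF \<nu>] e N by (intro connected_continuous_image) auto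
  ultimately have "\<nu> ` ball p e = {} \<or> (\<exists>c. \<nu> ` ball p e = {c})"
    using connected_finite_iff_sing by blast
  then have const: "\<nu> q = \<nu> p" if "q \<in> ball p e" for q
    using that e(1) by (metis centre_in_ball empty_iff imageI singletonD)
  show ?thesis
    by (rule locally_basic_constant[OF Ws open_ball _ _ const]) (use e N in auto)
qed

theorem theorem5p2:
  fixes \<alpha> \<beta> \<gamma> \<delta> :: real
  assumes disc: "\<alpha>\<^sup>2 - \<beta>\<^sup>2 + 4 * \<gamma> * \<delta> \<noteq> 0"
  shows
    "(\<forall>D z l I f g \<nu>.
        W_surface D z l I f g \<nu> \<and>
        (\<forall>p\<in>D. \<delta> * curv_K z l p = \<alpha> * curv_H z l p + \<beta> * curv_H' z l p + \<gamma>) \<longrightarrow>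
        (\<exists>Q\<subseteq>D. open Q \<and> D \<subseteq> closure Q \<and>
           {p\<in>D. parallel_defined \<alpha> \<gamma> \<delta> z l p} \<subseteq> Q \<and>
           (\<forall>p\<in>Q. locally_basic D z l I f g \<nu> p))) \<and>
     (\<forall>b I f g. basic_functions b I f g \<and> I \<subseteq> unknown_subst b ` unknown_dom b \<longrightarrow>
        natural_pde_is_listed b I f g)"
proof (intro conjI allI impI)
  fix b I f g
  assume "basic_functions b I f g \<and> I \<subseteq> unknown_subst b ` unknown_dom b"
  then show "natural_pde_is_listed b I f g" using natural_pde_basic by blast
next
  fix D z l I f g \<nu>
  assume asm: "W_surface D z l I f g \<nu> \<and>
    (\<forall>p\<in>D. \<delta> * curv_K z l p = \<alpha> * curv_H z l p + \<beta> * curv_H' z l p + \<gamma>)"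
  then have Ws: "W_surface D z l I f g \<nu>" by blast
  then have ps: "principal_surface D z l" and W: "W_functions I f g"
    and k: "\<And>q. q \<in> D \<Longrightarrow> \<nu> q \<in> I \<and> curv1 z l q = f (\<nu> q) \<and> curv2 z l q = g (\<nu> q)"
    unfolding W_surface_def by blast+
  have D: "open D" by (rule principal_surfaceD(1)[OF ps])
  have rel: "\<delta> * (curv1 z l q * curv2 z l q) = \<alpha> * ((curv1 z l q + curv2 z l q) / 2)
      + \<beta> * ((curv1 z l q - curv2 z l q) / 2) + \<gamma>" if "q \<in> D" for q
    using asm that unfolding curv_K_def curv_H_def curv_H'_def by blast
  have ne: "curv1 z l q \<noteq> curv2 z l q" if "q \<in> D" for q
    using W k[OF that] unfolding W_functions_def by auto
  show "\<exists>Q\<subseteq>D. open Q \<and> D \<subseteq> closure Q \<and> {p\<in>D. parallel_defined \<alpha> \<gamma> \<delta> z l p} \<subseteq> Q \<and>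
      (\<forall>p\<in>Q. locally_basic D z l I f g \<nu> p)"
  proof (cases "\<alpha>\<^sup>2 + 4 * \<gamma> * \<delta> \<ge> 0")
    case True
    then have "locally_basic D z l I f g \<nu> p" if "p \<in> D" for p
      using locally_basic_hyperbolic[OF disc _ Ws D that ne[OF that] rel] by blast
    then show ?thesis using D closure_subset by (intro exI[of _ D]) blast
  next
    case False
    then have neg: "\<alpha>\<^sup>2 + 4 * \<gamma> * \<delta> < 0" by simp
    then have \<gamma>: "\<gamma> \<noteq> 0" by auto
    let ?h = "\<lambda>q. (2 * \<gamma> + \<alpha> * curv1 z l q) * (2 * \<gamma> + \<alpha> * curv2 z l q)"
    define S where "S = {q \<in> D. ?h q \<noteq> 0}"
    have "continuous_on D ?h"
      using smooth2_on_curv[OF ps, THEN smooth2_onD(4)] by (auto intro!: continuous_intros)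
    then have oS: "open S"
      using continuous_open_preimage[OF _ D, of ?h "- {0}"] by (simp add: S_def Int_def vimage_def open_Compl)
    \<comment> \<open>Only boundary points of \<open>S\<close> are left out: on \<open>S\<close> the
      elliptic argument works, on the interior of the complement the degenerate one. The union is
      dense because \<open>D\<close> is open.\<close>
    define Q where "Q = S \<union> interior (D - S)"
    have "Q \<subseteq> D" using interior_subset[of "D - S"] by (auto simp: Q_def S_def)
    moreover have "open Q" using oS by (simp add: Q_def open_Un)
    moreover have "D \<subseteq> closure Q"
    proof
      fix p assume p: "p \<in> D"
      show "p \<in> closure Q"
      proof (cases "p \<in> closure S")
        case True
        then show ?thesis using closure_mono[of S Q] by (auto simp: Q_def)
      next
        case False
        have "open (D \<inter> - closure S)" using D by auto
        moreover have "D \<inter> - closure S \<subseteq> D - S" using closure_subset by blast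
        ultimately have "D \<inter> - closure S \<subseteq> interior (D - S)" by (rule interior_maximal[rotated])
        then show ?thesis using p False closure_subset[of Q] by (auto simp: Q_def)
      qed
    qed
    moreover have "{p\<in>D. parallel_defined \<alpha> \<gamma> \<delta> z l p} \<subseteq> Q"
      using False by (auto simp: Q_def S_def parallel_defined_def)
    moreover have "locally_basic D z l I f g \<nu> p" if "p \<in> Q" for p
    proof (cases "p \<in> S")
      case True
      then have p: "p \<in> D" and h: "?h p \<noteq> 0" by (auto simp: S_def)
      show ?thesis by (rule locally_basic_elliptic[OF neg Ws D p ne[OF p] rel h])
    next
      case False
      then have p: "p \<in> interior (D - S)" using that by (simp add: Q_def)
      have N: "open (interior (D - S))" "interior (D - S) \<subseteq> D" using interior_subset[of "D - S"] by auto
      have "?h q = 0" if "q \<in> interior (D - S)" for q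
        using that interior_subset[of "D - S"] by (auto simp: S_def)
      then show ?thesis by (rule locally_basic_degenerate[OF Ws N p \<gamma>])
    qed
    ultimately show ?thesis by blast
  qed
qed

end
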